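(* Assume the Riemann hypothesis, and fix $\alpha>0$. There are constants $C>0$ and $K>0$ depending only on $\alpha$ such that for all $x\geq 2$ and $T\geq 2$, $$ \frac{1}{T}\,\mathrm{meas}\Big\{ t\in [T,2T]: \frac{1}{\log T} \Big|\frac{\zeta'}{\zeta}\Big(\frac{1}{2}+\frac{\alpha}{\log T} + it\Big)\Big| \geq x \Big\} \leq K e^{-C x \log x}. $$
   Context: $\zeta$ is the Riemann zeta function and $\mathrm{meas}$ denotes Lebesgue measure. *)

theory Defs
  imports "HOL-Complex_Analysis.Complex_Analysis"
begin

text \<open>The normalisation at the pole \<open>1\<close> only serves to make the function unique.\<close>

definition zeta :: "complex \<Rightarrow> complex" where
  "zeta = (THE f. f holomorphic_on - {1} \<and> f 1 = 0 \<and>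
     (\<forall>s. Re s > 1 \<longrightarrow> f s = (\<Sum>n. 1 / of_nat (Suc n) powr s)))"

definition riemann_hypothesis :: bool where
  "riemann_hypothesis \<longleftrightarrow>
     (\<forall>s. s \<noteq> 1 \<and> zeta s = 0 \<and> \<not> (\<exists>n::nat. n \<ge> 1 \<and> s = - 2 * of_nat n) \<longrightarrow> Re s = 1 / 2)"

text \<open>
  The description defining \<open>zeta\<close> denotes: expanding \<open>(n + 1) powr (1 - s)\<close> around \<open>n\<close>
  and summing over \<open>n\<close> continues \<open>(s - 1) * zeta s\<close> by one unit to the left at a time.
\<close>

lemma taylor_bound:
  fixes a :: complex and u :: real
  assumes u: "0 \<le> u" "u \<le> 1"
  shows "norm (of_real (1+u) powr a - (\<Sum>j\<le>m. (a gchoose j) * of_real u ^ j))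
     \<le> (fact (Suc m) * norm (a gchoose Suc m) * 2 powr (norm a)) * u ^ Suc m"
proof -
  define S where "S = closed_segment 0 (1::complex)"
  define f where "f = (\<lambda>i z. fact i * (a gchoose i) * (1+z) powr (a - of_nat i) :: complex)"
  define B where "B = fact (Suc m) * norm (a gchoose Suc m) * 2 powr (norm a)"
  have S: "\<exists>x. z = of_real x \<and> 0 \<le> x \<and> x \<le> 1" if "z \<in> S" for z
    using that by (auto simp: S_def closed_segment_def scaleR_conv_of_real)
  have "norm (f 0 (of_real u) - (\<Sum>i\<le>m. f i 0 * (of_real u - 0) ^ i / fact i))
      \<le> B * norm (of_real u - 0 :: complex) ^ Suc m / fact m"
  proof (rule complex_Taylor)
    show "convex S" by (simp add: S_def)
    show "0 \<in> S" by (simp add: S_def)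
    show "of_real u \<in> S" using u by (auto simp: S_def closed_segment_def scaleR_conv_of_real)
    fix z assume "z \<in> S"
    then obtain x where x: "z = of_real x" "0 \<le> x" "x \<le> 1" using S by blast
    have eq: "1 + z = of_real (1+x)" using x by simp
    have nn: "1 + z \<notin> \<real>\<^sub>\<le>\<^sub>0" using x unfolding eq by (simp add: complex_nonpos_Reals_iff)
    show "(f i has_field_derivative f (Suc i) z) (at z within S)" if "i \<le> m" for i
    proof -
      have g: "(fact (Suc i) :: complex) * (a gchoose Suc i) = fact i * (a gchoose i) * (a - of_nat i)"
      proof -
        have "of_nat (Suc i) * (a gchoose Suc i) = (a - of_nat i) * (a gchoose i)"
          using gbinomial_absorb_comp[of a i] gbinomial_absorption[of i a] by simp
        hence "fact i * (of_nat (Suc i) * (a gchoose Suc i)) = fact i * ((a - of_nat i) * (a gchoose i))"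
          by simp
        thus ?thesis by (simp only: fact_Suc mult_ac)
      qed
      have "(f i has_field_derivative (fact i * (a gchoose i)) * ((a - of_nat i) * (1+z) powr (a - of_nat i - 1))) (at z within S)"
        unfolding f_def using nn
        by (auto intro!: derivative_eq_intros)
      also have "(fact i * (a gchoose i)) * ((a - of_nat i) * (1+z) powr (a - of_nat i - 1)) = f (Suc i) z"
        unfolding f_def g by (simp add: algebra_simps)
      finally show ?thesis .
    qed
    have "norm ((1+z) powr (a - of_nat (Suc m))) = (1+x) powr (Re a - Suc m)"
      unfolding eq using x by (subst norm_powr_real_powr) auto
    also have "\<dots> \<le> (1+x) powr norm a"
      using x complex_Re_le_cmod[of a] by (intro powr_mono) auto
    also have "\<dots> \<le> 2 powr norm a" using x by (intro powr_mono2) auto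
    finally show "norm (f (Suc m) z) \<le> B" unfolding f_def B_def norm_mult norm_fact
      by (intro mult_mono) (auto simp del: fact_Suc)
  qed
  also have "\<dots> \<le> B * u ^ Suc m"
  proof -
    have "B * u ^ Suc m \<ge> 0" using u by (auto simp: B_def)
    moreover have "fact m \<ge> (1::real)" by simp
    ultimately have "B * u ^ Suc m / fact m \<le> B * u ^ Suc m / 1"
      by (intro divide_left_mono) auto
    thus ?thesis using u by simp
  qed
  also have "f 0 (of_real u) = of_real (1+u) powr a" by (simp add: f_def)
  also have "(\<Sum>i\<le>m. f i 0 * (of_real u - 0) ^ i / fact i) = (\<Sum>j\<le>m. (a gchoose j) * of_real u ^ j)"
    by (simp add: f_def)
  finally show ?thesis by (simp only: B_def)
qed

lemma local_series_holomorphic: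
  fixes g :: "nat \<Rightarrow> complex \<Rightarrow> complex"
  assumes "open S" "\<And>n. g n holomorphic_on S"
    and "\<And>s. s \<in> S \<Longrightarrow> \<exists>d>0. \<exists>B\<ge>0. \<exists>e>1. \<forall>n. \<forall>y\<in>ball s d. norm (g n y) \<le> B * real (Suc n) powr (- e)"
  obtains G where "G holomorphic_on S" "\<And>s. s \<in> S \<Longrightarrow> (\<lambda>n. g n s) sums G s"
proof -
  have "\<exists>d h. 0 < d \<and> summable h \<and> range h \<subseteq> \<real>\<^sub>\<ge>\<^sub>0 \<and>
      (\<forall>\<^sub>F n in sequentially. \<forall>y\<in>ball x d \<inter> S. cmod (g n y) \<le> cmod (h n))" if "x \<in> S" for x
  proof -
    from assms(3)[OF that] obtain d B e where
      *: "d > 0" "B \<ge> 0" "e > 1" "\<And>n y. y\<in>ball x d \<Longrightarrow> norm (g n y) \<le> B * real (Suc n) powr (- e)" by blast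
    have "summable (\<lambda>n. real (Suc n) powr (-e))"
      using *(3) by (subst summable_Suc_iff) (simp add: summable_real_powr_iff)
    hence 1: "summable (\<lambda>n. complex_of_real (B * real (Suc n) powr (-e)))"
      by (intro summable_of_real summable_mult)
    show ?thesis
    proof (intro exI[of _ d] exI[of _ "\<lambda>n. complex_of_real (B * real (Suc n) powr (-e))"] conjI)
      show "range (\<lambda>n. complex_of_real (B * real (Suc n) powr (-e))) \<subseteq> \<real>\<^sub>\<ge>\<^sub>0"
        using *(2) by (auto simp del: of_real_mult)
      show "\<forall>\<^sub>F n in sequentially. \<forall>y\<in>ball x d \<inter> S. cmod (g n y) \<le> cmod (complex_of_real (B * real (Suc n) powr (-e)))"
        using *(4) *(2) by (intro always_eventually) (auto simp del: of_real_mult)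
    qed (use 1 * in auto)
  qed
  from series_differentiable_comparison_complex[OF assms(1) _ this] assms(1,2)
  obtain G where "\<forall>x\<in>S. (\<lambda>n. g n x) sums G x \<and> G field_differentiable at x"
    using holomorphic_on_imp_differentiable_at by metis
  thus ?thesis using that assms(1) by (auto simp: holomorphic_on_open field_differentiable_def)
qed


lemma norm_Suc_powr: "norm (of_nat (Suc n) powr (s::complex)) = real (Suc n) powr Re s"
  by (subst norm_powr_real_powr) (auto simp flip: of_nat_Suc)

lemma Re_ball_bound: "y \<in> ball s d \<Longrightarrow> Re y > Re s - d"
  using abs_Re_le_cmod[of "s - y"] by (auto simp: dist_norm)

definition dirichlet_series_one :: "complex \<Rightarrow> complex" where
  "dirichlet_series_one s = (\<Sum>n. 1 / of_nat (Suc n) powr s)"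

lemma dirichlet_series_one_holomorphic: "dirichlet_series_one holomorphic_on {s. Re s > 1}"
  and dirichlet_series_one_sums:
    "Re s > 1 \<Longrightarrow> (\<lambda>n. of_nat (Suc n) powr (- s)) sums dirichlet_series_one s"
proof -
  have op: "open {s. Re s > 1}" by (simp add: open_halfspace_Re_gt)
  have hol: "(\<lambda>s. of_nat (Suc n) powr (- s)) holomorphic_on {s. Re s > 1}" for n
    by (intro holomorphic_intros) (auto simp flip: of_nat_Suc)
  have bd: "\<exists>d>0. \<exists>B\<ge>0. \<exists>e>1. \<forall>n. \<forall>y\<in>ball s d. norm (of_nat (Suc n) powr (- y) :: complex) \<le> B * real (Suc n) powr (- e)"
    if "s \<in> {s. Re s > 1}" for s
  proof (rule exI[of _ "(Re s - 1) / 2"], intro conjI, goal_cases)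
    case 2
    show ?case
    proof (rule exI[of _ 1], intro conjI exI[of _ "1 + (Re s - 1)/2"] allI ballI, goal_cases)
      case (3 n y)
      have "Re y > 1 + (Re s - 1)/2" using Re_ball_bound[OF 3] by (simp add: field_simps)
      thus ?case unfolding norm_Suc_powr by (simp add: powr_mono)
    qed (use that in auto)
  qed (use that in auto)
  obtain G where G: "G holomorphic_on {s. Re s > 1}"
    "\<And>s. s \<in> {s. Re s > 1} \<Longrightarrow> (\<lambda>n. of_nat (Suc n) powr (- s)) sums G s"
    using local_series_holomorphic[of "{s. Re s > 1}" "\<lambda>n s. of_nat (Suc n) powr (- s)", OF op hol bd] by blast
  have eq: "dirichlet_series_one s = G s" if "Re s > 1" for s
    using G(2)[of s] that by (simp add: dirichlet_series_one_def sums_iff powr_minus_divide)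
  show "dirichlet_series_one holomorphic_on {s. Re s > 1}"
    using G(1) eq by (subst holomorphic_cong[OF refl, of _ _ G]) auto
  show "Re s > 1 \<Longrightarrow> (\<lambda>n. of_nat (Suc n) powr (- s)) sums dirichlet_series_one s"
    using G(2)[of s] eq[of s] by auto
qed

lemma holomorphic_gbinomial:
  "(\<lambda>s::complex. (1 - s) gchoose k) holomorphic_on A"
  unfolding gbinomial_prod_rev by (intro holomorphic_intros) auto

definition zeta_remainder :: "nat \<Rightarrow> nat \<Rightarrow> complex \<Rightarrow> complex" where
  "zeta_remainder m n s = of_nat (Suc (Suc n)) powr (1 - s)
     - (\<Sum>j\<le>m. ((1 - s) gchoose j) * of_nat (Suc n) powr (1 - s - of_nat j))"

lemma zeta_remainder_bound:
  "norm (zeta_remainder m n s) \<le>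
     fact (Suc m) * norm ((1 - s) gchoose Suc m) * 2 powr norm (1 - s) * real (Suc n) powr (- Re s - real m)"
proof -
  define u where "u = 1 / real (Suc n)"
  define N where "N = (of_nat (Suc n) :: complex)"
  have N0: "N \<noteq> 0" unfolding N_def by (simp del: of_nat_Suc)
  have Nr: "N = of_real (real (Suc n))" by (simp add: N_def)
  have u: "0 \<le> u" "u \<le> 1" by (auto simp: u_def)
  have N2: "of_nat (Suc (Suc n)) = of_real (real (Suc n)) * (of_real (1 + u) :: complex)"
  proof -
    have "real (Suc (Suc n)) = real (Suc n) * (1 + u)" by (simp add: u_def field_simps)
    thus ?thesis by (metis of_real_mult of_real_of_nat_eq)
  qed
  have 1: "of_nat (Suc (Suc n)) powr (1 - s) = N powr (1 - s) * of_real (1+u) powr (1 - s)"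
    unfolding N2 Nr using u by (subst powr_times_real) auto
  have 2: "N powr (1 - s - of_nat j) = N powr (1 - s) * of_real u ^ j" for j
    using N0 by (subst powr_diff) (simp add: powr_nat' N_def u_def power_one_over divide_inverse power_inverse del: of_nat_Suc)
  have "zeta_remainder m n s = N powr (1 - s) * (of_real (1+u) powr (1 - s) - (\<Sum>j\<le>m. ((1 - s) gchoose j) * of_real u ^ j))"
    unfolding zeta_remainder_def N_def[symmetric] 1 2
    by (simp add: algebra_simps sum_distrib_left)
  also have "norm \<dots> \<le> real (Suc n) powr (1 - Re s) * ((fact (Suc m) * norm ((1-s) gchoose Suc m) * 2 powr (norm (1-s))) * u ^ Suc m)"
    unfolding norm_mult
    using taylor_bound[OF u, of "1 - s" m] norm_Suc_powr[of n "1 - s"]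
    by (intro mult_mono) (auto simp: N_def)
  also have "u ^ Suc m = real (Suc n) powr (- real (Suc m))"
    unfolding u_def by (simp add: powr_minus_divide powr_realpow power_one_over del: of_nat_Suc power_Suc)
  also have "real (Suc n) powr (1 - Re s) * ((fact (Suc m) * norm ((1-s) gchoose Suc m) * 2 powr (norm (1-s))) * real (Suc n) powr (- real (Suc m)))
     = fact (Suc m) * norm ((1 - s) gchoose Suc m) * 2 powr norm (1 - s) * (real (Suc n) powr (1 - Re s) * real (Suc n) powr (- real (Suc m)))"
    by (simp only: mult_ac)
  also have "real (Suc n) powr (1 - Re s) * real (Suc n) powr (- real (Suc m)) = real (Suc n) powr (- Re s - real m)"
    by (subst powr_add[symmetric]) (simp add: algebra_simps)
  finally show ?thesis .
qed

lemma zeta_remainder_sum_holomorphic: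
  obtains G where "G holomorphic_on {s. Re s > - real M}"
    "\<And>s. Re s > - real M \<Longrightarrow> (\<lambda>n. zeta_remainder (Suc M) n s) sums G s"
proof -
  let ?S = "{s. Re s > - real M}"
  have op: "open ?S" by (simp add: open_halfspace_Re_gt)
  have hol: "zeta_remainder (Suc M) n holomorphic_on ?S" for n
    unfolding zeta_remainder_def
    by (intro holomorphic_intros holomorphic_gbinomial) (auto simp flip: of_nat_Suc)
  have bd: "\<exists>d>0. \<exists>B\<ge>0. \<exists>e>1. \<forall>n. \<forall>y\<in>ball s d. norm (zeta_remainder (Suc M) n y) \<le> B * real (Suc n) powr (- e)"
    if s: "s \<in> ?S" for s
  proof -
    define d where "d = (Re s + real M) / 2"
    have d: "d > 0" using s by (auto simp: d_def)
    define \<phi> where "\<phi> = (\<lambda>y::complex. fact (Suc (Suc M)) * norm ((1 - y) gchoose Suc (Suc M)) * 2 powr norm (1 - y) :: real)"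
    have "continuous_on (cball s d) \<phi>"
      unfolding \<phi>_def
      by (intro continuous_intros holomorphic_on_imp_continuous_on holomorphic_gbinomial) auto
    hence "compact (\<phi> ` cball s d)" by (intro compact_continuous_image) auto
    then obtain B where B: "\<And>y. y \<in> cball s d \<Longrightarrow> norm (\<phi> y) \<le> B"
      unfolding compact_eq_bounded_closed bounded_iff by blast
    have B0: "B \<ge> 0" using B[of s] d norm_ge_zero[of "\<phi> s"] by (simp only: centre_in_cball) linarith
    have "norm (zeta_remainder (Suc M) n y) \<le> B * real (Suc n) powr (- (1 + d))" if y: "y \<in> ball s d" for n y
    proof -
      have "Re y > Re s - d" using Re_ball_bound[OF y] .
      hence e: "- Re y - real (Suc M) \<le> - (1 + d)" by (simp add: d_def field_simps)
      have "norm (zeta_remainder (Suc M) n y) \<le> \<phi> y * real (Suc n) powr (- Re y - real (Suc M))"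
        using zeta_remainder_bound[of "Suc M" n y] by (simp only: \<phi>_def)
      also have "\<dots> \<le> B * real (Suc n) powr (- (1 + d))"
        using B[of y] y B0 e by (intro mult_mono powr_mono) auto
      finally show ?thesis .
    qed
    thus ?thesis using d B0 by (intro exI[of _ d] conjI exI[of _ B] exI[of _ "1+d"]) auto
  qed
  show ?thesis
    using local_series_holomorphic[OF op hol bd] that by auto
qed

lemma zeta_remainder_sum:
  assumes s: "Re s > 1"
  shows "(\<lambda>n. zeta_remainder (Suc M) n s) sums
    (- 1 + (s - 1) * dirichlet_series_one s
      - (\<Sum>j=2..Suc M. ((1 - s) gchoose j) * dirichlet_series_one (s + of_nat j - 1)))"
proof -
  have lim: "(\<lambda>n. of_nat (Suc n) powr (1 - s)) \<longlonglongrightarrow> (0::complex)"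
  proof (rule tendsto_norm_zero_cancel)
    have "(\<lambda>n. real n powr (1 - Re s)) \<longlonglongrightarrow> 0"
      using s by (intro tendsto_neg_powr filterlim_real_sequentially) auto
    hence "(\<lambda>n. real (Suc n) powr (1 - Re s)) \<longlonglongrightarrow> 0" by (rule LIMSEQ_Suc)
    thus "(\<lambda>n. norm (of_nat (Suc n) powr (1 - s) :: complex)) \<longlonglongrightarrow> 0"
      unfolding norm_Suc_powr by simp
  qed
  have 1: "(\<lambda>n. of_nat (Suc (Suc n)) powr (1 - s) - of_nat (Suc n) powr (1 - s)) sums (0 - 1 :: complex)"
    using telescope_sums[OF lim] by simp
  have 2: "(\<lambda>n. \<Sum>j=1..Suc M. ((1 - s) gchoose j) * of_nat (Suc n) powr (1 - s - of_nat j)) sums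
     (\<Sum>j=1..Suc M. ((1 - s) gchoose j) * dirichlet_series_one (s + of_nat j - 1))"
  proof (intro sums_sum sums_mult)
    fix j assume "j \<in> {1..Suc M}"
    hence "Re (s + of_nat j - 1) > 1" using s by auto
    from dirichlet_series_one_sums[OF this]
    show "(\<lambda>n. of_nat (Suc n) powr (1 - s - of_nat j)) sums dirichlet_series_one (s + of_nat j - 1)"
      by (simp add: algebra_simps)
  qed
  have 3: "(\<Sum>j=1..Suc M. f j) = f 1 + (\<Sum>j=2..Suc M. f j)" for f :: "nat \<Rightarrow> complex"
    by (subst sum.atLeast_Suc_atMost) (auto simp: numeral_2_eq_2)
  have 4: "(\<Sum>j\<le>Suc M. f j) = f 0 + (\<Sum>j=1..Suc M. f j)" for f :: "nat \<Rightarrow> complex"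
    unfolding atMost_atLeast0 by (subst sum.atLeast_Suc_atMost) auto
  have "(\<lambda>n. zeta_remainder (Suc M) n s) =
    (\<lambda>n. (of_nat (Suc (Suc n)) powr (1 - s) - of_nat (Suc n) powr (1 - s))
      - (\<Sum>j=1..Suc M. ((1 - s) gchoose j) * of_nat (Suc n) powr (1 - s - of_nat j)))"
    unfolding zeta_remainder_def 4 by (simp add: algebra_simps)
  also have "\<dots> sums (0 - 1 - (\<Sum>j=1..Suc M. ((1 - s) gchoose j) * dirichlet_series_one (s + of_nat j - 1)))"
    by (intro sums_diff[OF 1 2])
  also have "\<dots> = - 1 + (s - 1) * dirichlet_series_one s
      - (\<Sum>j=2..Suc M. ((1 - s) gchoose j) * dirichlet_series_one (s + of_nat j - 1))"
    unfolding 3 by (simp add: algebra_simps)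
  finally show ?thesis .
qed

lemma zeta_continuation_aux:
  "\<exists>Z. Z holomorphic_on {s. Re s > 1 - real M} \<and>
     (\<forall>s. Re s > 1 \<longrightarrow> Z s = (s - 1) * dirichlet_series_one s)"
proof (induction M)
  case 0
  show ?case
    by (rule exI[of _ "\<lambda>s. (s - 1) * dirichlet_series_one s"])
       (auto intro!: holomorphic_intros dirichlet_series_one_holomorphic)
next
  case (Suc M)
  then obtain Z where Z: "Z holomorphic_on {s. Re s > 1 - real M}"
    "\<And>s. Re s > 1 \<Longrightarrow> Z s = (s - 1) * dirichlet_series_one s" by blast
  obtain G where G: "G holomorphic_on {s. Re s > - real M}"
    "\<And>s. Re s > - real M \<Longrightarrow> (\<lambda>n. zeta_remainder (Suc M) n s) sums G s"
    using zeta_remainder_sum_holomorphic by blast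
  define Z' where "Z' = (\<lambda>s. G s + 1 - (\<Sum>j=2..Suc M. ((1 - s) gchoose (j - 1)) / of_nat j * Z (s + of_nat j - 1)))"
  have "(\<lambda>s. Z (s + of_nat j - 1)) holomorphic_on {s. Re s > - real M}" if "j \<in> {2..Suc M}" for j
  proof -
    have "(\<lambda>s. s + of_nat j - 1) ` {s. Re s > - real M} \<subseteq> {s. Re s > 1 - real M}"
      using that by auto
    from holomorphic_on_compose_gen[OF _ Z(1) this] show ?thesis
      by (simp add: o_def holomorphic_intros)
  qed
  hence "Z' holomorphic_on {s. Re s > - real M}"
    unfolding Z'_def by (intro holomorphic_intros G(1) holomorphic_gbinomial) auto
  moreover have "Z' s = (s - 1) * dirichlet_series_one s" if s: "Re s > 1" for s
  proof -
    have "((1 - s) gchoose j) * dirichlet_series_one (s + of_nat j - 1)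
      = - (((1 - s) gchoose (j - 1)) / of_nat j * Z (s + of_nat j - 1))" if j: "j \<in> {2..Suc M}" for j
    proof -
      obtain k where k: "j = Suc k" using j by (cases j) auto
      have "of_nat (Suc k) * ((1 - s) gchoose Suc k) = (1 - s - of_nat k) * ((1 - s) gchoose k)"
        using gbinomial_absorb_comp[of "1 - s" k] gbinomial_absorption[of k "1 - s"] by simp
      hence g: "((1 - s) gchoose Suc k) = (1 - s - of_nat k) * ((1 - s) gchoose k) / of_nat (Suc k)"
        by (simp add: field_simps del: of_nat_Suc)
      have "Re (s + of_nat j - 1) > 1" using s j by auto
      from Z(2)[OF this] show ?thesis 
        unfolding k g by (simp del: of_nat_Suc) (simp add: algebra_simps minus_divide_left)
    qed
    hence "(\<Sum>j=2..Suc M. ((1 - s) gchoose j) * dirichlet_series_one (s + of_nat j - 1))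
       = - (\<Sum>j=2..Suc M. ((1 - s) gchoose (j - 1)) / of_nat j * Z (s + of_nat j - 1))"
      unfolding sum_negf[symmetric] by (intro sum.cong) auto
    moreover have "G s = - 1 + (s - 1) * dirichlet_series_one s
      - (\<Sum>j=2..Suc M. ((1 - s) gchoose j) * dirichlet_series_one (s + of_nat j - 1))"
      using sums_unique2[OF G(2)[of s] zeta_remainder_sum[OF s]] s by simp
    ultimately show ?thesis by (simp add: Z'_def)
  qed
  ultimately show ?case by (intro exI[of _ Z']) auto
qed

lemma zeta_continuation_entire:
  obtains E where "E holomorphic_on UNIV"
    "\<And>s. Re s > 1 \<Longrightarrow> E s = (s - 1) * dirichlet_series_one s"
proof -
  obtain Z where Z: "\<And>M. Z M holomorphic_on {s. Re s > 1 - real M}"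
    "\<And>M s. Re s > 1 \<Longrightarrow> Z M s = (s - 1) * dirichlet_series_one s"
    using zeta_continuation_aux by metis
  have op: "open {s. Re s > c}" for c by (simp add: open_halfspace_Re_gt)
  have mono: "Z M s = Z M' s" if "M \<le> M'" "Re s > 1 - real M" for M M' s
  proof (rule analytic_continuation_open[of "{s. Re s > 1}" "{s. Re s > 1 - real M}" "Z M" "Z M'"])
    show "{s. Re s > 1} \<noteq> {}" by (auto intro!: exI[of _ 2])
    show "connected {s. Re s > 1 - real M}"
      by (intro convex_connected convex_halfspace_Re_gt)
    show "Z M' holomorphic_on {s. Re s > 1 - real M}"
      by (rule holomorphic_on_subset[OF Z(1)]) (use that in auto)
  qed (use that Z op in auto)
  define E where "E = (\<lambda>s. Z (nat \<lceil>2 - Re s\<rceil>) s)"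
  have E: "E s = Z M s" if "Re s > 1 - real M" for M s
  proof -
    have "Re s > 1 - real (nat \<lceil>2 - Re s\<rceil>)" by linarith
    thus ?thesis unfolding E_def using mono that by (metis nat_le_linear)
  qed
  have "E holomorphic_on {s. Re s > 1 - real M}" for M
    using Z(1)[of M] E by (subst holomorphic_cong[OF refl, of _ _ "Z M"]) auto
  hence "E holomorphic_on (\<Union>M. {s. Re s > 1 - real M})"
    by (intro holomorphic_on_UN_open op) auto
  also have "(\<Union>M. {s. Re s > 1 - real M}) = UNIV"
  proof (intro set_eqI iffI UNIV_I)
    fix s :: complex
    have "Re s > 1 - real (nat \<lceil>2 - Re s\<rceil>)" by linarith
    thus "s \<in> (\<Union>M. {s. Re s > 1 - real M})" by blast
  qed
  finally show ?thesis using that[of E] Z(2) E[of 0] by auto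
qed

lemma zeta_ex1:
  "\<exists>!f. f holomorphic_on - {1} \<and> f 1 = 0 \<and>
     (\<forall>s. Re s > 1 \<longrightarrow> f s = (\<Sum>n. 1 / of_nat (Suc n) powr s))"
proof -
  obtain E where E: "E holomorphic_on UNIV"
    "\<And>s. Re s > 1 \<Longrightarrow> E s = (s - 1) * dirichlet_series_one s"
    using zeta_continuation_entire by blast
  have "(\<lambda>s. E s / (s - 1)) holomorphic_on - {1}"
    by (intro holomorphic_intros holomorphic_on_subset[OF E(1)]) auto
  moreover have "E s / (s - 1) = (\<Sum>n. 1 / of_nat (Suc n) powr s)" if "Re s > 1" for s
    using E(2)[OF that] that by (auto simp: dirichlet_series_one_def)
  ultimately show ?thesis
  proof (intro ex1I[of _ "\<lambda>s. E s / (s - 1)"] conjI allI impI, goal_cases)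
    case (4 f)
    show "f = (\<lambda>s. E s / (s - 1))"
    proof
      fix z
      show "f z = E z / (z - 1)"
      proof (cases "z = 1")
        case False
        show ?thesis
        proof (rule analytic_continuation_open[of "{s. Re s > 1}" "- {1}" f "\<lambda>s. E s / (s - 1)"])
          show "{s. Re s > 1} \<noteq> {}" by (auto intro!: exI[of _ 2])
          show "connected (- {1::complex})" by (rule connected_punctured_universe) simp
        qed (use 4 False in \<open>auto simp: open_halfspace_Re_gt\<close>)
      qed (use 4 in auto)
    qed
  qed auto
qed

lemma zeta_holomorphic: "zeta holomorphic_on - {1}"
  and zeta_one: "zeta 1 = 0"
  and zeta_eq_series: "Re s > 1 \<Longrightarrow> zeta s = (\<Sum>n. 1 / of_nat (Suc n) powr s)"
  using theI'[OF zeta_ex1] unfolding zeta_def[symmetric] by auto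

end

theory Submission
  imports Defs "HOL-Number_Theory.Prime_Powers"
begin

text \<open>
  Write \<open>L = ln T\<close>, \<open>a = \<alpha> / L\<close> and \<open>F = \<zeta>' / \<zeta>\<close>. Near height \<open>T\<close>, \<open>F\<close> is a sum of terms
  \<open>1 / (s - \<rho>)\<close> over zeros \<open>\<rho>\<close>, up to an error \<open>O(L)\<close>. On the Riemann hypothesis all \<open>\<rho>\<close> have
  real part \<open>1/2\<close>, so each term has positive real part to the right of the critical line, and a
  Harnack-type comparison bounds \<open>F (1/2 + a + it)\<close> by \<open>b / a\<close> times an average of
  \<open>F (1/2 + b + i(t + bx))\<close> against the kernel \<open>(sin x / x)\<^sup>4\<close>, up to \<open>O(b L / a)\<close>. The Fourier
  transform of this kernel is supported in \<open>[-4, 4]\<close>; shifting the average to the line of real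
  part \<open>2\<close> therefore turns it into a Dirichlet polynomial over prime powers up to \<open>exp (4 / b)\<close>.

  Choose \<open>b = c x / L\<close> with a small constant \<open>c\<close> depending on \<open>\<alpha>\<close>. Then \<open>\<bar>F\<bar> \<ge> x L\<close> at
  \<open>1/2 + a + it\<close> forces the part of the polynomial over primes to exceed \<open>L\<close>. Its variance is
  \<open>O(1 / b\<^sup>2) = O(L\<^sup>2 / x\<^sup>2)\<close>, and it is short enough for its \<open>2k\<close>-th moment with \<open>k\<close> about \<open>c x / 8\<close>
  to be essentially diagonal. The moment inequality gives the bound \<open>(O(k) / x\<^sup>2) ^ k\<close>, which is
  \<open>exp (- C x ln x)\<close>.
\<close>

section \<open>Logarithmic derivatives and zeros\<close>

text \<open>The obstacle is the length of the Dirichlet polynomial. At distance \<open>a\<close>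
  from the critical line the kernel would give length \<open>exp (4 / a)\<close>, which is T to the
  power 4 / alpha, and its high moments are out of reach. At distance \<open>b\<close> the length
  drops to T to the power 4 / (c x), so the k-th power with k proportional to x still has length at
  most the square root of T, and an elementary mean value bound suffices. The price of moving from
  \<open>a\<close> to \<open>b\<close> is the factor \<open>b / a = c x / alpha\<close>; for small c
  it is a small multiple of the x gained from the assumption, so x cancels and the polynomial itself
  must be at least \<open>L\<close>. There are constraints on \<open>b\<close> from both sides. On
  the line of real part 2 the kernel grows like \<open>exp (4 * (3/2 - b) / b)\<close>, which is at
  most T once \<open>b * L\<close> is at least 6. If \<open>b\<close> exceeds 1/8, then x is so
  large compared with \<open>L\<close> that the pointwise bound \<open>O(L / a)\<close> already
  excludes the large values. Bounded x is absorbed by the constant K; for bounded T a compactness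
  argument leaves no large values beyond a fixed x.\<close>

abbreviation (input) blaschke :: "real \<Rightarrow> complex \<Rightarrow> complex \<Rightarrow> complex" where
  "blaschke R \<rho> z \<equiv> of_real R * (z - \<rho>) / (of_real (R\<^sup>2) - cnj \<rho> * z)"

text \<open>On the circle of radius R one has \<open>R^2 = z * cnj z\<close>, so the denominator is
  z times the conjugate of \<open>z - rho\<close>. Hence a Blaschke factor has modulus 1
  there.\<close>

lemma norm_blaschke_eq:
  fixes z \<rho> :: complex
  assumes "norm z = R"
  shows "norm (of_real (R\<^sup>2) - cnj \<rho> * z) = R * norm (z - \<rho>)"
proof -
  have "of_real (R\<^sup>2) = z * cnj z" using assms by (simp add: complex_norm_square[symmetric])
  hence "of_real (R\<^sup>2) - cnj \<rho> * z = z * cnj (z - \<rho>)" by (simp add: algebra_simps)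
  thus ?thesis using assms by (simp add: norm_mult del: complex_cnj_diff)
qed

lemma norm_blaschke_denom_ge:
  fixes z \<rho> :: complex
  assumes "norm z \<le> q" "norm \<rho> \<le> r" "0 \<le> r"
  shows "norm (of_real (R\<^sup>2) - cnj \<rho> * z) \<ge> R\<^sup>2 - r * q"
proof -
  have "norm (cnj \<rho> * z) \<le> r * q" unfolding norm_mult using assms by (intro mult_mono) auto
  moreover have "norm (of_real (R\<^sup>2) :: complex) - norm (cnj \<rho> * z) \<le> norm (of_real (R\<^sup>2) - cnj \<rho> * z)"
    by (rule norm_triangle_ineq2)
  moreover have "norm (of_real (R\<^sup>2) :: complex) = R\<^sup>2" by (simp only: norm_of_real) simp
  ultimately show ?thesis by linarith
qed

text \<open>The quotient by the Blaschke factor has a removable singularity at the zero and the same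
  modulus as f on the bounding circle, so the maximum modulus principle transfers the bound M. The
  identity is multiplied out to avoid dividing by zero.\<close>

lemma blaschke_divide:
  fixes f :: "complex \<Rightarrow> complex"
  assumes f: "f holomorphic_on S" "open S" "cball 0 R \<subseteq> S" "\<And>z. z \<in> cball 0 R \<Longrightarrow> norm (f z) \<le> M"
    and \<rho>: "f \<rho> = 0" "norm \<rho> < R"
  obtains g where "g holomorphic_on S" "\<And>z. z \<in> cball 0 R \<Longrightarrow> norm (g z) \<le> M"
    "\<And>z. z \<in> S \<Longrightarrow> f z * (of_real (R\<^sup>2) - cnj \<rho> * z) = of_real R * (z - \<rho>) * g z"
proof -
  have R: "R > 0" using \<rho> norm_ge_zero[of \<rho>] by linarith
  have \<rho>S: "\<rho> \<in> S" using f(3) \<rho> by auto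
  define G where "G = (\<lambda>z. f z * (of_real (R\<^sup>2) - cnj \<rho> * z) / of_real R)"
  define g where "g = (\<lambda>z. if z = \<rho> then deriv G \<rho> else G z / (z - \<rho>))"
  have G: "G holomorphic_on S" unfolding G_def using R by (intro holomorphic_intros f) auto
  have g: "g holomorphic_on S"
    by (rule pole_theorem_0[OF G, of \<rho>]) (use \<rho>S f(2) \<rho> in \<open>auto simp: g_def interior_open G_def\<close>)
  have eq: "f z * (of_real (R\<^sup>2) - cnj \<rho> * z) = of_real R * (z - \<rho>) * g z" for z
    using R \<rho> by (auto simp: g_def G_def field_simps)
  have "norm (g z) \<le> M" if z: "z \<in> cball 0 R" for z
  proof (rule maximum_modulus_frontier[of g "cball 0 R"])
    show "g holomorphic_on interior (cball 0 R)"
      by (rule holomorphic_on_subset[OF g]) (use f(3) interior_subset in blast)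
    show "continuous_on (closure (cball 0 R)) g"
      using holomorphic_on_imp_continuous_on[OF g] f(3) by (auto intro: continuous_on_subset)
    fix w :: complex assume "w \<in> frontier (cball 0 R)"
    hence w: "norm w = R" using R by (simp add: frontier_cball)
    have "norm (f w) * (R * norm (w - \<rho>)) = R * norm (w - \<rho>) * norm (g w)"
      using arg_cong[OF eq[of w], of norm] R unfolding norm_mult norm_blaschke_eq[OF w] by simp
    moreover have "R * norm (w - \<rho>) \<noteq> 0" using R w \<rho> by auto
    ultimately have "norm (f w) = norm (g w)" by (metis mult.commute mult_left_cancel)
    thus "norm (g w) \<le> M" using f(4)[of w] w by auto
  qed (use z in auto)
  with g eq show ?thesis using that by blast
qed

text \<open>
  Dividing out a zero by its Blaschke factor keeps the bound \<open>M\<close> and enlarges \<open>norm (f 0)\<close> by a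
  factor of at least \<open>R / r\<close>, so only finitely many divisions are possible.
\<close>

lemma blaschke_factorization:
  fixes f :: "complex \<Rightarrow> complex" and S
  assumes S: "open S" "cball 0 R \<subseteq> S" and r: "0 < r" "r < R"
  shows "f holomorphic_on S \<Longrightarrow> (\<And>z. z \<in> cball 0 R \<Longrightarrow> norm (f z) \<le> M) \<Longrightarrow> f 0 \<noteq> 0 \<Longrightarrow>
    M < norm (f 0) * (R / r) ^ n \<Longrightarrow>
    \<exists>\<rho>s g. g holomorphic_on S \<and> (\<forall>z\<in>cball 0 R. norm (g z) \<le> M) \<and>
      norm (f 0) * (R / r) ^ length \<rho>s \<le> norm (g 0) \<and> (\<forall>z\<in>cball 0 r. g z \<noteq> 0) \<and>
      (\<forall>\<rho>\<in>set \<rho>s. norm \<rho> \<le> r \<and> f \<rho> = 0) \<and>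
      (\<forall>z\<in>ball 0 R. f z = (\<Prod>\<rho>\<leftarrow>\<rho>s. blaschke R \<rho> z) * g z)"
proof (induction n arbitrary: f)
  case (0 f)
  \<comment> \<open>The exponent n is the fuel of the recursion: at 0 the last hypothesis
    contradicts the bound of f at the origin.\<close>
  have "norm (f 0) \<le> M" using 0(2)[of 0] r by simp
  thus ?case using 0(4) by simp
next
  case (Suc n f)
  show ?case
  proof (cases "\<forall>z\<in>cball 0 r. f z \<noteq> 0")
    case True
    thus ?thesis using Suc.prems by (intro exI[of _ "[]"] exI[of _ f]) auto
  next
    case False
    then obtain \<rho> where \<rho>: "norm \<rho> \<le> r" "f \<rho> = 0" by auto
    have \<rho>R: "norm \<rho> < R" using \<rho> r by simp
    from blaschke_divide[OF Suc.prems(1) S Suc.prems(2) \<rho>(2) this] obtain g where g: "g holomorphic_on S" "\<And>z. z \<in> cball 0 R \<Longrightarrow> norm (g z) \<le> M"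
      "\<And>z. z \<in> S \<Longrightarrow> f z * (of_real (R\<^sup>2) - cnj \<rho> * z) = of_real R * (z - \<rho>) * g z" by blast
    have "0 \<in> S" using S r by auto
    have "norm (f 0) * R\<^sup>2 = R * norm \<rho> * norm (g 0)"
      using arg_cong[OF g(3)[OF \<open>0 \<in> S\<close>], of norm] r by (simp add: norm_mult norm_power)
    hence "norm (f 0) * R = norm \<rho> * norm (g 0)" using r by (simp add: power2_eq_square)
    also have "\<dots> \<le> r * norm (g 0)" using \<rho> by (intro mult_right_mono) auto
    finally have g0: "norm (f 0) * (R / r) \<le> norm (g 0)" using r by (simp add: field_simps)
    have gn0: "g 0 \<noteq> 0"
    proof
      assume "g 0 = 0"
      with g0 have "norm (f 0) * (R / r) \<le> 0" by simp
      moreover have "norm (f 0) * (R / r) > 0" using Suc.prems(3) r by simp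
      ultimately show False by linarith
    qed
    have "M < norm (f 0) * (R / r) * (R / r) ^ n" using Suc.prems(4) by (simp add: mult_ac)
    also have "\<dots> \<le> norm (g 0) * (R / r) ^ n" using g0 r by (intro mult_right_mono) auto
    finally have gM: "M < norm (g 0) * (R / r) ^ n" .
    from Suc.IH[OF g(1) g(2) gn0 gM] obtain \<rho>s h where h: "h holomorphic_on S" "\<forall>z\<in>cball 0 R. norm (h z) \<le> M"
      "norm (g 0) * (R / r) ^ length \<rho>s \<le> norm (h 0)" "\<forall>z\<in>cball 0 r. h z \<noteq> 0"
      "\<forall>\<rho>\<in>set \<rho>s. norm \<rho> \<le> r \<and> g \<rho> = 0"
      "\<forall>z\<in>ball 0 R. g z = (\<Prod>\<rho>\<leftarrow>\<rho>s. blaschke R \<rho> z) * h z" by blast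
    have nz: "of_real (R\<^sup>2) - cnj \<rho> * z \<noteq> 0" if "norm z \<le> R" for z
    proof -
      have "R\<^sup>2 - r * R > 0" using r by (simp add: power2_eq_square)
      thus ?thesis using norm_blaschke_denom_ge[OF that \<rho>(1), of R] r by fastforce
    qed
    have fz: "f z = blaschke R \<rho> z * g z" if "norm z \<le> R" for z
    proof -
      have "z \<in> S" using S that by auto
      from g(3)[OF this] nz[OF that] show ?thesis by (simp add: field_simps)
    qed
    show ?thesis
    proof (intro exI[of _ "\<rho> # \<rho>s"] exI[of _ h] conjI)
      have "norm (f 0) * (R / r) ^ length (\<rho> # \<rho>s) = norm (f 0) * (R / r) * (R / r) ^ length \<rho>s" by simp
      also have "\<dots> \<le> norm (g 0) * (R / r) ^ length \<rho>s" using g0 r by (intro mult_right_mono) auto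
      also have "\<dots> \<le> norm (h 0)" by (rule h(3))
      finally show "norm (f 0) * (R / r) ^ length (\<rho> # \<rho>s) \<le> norm (h 0)" .
      show "\<forall>\<rho>\<in>set (\<rho> # \<rho>s). norm \<rho> \<le> r \<and> f \<rho> = 0"
      proof
        fix \<rho>' assume "\<rho>' \<in> set (\<rho> # \<rho>s)"
        hence "\<rho>' = \<rho> \<or> \<rho>' \<in> set \<rho>s" by simp
        thus "norm \<rho>' \<le> r \<and> f \<rho>' = 0"
        proof
          assume "\<rho>' \<in> set \<rho>s"
          hence *: "norm \<rho>' \<le> r" "g \<rho>' = 0" using h(5) by auto
          thus ?thesis using fz[of \<rho>'] r by simp
        qed (use \<rho> in auto)
      qed
      show "\<forall>z\<in>ball 0 R. f z = (\<Prod>\<rho>\<leftarrow>(\<rho> # \<rho>s). blaschke R \<rho> z) * h z"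
        using h(6) fz by (auto simp: mult.assoc)
    qed (use h in auto)
  qed
qed

text \<open>The Schwarz lemma turns a one-sided bound of the real part into a bound of
  \<open>h - h 0\<close> on the disc of radius r1. Cauchy's inequality on circles of radius
  \<open>r1 - r2\<close> then bounds the derivative on the disc of radius r2.\<close>

lemma borel_caratheodory_deriv:
  fixes h :: "complex \<Rightarrow> complex"
  assumes h: "h holomorphic_on ball 0 r" "\<And>z. z \<in> ball 0 r \<Longrightarrow> Re (h z - h 0) < A"
    and r: "0 < r2" "r2 < r1" "r1 < r" and z: "norm z \<le> r2"
  shows "norm (deriv h z) \<le> 2 * A * r1 / (r - r1) / (r1 - r2)"
proof -
  have A: "A > 0" using h(2)[of 0] r by simp
  define k where "k = (\<lambda>z. h (of_real r * z) - h 0)"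
  have sub: "of_real r * z \<in> ball 0 r" if "norm z < 1" for z :: complex
    using that r by (simp add: norm_mult)
  have hk: "k holomorphic_on ball 0 1"
  proof -
    have "(h \<circ> (\<lambda>z. of_real r * z)) holomorphic_on ball 0 1"
      by (rule holomorphic_on_compose_gen[OF _ h(1)]) (use sub in \<open>auto intro!: holomorphic_intros simp: image_subset_iff\<close>)
    thus ?thesis unfolding k_def by (intro holomorphic_intros) (simp_all add: o_def)
  qed
  have Rek: "Re (k z) < A" if "norm z < 1" for z unfolding k_def using h(2)[OF sub[OF that]] .
  have nz: "2 * of_real A - k z \<noteq> 0" if "norm z < 1" for z
  proof
    assume "2 * of_real A - k z = 0"
    hence "Re (k z) = 2 * A" by (simp add: complex_eq_iff)
    with Rek[OF that] A show False by simp
  qed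
  \<comment> \<open>The Moebius map w / (2 A - w) sends the half-plane Re w < A into the unit disc
    and fixes 0.\<close>
  define \<phi> where "\<phi> = (\<lambda>z. k z / (2 * of_real A - k z))"
  have p1: "\<phi> holomorphic_on ball 0 1" unfolding \<phi>_def by (intro holomorphic_intros hk) (use nz in auto)
  have p2: "\<phi> 0 = 0" by (simp add: \<phi>_def k_def)
  have p3: "norm (\<phi> z) < 1" if "norm z < 1" for z
  proof -
    have "(2 * A - Re (k z))\<^sup>2 - (Re (k z))\<^sup>2 = 4 * A * (A - Re (k z))" by (simp add: power2_eq_square algebra_simps)
    also have "\<dots> > 0" using A Rek[OF that] by simp
    finally have "(norm (k z))\<^sup>2 < (norm (2 * of_real A - k z))\<^sup>2"
      by (simp add: cmod_power2)
    hence "norm (k z) < norm (2 * of_real A - k z)" by (rule power_less_imp_less_base) simp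
    thus ?thesis using nz[OF that] by (simp add: \<phi>_def norm_divide)
  qed
  have bd: "norm (k z) \<le> 2 * A * norm z / (1 - norm z)" if z: "norm z < 1" for z
  proof -
    have s: "norm (\<phi> z) \<le> norm z" by (rule Schwarz_Lemma(1)[OF p1 p2 p3 z])
    have "k z = \<phi> z * (2 * of_real A - k z)" using nz[OF z] by (simp add: \<phi>_def)
    hence "norm (k z) = norm (\<phi> z) * norm (2 * of_real A - k z)" by (metis norm_mult)
    also have "\<dots> \<le> norm z * (2 * A + norm (k z))"
      using s A norm_triangle_ineq4[of "2 * of_real A" "k z"] by (intro mult_mono) (auto simp: norm_mult)
    finally show ?thesis using z by (simp add: field_simps)
  qed
  define B where "B = 2 * A * r1 / (r - r1)"
  have hb: "norm (h w - h 0) \<le> B" if "norm w \<le> r1" for w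
  proof -
    define v where "v = w / of_real r"
    have v: "norm v = norm w / r" "of_real r * v = w" using r by (auto simp: v_def norm_divide)
    have v0: "norm v \<le> r1 / r" "r1 / r < 1" using v(1) r that by (auto intro: divide_right_mono)
    hence v1: "norm v \<le> r1 / r" "norm v < 1" "r1 / r < 1" by auto
    have "norm (h w - h 0) = norm (k v)" by (simp add: k_def v)
    also have "\<dots> \<le> 2 * A * norm v / (1 - norm v)" by (rule bd) fact
    also have "\<dots> \<le> 2 * A * (r1 / r) / (1 - r1 / r)" using A v1 r by (intro frac_le mult_left_mono) auto
    also have "\<dots> = B" using r by (simp add: B_def field_simps)
    finally show ?thesis .
  qed
  have "norm ((deriv ^^ 1) (\<lambda>w. h w - h 0) z) \<le> fact 1 * B / (r1 - r2) ^ 1"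
  proof (rule Cauchy_inequality)
    have sub2: "cball z (r1 - r2) \<subseteq> cball 0 r1"
    proof
      fix y assume "y \<in> cball z (r1 - r2)"
      hence "norm (y - z) \<le> r1 - r2" by (simp add: dist_norm norm_minus_commute)
      hence "norm y \<le> r1" using z norm_triangle_ineq2[of y z] by linarith
      thus "y \<in> cball 0 r1" by simp
    qed
    have hol: "(\<lambda>w. h w - h 0) holomorphic_on cball z (r1 - r2)"
      by (rule holomorphic_on_subset[of _ "ball 0 r"]) (use h(1) sub2 r in \<open>auto intro!: holomorphic_intros\<close>)
    show "(\<lambda>w. h w - h 0) holomorphic_on ball z (r1 - r2)" by (rule holomorphic_on_subset[OF hol]) auto
    show "continuous_on (cball z (r1 - r2)) (\<lambda>w. h w - h 0)" by (rule holomorphic_on_imp_continuous_on[OF hol])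
    show "norm (h x - h 0) \<le> B" if "norm (z - x) = r1 - r2" for x
    proof (rule hb)
      have "x \<in> cball z (r1 - r2)" using that by (simp add: dist_norm)
      thus "norm x \<le> r1" using sub2 by auto
    qed
  qed (use r in auto)
  moreover have "deriv (\<lambda>w. h w - h 0) z = deriv h z"
  proof -
    have "z \<in> ball 0 r" using z r by simp
    hence "(h has_field_derivative deriv h z) (at z)" using h(1) by (intro holomorphic_derivI[of _ "ball 0 r"]) auto
    thus ?thesis by (intro DERIV_imp_deriv) (auto intro!: derivative_eq_intros)
  qed
  ultimately show ?thesis by (simp add: B_def)
qed


section \<open>Landau's lemma: the logarithmic derivative as a sum over nearby zeros\<close>

lemma has_field_derivative_prod_list:
  fixes z :: "'a :: real_normed_field"
  assumes "\<And>\<rho>. \<rho> \<in> set \<rho>s \<Longrightarrow> (B \<rho> has_field_derivative D \<rho> * B \<rho> z) (at z)"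
  shows "((\<lambda>z. \<Prod>\<rho>\<leftarrow>\<rho>s. B \<rho> z) has_field_derivative (\<Sum>\<rho>\<leftarrow>\<rho>s. D \<rho>) * (\<Prod>\<rho>\<leftarrow>\<rho>s. B \<rho> z)) (at z)"
  using assms
proof (induction \<rho>s)
  case (Cons \<rho> \<rho>s)
  have "((\<lambda>z. B \<rho> z * (\<Prod>\<rho>\<leftarrow>\<rho>s. B \<rho> z)) has_field_derivative
     (D \<rho> * B \<rho> z) * (\<Prod>\<rho>\<leftarrow>\<rho>s. B \<rho> z) + ((\<Sum>\<rho>\<leftarrow>\<rho>s. D \<rho>) * (\<Prod>\<rho>\<leftarrow>\<rho>s. B \<rho> z)) * B \<rho> z) (at z)"
    by (rule DERIV_mult) (use Cons in auto)
  thus ?case by (simp add: algebra_simps)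
qed auto

lemma norm_sum_list_le:
  fixes f :: "'b \<Rightarrow> 'a :: real_normed_vector"
  assumes "\<And>x. x \<in> set xs \<Longrightarrow> norm (f x) \<le> g x"
  shows "norm (\<Sum>x\<leftarrow>xs. f x) \<le> (\<Sum>x\<leftarrow>xs. g x)"
  using assms
proof (induction xs)
  case (Cons x xs)
  thus ?case using norm_triangle_ineq[of "f x" "\<Sum>x\<leftarrow>xs. f x"] by fastforce
qed auto

text \<open>The zeros form a list and not a set, so that multiple zeros are counted with
  multiplicity.\<close>

definition pole_sum :: "complex list \<Rightarrow> complex \<Rightarrow> complex" where
  "pole_sum \<rho>s s = (\<Sum>\<rho>\<leftarrow>\<rho>s. 1 / (s - \<rho>))"

text \<open>Dividing f by its Blaschke factors leaves a zero-free g, hence a logarithm h with real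
  part controlled by M. Borel-Caratheodory bounds \<open>deriv h\<close>, and the Blaschke factors
  contribute the poles plus a bounded term each.\<close>

lemma landau_log_derivative:
  fixes r2 r R :: real
  assumes r: "0 < r2" "r2 < r" "r < R"
  obtains C where "C > 0"
    "\<And>f S M. f holomorphic_on S \<Longrightarrow> open S \<Longrightarrow> cball 0 R \<subseteq> S \<Longrightarrow> f 0 \<noteq> 0 \<Longrightarrow>
       (\<And>z. z \<in> cball 0 R \<Longrightarrow> norm (f z) \<le> M) \<Longrightarrow>
       \<exists>\<rho>s. (\<forall>\<rho>\<in>set \<rho>s. norm \<rho> \<le> r \<and> f \<rho> = 0) \<and>
         length \<rho>s \<le> C * (ln (M / norm (f 0)) + 1) \<and>
         (\<forall>z\<in>cball 0 r2. f z \<noteq> 0 \<longrightarrow>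
            norm (deriv f z / f z - pole_sum \<rho>s z) \<le> C * (ln (M / norm (f 0)) + 1))"
proof -
  define r1 where "r1 = (r2 + r) / 2"
  have r1: "r2 < r1" "r1 < r" using r by (auto simp: r1_def)
  \<comment> \<open>C1 counts zeros as in Jensen's inequality, C2 is the Borel-Caratheodory
    constant, and C3 bounds the contribution of one zero reflected in the circle of radius
    R.\<close>
  define C1 where "C1 = 1 / ln (R / r)"
  define C2 where "C2 = 2 * r1 / (r - r1) / (r1 - r2)"
  define C3 where "C3 = r / (R\<^sup>2 - r * r)"
  have lR: "ln (R / r) > 0" using r by simp
  have R2: "R\<^sup>2 - r * r > 0" using r by (simp add: power2_eq_square mult_strict_mono)
  have C123: "C1 > 0" "C2 > 0" "C3 > 0" using lR r r1 R2 by (auto simp: C1_def C2_def C3_def)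
  define C where "C = C1 + C2 + C1 * C3"
  have C: "C > 0" "C1 \<le> C" "C2 + C1 * C3 \<le> C" using C123 by (auto simp: C_def add_pos_pos)
  show thesis
  proof (rule that[OF C(1)])
    fix f :: "complex \<Rightarrow> complex" and S M
    assume f: "f holomorphic_on S" and S: "open S" "cball 0 R \<subseteq> S" and f0: "f 0 \<noteq> 0"
      and M: "\<And>z. z \<in> cball 0 R \<Longrightarrow> norm (f z) \<le> M"
    \<comment> \<open>The summand 1 makes the bound on \<open>Re (h z - h 0)\<close> strict, as
      Borel-Caratheodory requires, and keeps A positive even when f is constant.\<close>
    define A where "A = ln (M / norm (f 0)) + 1"
    have MR: "norm (f 0) \<le> M" using M[of 0] r by simp
    have M0: "M > 0" using MR f0 by (meson less_le_trans zero_less_norm_iff)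
    have MR1: "1 \<le> M / norm (f 0)" using MR f0 by simp
    hence A: "A > ln (M / norm (f 0))" "A \<ge> 1" by (auto simp: A_def)
    obtain n where n: "M / norm (f 0) < (R / r) ^ n"
      using real_arch_pow[of "R / r"] r by auto
    hence n': "M < norm (f 0) * (R / r) ^ n" using f0 by (simp add: field_simps)
    have r0: "0 < r" using r by simp
    from blaschke_factorization[OF S r0 r(3) f M f0 n'] obtain \<rho>s g where
      g: "g holomorphic_on S" "\<forall>z\<in>cball 0 R. norm (g z) \<le> M"
      "norm (f 0) * (R / r) ^ length \<rho>s \<le> norm (g 0)" "\<forall>z\<in>cball 0 r. g z \<noteq> 0" and
      \<rho>: "\<forall>\<rho>\<in>set \<rho>s. norm \<rho> \<le> r \<and> f \<rho> = 0" and
      fac: "\<forall>z\<in>ball 0 R. f z = (\<Prod>\<rho>\<leftarrow>\<rho>s. blaschke R \<rho> z) * g z"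
      by blast
    have len: "length \<rho>s \<le> C1 * A"
    proof -
      have "norm (f 0) * (R / r) ^ length \<rho>s \<le> M" using g(2,3) r by (meson centre_in_cball less_imp_le order_trans r0)
      hence "(R / r) ^ length \<rho>s \<le> M / norm (f 0)" using f0 by (simp add: field_simps)
      hence "ln ((R / r) ^ length \<rho>s) \<le> ln (M / norm (f 0))" using r by (intro ln_mono) auto
      hence "length \<rho>s * ln (R / r) \<le> A" using A r by (subst (asm) ln_realpow) auto
      thus ?thesis using lR by (simp add: C1_def field_simps)
    qed
    have "\<forall>x\<in>ball 0 r. g x \<noteq> 0" using g(4) by auto
    moreover have "ball 0 r \<subseteq> S" using S r by (auto simp: subset_iff)
    ultimately obtain h where h: "h holomorphic_on ball 0 r" "\<And>x. x \<in> ball 0 r \<Longrightarrow> exp (h x) = g x"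
      using holomorphic_logarithm_exists[of "ball 0 r" g 0] holomorphic_on_subset[OF g(1)] r by (metis centre_in_ball convex_ball open_ball r0)
    have Reh: "Re (h z - h 0) < A" if z: "z \<in> ball 0 r" for z
    proof -
      have gz: "norm (g z) = exp (Re (h z))" using h(2)[OF z] by (metis norm_exp_eq_Re)
      have g0: "norm (g 0) = exp (Re (h 0))" using h(2)[of 0] r by (metis norm_exp_eq_Re centre_in_ball r0)
      have "norm (f 0) \<le> norm (g 0)"
      proof -
        have "norm (f 0) * 1 \<le> norm (f 0) * (R / r) ^ length \<rho>s" using r by (intro mult_left_mono one_le_power) auto
        thus ?thesis using g(3) by simp
      qed
      moreover have "norm (g z) \<le> M" using g(2) z r by auto
      ultimately have "exp (Re (h z)) / exp (Re (h 0)) \<le> M / norm (f 0)" using f0 M0 unfolding gz g0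
        by (intro frac_le) auto
      hence "exp (Re (h z - h 0)) \<le> M / norm (f 0)" by (simp add: exp_diff)
      hence "Re (h z - h 0) \<le> ln (M / norm (f 0))" using M0 f0 by (subst ln_ge_iff) auto
      thus ?thesis using A by simp
    qed
    show "\<exists>\<rho>s. (\<forall>\<rho>\<in>set \<rho>s. norm \<rho> \<le> r \<and> f \<rho> = 0) \<and> length \<rho>s \<le> C * (ln (M / norm (f 0)) + 1) \<and>
         (\<forall>z\<in>cball 0 r2. f z \<noteq> 0 \<longrightarrow>
            norm (deriv f z / f z - pole_sum \<rho>s z) \<le> C * (ln (M / norm (f 0)) + 1))"
    proof (intro exI[of _ \<rho>s] conjI \<rho> ballI impI; fold A_def)
      show "length \<rho>s \<le> C * A" using len C(2) A by (meson mult_right_mono order_trans zero_le_one)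
      fix z :: complex assume z: "z \<in> cball 0 r2" and fz: "f z \<noteq> 0"
      have zr: "z \<in> ball 0 r" using z r by auto
      \<comment> \<open>The logarithmic derivative of one Blaschke factor. Its second term belongs
        to the reflected pole and is bounded by C3, since both z and the zero have norm at most r <
        R.\<close>
      define D where "D = (\<lambda>\<rho>. 1 / (z - \<rho>) + cnj \<rho> / (of_real (R\<^sup>2) - cnj \<rho> * z))"
      define B where "B = (\<lambda>\<rho> z. blaschke R \<rho> z)"
      have den: "norm (of_real (R\<^sup>2) - cnj \<rho> * z) \<ge> R\<^sup>2 - r * r" if "\<rho> \<in> set \<rho>s" for \<rho>
        by (rule norm_blaschke_denom_ge) (use \<rho> that zr r in auto)
      have dB: "(B \<rho> has_field_derivative D \<rho> * B \<rho> z) (at z)" if "\<rho> \<in> set \<rho>s" for \<rho>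
      proof -
        have nz: "of_real (R\<^sup>2) - cnj \<rho> * z \<noteq> 0" using den[OF that] R2 by fastforce
        have zn: "z \<noteq> \<rho>" using fz \<rho> that by auto
        have "(B \<rho> has_field_derivative (of_real R * (of_real (R\<^sup>2) - cnj \<rho> * z) - of_real R * (z - \<rho>) * (- cnj \<rho>)) /
           ((of_real (R\<^sup>2) - cnj \<rho> * z) * (of_real (R\<^sup>2) - cnj \<rho> * z))) (at z)"
          unfolding B_def using nz by (auto intro!: derivative_eq_intros)
        moreover have "(of_real R * (of_real (R\<^sup>2) - cnj \<rho> * z) - of_real R * (z - \<rho>) * (- cnj \<rho>)) /
           ((of_real (R\<^sup>2) - cnj \<rho> * z) * (of_real (R\<^sup>2) - cnj \<rho> * z)) = D \<rho> * B \<rho> z"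
          using nz zn r unfolding D_def B_def by (simp add: divide_simps) (simp add: algebra_simps)
        ultimately show ?thesis by simp
      qed
      have dh: "(h has_field_derivative deriv h z) (at z)" using h(1) zr by (intro holomorphic_derivI[of _ "ball 0 r"]) auto
      define P where "P = (\<lambda>z. \<Prod>\<rho>\<leftarrow>\<rho>s. B \<rho> z)"
      have dP: "(P has_field_derivative (\<Sum>\<rho>\<leftarrow>\<rho>s. D \<rho>) * P z) (at z)"
        unfolding P_def by (rule has_field_derivative_prod_list) (use dB in auto)
      have feq: "f w = P w * exp (h w)" if "w \<in> ball 0 r" for w
        using fac that h(2)[OF that] r by (auto simp: P_def B_def)
      have "((\<lambda>w. P w * exp (h w)) has_field_derivative ((\<Sum>\<rho>\<leftarrow>\<rho>s. D \<rho>) + deriv h z) * (P z * exp (h z))) (at z)"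
        by (auto intro!: derivative_eq_intros dP dh simp: algebra_simps)
      hence "(f has_field_derivative ((\<Sum>\<rho>\<leftarrow>\<rho>s. D \<rho>) + deriv h z) * (P z * exp (h z))) (at z)"
        by (rule DERIV_cong_ev[THEN iffD1, rotated -1])
           (use feq zr eventually_nhds_in_open[of "ball 0 r" z] in \<open>auto elim!: eventually_mono\<close>)
      hence "deriv f z / f z = (\<Sum>\<rho>\<leftarrow>\<rho>s. D \<rho>) + deriv h z"
        using fz feq[OF zr] by (simp add: DERIV_imp_deriv)
      also have "(\<Sum>\<rho>\<leftarrow>\<rho>s. D \<rho>) = pole_sum \<rho>s z + (\<Sum>\<rho>\<leftarrow>\<rho>s. cnj \<rho> / (of_real (R\<^sup>2) - cnj \<rho> * z))"
        unfolding D_def pole_sum_def by (rule sum_list_addf)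
      finally have eq: "deriv f z / f z - pole_sum \<rho>s z = (\<Sum>\<rho>\<leftarrow>\<rho>s. cnj \<rho> / (of_real (R\<^sup>2) - cnj \<rho> * z)) + deriv h z"
        by simp
      have "norm (\<Sum>\<rho>\<leftarrow>\<rho>s. cnj \<rho> / (of_real (R\<^sup>2) - cnj \<rho> * z)) \<le> (\<Sum>\<rho>\<leftarrow>\<rho>s. C3)"
        unfolding C3_def norm_divide using den \<rho> R2 r
        by (intro norm_sum_list_le) (auto simp: norm_divide intro!: frac_le)
      also have "\<dots> = length \<rho>s * C3" by (simp add: sum_list_triv)
      also have "\<dots> \<le> C1 * A * C3" using len C123 by (intro mult_right_mono) auto
      finally have 1: "norm (\<Sum>\<rho>\<leftarrow>\<rho>s. cnj \<rho> / (of_real (R\<^sup>2) - cnj \<rho> * z)) \<le> C1 * A * C3" .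
      have 2: "norm (deriv h z) \<le> C2 * A"
        using borel_caratheodory_deriv[OF h(1) Reh r(1) r1, of z] z by (simp add: C2_def mult_ac)
      have "norm (deriv f z / f z - pole_sum \<rho>s z) \<le> C1 * A * C3 + C2 * A"
        unfolding eq using 1 2 norm_triangle_ineq by (meson add_mono order_trans)
      also have "\<dots> = (C2 + C1 * C3) * A" by (simp add: algebra_simps)
      also have "\<dots> \<le> C * A" using C(3) A by (intro mult_right_mono) auto
      finally show "norm (deriv f z / f z - pole_sum \<rho>s z) \<le> C * A" .
    qed
  qed
qed

section \<open>The zeta function to the right of the imaginary axis\<close>

abbreviation (input) log_deriv_zeta :: "complex \<Rightarrow> complex" where
  "log_deriv_zeta \<equiv> \<lambda>s. deriv zeta s / zeta s"

text \<open>A second-order version of \<open>taylor_bound\<close> without the factor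
  \<open>2 powr norm a\<close>, which would be exponential in the height. Here
  \<open>Re a <= 2\<close> keeps the second derivative polynomial in a, and this yields polynomial
  growth of zeta.\<close>

lemma taylor_two_bound:
  fixes a :: complex and u :: real
  assumes u: "0 \<le> u" "u \<le> 1" and a: "Re a \<le> 2"
  shows "norm (of_real (1+u) powr a - (1 + a * of_real u)) \<le> norm a * norm (a - 1) * u\<^sup>2"
proof -
  define S where "S = closed_segment 0 (1::complex)"
  define f where "f = (\<lambda>(i::nat) z. (if i = 0 then (1+z) powr a else if i = 1 then a * (1+z) powr (a - 1)
     else a * (a - 1) * (1+z) powr (a - 2)) :: complex)"
  have "norm (f 0 (of_real u) - (\<Sum>i\<le>1. f i 0 * (of_real u - 0) ^ i / fact i))
      \<le> (norm a * norm (a - 1)) * norm (of_real u - 0 :: complex) ^ Suc 1 / fact 1"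
  proof (rule complex_Taylor)
    show "convex S" by (simp add: S_def)
    show "0 \<in> S" by (simp add: S_def)
    show "of_real u \<in> S" using u by (auto simp: S_def closed_segment_def scaleR_conv_of_real)
    fix z assume "z \<in> S"
    then obtain x where x: "z = of_real x" "0 \<le> x" "x \<le> 1"
      by (auto simp: S_def closed_segment_def scaleR_conv_of_real)
    have eq: "1 + z = of_real (1+x)" using x by simp
    have nn: "1 + z \<notin> \<real>\<^sub>\<le>\<^sub>0" using x unfolding eq by (simp add: complex_nonpos_Reals_iff)
    show "(f i has_field_derivative f (Suc i) z) (at z within S)" if "i \<le> 1" for i
    proof -
      have "i = 0 \<or> i = 1" using that by auto
      thus ?thesis
      proof
        assume "i = 0"
        thus ?thesis unfolding f_def using nn by (auto intro!: derivative_eq_intros)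
      next
        assume "i = 1"
        thus ?thesis unfolding f_def using nn by (auto intro!: derivative_eq_intros)
      qed
    qed
    have "norm ((1+z) powr (a - 2)) = (1+x) powr (Re a - 2)"
      unfolding eq using x by (subst norm_powr_real_powr) auto
    also have "\<dots> \<le> (1+x) powr 0" using x a by (intro powr_mono) auto
    also have "\<dots> = 1" using x by simp
    finally have "norm ((1+z) powr (a - 2)) \<le> 1" .
    hence "norm (a * (a - 1)) * norm ((1+z) powr (a - 2)) \<le> norm (a * (a - 1)) * 1"
      by (intro mult_left_mono) auto
    thus "norm (f (Suc 1) z) \<le> norm a * norm (a - 1)" by (simp add: f_def norm_mult)
  qed
  thus ?thesis using u by (simp add: f_def power2_eq_square)
qed

lemma norm_zeta_remainder_one_le:
  assumes s: "Re s \<ge> -1"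
  shows "norm (zeta_remainder 1 n s) \<le> norm (s - 1) * norm s * real (Suc n) powr (- Re s - 1)"
proof -
  define u where "u = 1 / real (Suc n)"
  define N where "N = (of_nat (Suc n) :: complex)"
  have N0: "N \<noteq> 0" unfolding N_def by (simp del: of_nat_Suc)
  have Nr: "N = of_real (real (Suc n))" by (simp add: N_def)
  have u: "0 \<le> u" "u \<le> 1" by (auto simp: u_def)
  have N2: "of_nat (Suc (Suc n)) = of_real (real (Suc n)) * (of_real (1 + u) :: complex)"
  proof -
    have "real (Suc (Suc n)) = real (Suc n) * (1 + u)" by (simp add: u_def field_simps)
    thus ?thesis by (metis of_real_mult of_real_of_nat_eq)
  qed
  have 1: "of_nat (Suc (Suc n)) powr (1 - s) = N powr (1 - s) * of_real (1+u) powr (1 - s)"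
    unfolding N2 Nr using u by (subst powr_times_real) auto
  have 2: "N powr (1 - s - 1) = N powr (1 - s) * of_real u"
    using N0 by (subst powr_diff) (simp add: N_def u_def divide_inverse del: of_nat_Suc)
  have "zeta_remainder 1 n s = N powr (1 - s) * (of_real (1+u) powr (1 - s) - (1 + (1 - s) * of_real u))"
    unfolding zeta_remainder_def N_def[symmetric] 1 using 2
    by (simp add: algebra_simps)
  also have "norm \<dots> \<le> real (Suc n) powr (1 - Re s) * (norm (1 - s) * norm ((1 - s) - 1) * u\<^sup>2)"
    unfolding norm_mult
    using taylor_two_bound[OF u, of "1 - s"] norm_Suc_powr[of n "1 - s"] s
    by (intro mult_mono) (auto simp: N_def norm_mult)
  also have "u\<^sup>2 = real (Suc n) powr (- 2)"
    unfolding u_def by (simp add: powr_minus_divide power_one_over del: of_nat_Suc)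
  also have "real (Suc n) powr (1 - Re s) * (norm (1 - s) * norm ((1 - s) - 1) * real (Suc n) powr (- 2))
     = norm (s - 1) * norm s * (real (Suc n) powr (1 - Re s) * real (Suc n) powr (- 2))"
    by (simp add: norm_minus_commute)
  also have "real (Suc n) powr (1 - Re s) * real (Suc n) powr (- 2) = real (Suc n) powr (- Re s - 1)"
    by (subst powr_add[symmetric], rule arg_cong[where f = "\<lambda>x. real (Suc n) powr x"]) simp
  finally show ?thesis .
qed

text \<open>The series of first-order remainders already converges for Re s > 0. All its terms
  vanish at 1, which gives the residue 1 of zeta. The series is part of the conclusion because the
  growth bound is read off from it.\<close>

lemma zeta_times_s_minus_one:
  obtains E where "E holomorphic_on {s. Re s > 0}" "E 1 = 1"
    "\<And>s. Re s > 0 \<Longrightarrow> s \<noteq> 1 \<Longrightarrow> E s = (s - 1) * zeta s"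
    "\<And>s. Re s > 0 \<Longrightarrow> (\<lambda>n. zeta_remainder 1 n s) sums (E s - 1)"
proof -
  obtain G where G: "G holomorphic_on {s. Re s > - real 0}"
    "\<And>s. Re s > - real 0 \<Longrightarrow> (\<lambda>n. zeta_remainder (Suc 0) n s) sums G s"
    using zeta_remainder_sum_holomorphic by blast
  define E where "E = (\<lambda>s. G s + 1)"
  have E: "E holomorphic_on {s. Re s > 0}" unfolding E_def using G(1) by (intro holomorphic_intros) auto
  have G1: "G s = -1 + (s - 1) * dirichlet_series_one s" if "Re s > 1" for s
    using sums_unique2[OF G(2)[of s] zeta_remainder_sum[of s 0]] that by auto
  have z1: "zeta s = dirichlet_series_one s" if "Re s > 1" for s
    using zeta_eq_series[OF that] by (simp add: dirichlet_series_one_def)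
  have "E 1 = 1"
  proof -
    have "zeta_remainder (Suc 0) n 1 = 0" for n 
      by (simp add: zeta_remainder_def del: of_nat_Suc)
    hence "(\<lambda>n. 0) sums G 1" using G(2)[of 1] by simp
    hence "G 1 = 0" using sums_zero sums_unique2 by blast
    thus ?thesis by (simp add: E_def)
  qed
  moreover have "E s = (s - 1) * zeta s" if s: "Re s > 0" "s \<noteq> 1" for s
  proof (rule analytic_continuation_open[of "{s. Re s > 1}" "{s. Re s > 0} - {1}" E "\<lambda>s. (s - 1) * zeta s"])
    show "{s. Re s > 1} \<noteq> {}" by (auto intro!: exI[of _ 2])
    show "connected ({s. Re s > 0} - {1})"
      by (intro connected_open_delete open_halfspace_Re_gt convex_connected convex_halfspace_Re_gt) simp
    show "E holomorphic_on {s. Re s > 0} - {1}" by (rule holomorphic_on_subset[OF E]) auto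
    show "(\<lambda>s. (s - 1) * zeta s) holomorphic_on {s. 0 < Re s} - {1}"
      by (intro holomorphic_intros holomorphic_on_subset[OF zeta_holomorphic]) auto
    show "E z = (z - 1) * zeta z" if "z \<in> {s. Re s > 1}" for z using that G1[of z] z1[of z] by (simp add: E_def)
  qed (use s in \<open>auto simp: open_halfspace_Re_gt intro!: open_delete\<close>)
  moreover have "(\<lambda>n. zeta_remainder 1 n s) sums (E s - 1)" if "Re s > 0" for s
    using G(2)[of s] that by (simp add: E_def)
  ultimately show ?thesis using that E by blast
qed

text \<open>The remainders are at most \<open>norm (s - 1) * norm s * n powr (-9/8)\<close>; summing
  and dividing by \<open>norm (s - 1)\<close> leaves one factor \<open>norm s\<close>. The bound 1/8
  is 2 - 15/8, the least real part in the disc of radius 15/8 about 2 + it used below.\<close>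

lemma zeta_linear_growth:
  obtains C where "C > 0" "\<And>s. Re s \<ge> 1/8 \<Longrightarrow> \<bar>Im s\<bar> \<ge> 1 \<Longrightarrow> norm (zeta s) \<le> C * norm s"
proof -
  obtain E where E: "\<And>s. Re s > 0 \<Longrightarrow> s \<noteq> 1 \<Longrightarrow> E s = (s - 1) * zeta s"
    "\<And>s. Re s > 0 \<Longrightarrow> (\<lambda>n. zeta_remainder 1 n s) sums (E s - 1)"
    using zeta_times_s_minus_one by metis
  have sm: "summable (\<lambda>n. real (Suc n) powr (- (9/8)))"
    by (subst summable_Suc_iff) (simp add: summable_real_powr_iff)
  define B where "B = (\<Sum>n. real (Suc n) powr (- (9/8)))"
  have B: "B \<ge> 0" unfolding B_def by (intro suminf_nonneg sm) auto
  have "norm (zeta s) \<le> (1 + B) * norm s" if s: "Re s \<ge> 1/8" "\<bar>Im s\<bar> \<ge> 1" for s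
  proof -
    have s1: "s \<noteq> 1" using s by auto
    have n1: "norm (s - 1) \<ge> 1" "norm s \<ge> 1" using s abs_Im_le_cmod[of s] abs_Im_le_cmod[of "s - 1"] by auto
    have le: "norm (zeta_remainder 1 n s) \<le> norm (s - 1) * norm s * real (Suc n) powr (- (9/8))" for n
    proof -
      have "norm (zeta_remainder 1 n s) \<le> norm (s - 1) * norm s * real (Suc n) powr (- Re s - 1)"
        by (rule norm_zeta_remainder_one_le) (use s in auto)
      also have "\<dots> \<le> norm (s - 1) * norm s * real (Suc n) powr (- (9/8))"
        using s by (intro mult_left_mono powr_mono) auto
      finally show ?thesis .
    qed
    have sm': "summable (\<lambda>n. norm (s - 1) * norm s * real (Suc n) powr (- (9/8)))" by (intro summable_mult sm)
    have "E s - 1 = (\<Sum>n. zeta_remainder 1 n s)" using E(2)[of s] s by (simp add: sums_iff)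
    also have "norm \<dots> \<le> (\<Sum>n. norm (s - 1) * norm s * real (Suc n) powr (- (9/8)))"
      by (rule norm_suminf_le[OF le sm'])
    also have "\<dots> = norm (s - 1) * norm s * B" unfolding B_def by (rule suminf_mult[OF sm])
    finally have "norm (E s) \<le> 1 + norm (s - 1) * norm s * B"
      using norm_triangle_ineq2[of "E s" 1] by simp
    also have "\<dots> \<le> norm (s - 1) * norm s + norm (s - 1) * norm s * B" 
      using mult_mono[OF n1] by simp
    finally have "norm (s - 1) * norm (zeta s) \<le> norm (s - 1) * norm s + norm (s - 1) * norm s * B"
      using E(1)[of s] s s1 by (simp add: norm_mult)
    also have "\<dots> = norm (s - 1) * ((1 + B) * norm s)" by (simp add: algebra_simps)
    finally have "norm (s - 1) * norm (zeta s) \<le> norm (s - 1) * ((1 + B) * norm s)" .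
    moreover have "norm (s - 1) > 0" using n1 by linarith
    ultimately show ?thesis by simp
  qed
  thus ?thesis using that[of "1 + B"] B by auto
qed

text \<open>The first term of the series is 1 and the others add up to at most pi^2/6 - 1 < 1 in
  modulus.\<close>

lemma zeta_two_lower:
  obtains c where "c > 0" "\<And>t. norm (zeta (2 + \<i> * of_real t)) \<ge> c"
proof -
  have sums2: "(\<lambda>n. 1 / real (Suc n) ^ 2) sums (pi\<^sup>2 / 6)" using inverse_squares_sums by simp
  have c: "2 - pi\<^sup>2 / 6 > 0"
  proof -
    have "pi < 3.2" using pi_approx by simp
    hence "pi\<^sup>2 \<le> 3.2\<^sup>2" by (intro power_mono) auto
    thus ?thesis by (simp add: power2_eq_square)
  qed
  have "norm (zeta (2 + \<i> * of_real t)) \<ge> 2 - pi\<^sup>2 / 6" for t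
  proof -
    define s where "s = 2 + \<i> * of_real t"
    have s: "Re s = 2" by (simp add: s_def)
    have z1: "zeta s = dirichlet_series_one s"
      using zeta_eq_series[of s] s by (simp add: dirichlet_series_one_def)
    have "(\<lambda>n. of_nat (Suc n) powr (- s)) sums zeta s" unfolding z1 by (rule dirichlet_series_one_sums) (simp add: s)
    hence a: "(\<lambda>n. of_nat (Suc (Suc n)) powr (- s)) sums (zeta s - 1)"
      using sums_Suc_iff[of "\<lambda>n. of_nat (Suc n) powr (- s)"] by simp
    have b: "(\<lambda>n. 1 / real (Suc (Suc n)) ^ 2) sums (pi\<^sup>2 / 6 - 1)"
      using sums_Suc_iff[of "\<lambda>n. 1 / real (Suc n) ^ 2"] sums2 by simp
    have "norm (zeta s - 1) \<le> pi\<^sup>2 / 6 - 1"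
    proof -
      have "norm (\<Sum>n. of_nat (Suc (Suc n)) powr (- s)) \<le> (\<Sum>n. 1 / real (Suc (Suc n)) ^ 2)"
      proof (rule norm_suminf_le)
        show "norm (of_nat (Suc (Suc n)) powr (- s)) \<le> 1 / real (Suc (Suc n)) ^ 2" for n
          unfolding norm_Suc_powr using s by (simp add: powr_minus_divide)
      qed (use b in \<open>simp add: sums_iff\<close>)
      thus ?thesis using a b by (simp add: sums_iff)
    qed
    thus ?thesis using norm_triangle_ineq2[of 1 "1 - zeta s"] unfolding s_def[symmetric]
      by (simp add: norm_minus_commute)
  qed
  thus ?thesis using that c by blast
qed

section \<open>The von Mangoldt function\<close>

text \<open>The factor n^(-it), written through its frequency ln n so that products add
  frequencies.\<close>

abbreviation (input) osc :: "nat \<Rightarrow> real \<Rightarrow> complex" where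
  "osc n t \<equiv> exp (- (\<i> * of_real (ln (real n) * t)))"

text \<open>Unordered sums over the positive integers allow a product of two series to be regrouped
  by divisors.\<close>

lemma sums_Suc_imp_has_sum:
  fixes f :: "nat \<Rightarrow> 'a :: banach"
  assumes "summable (\<lambda>n. norm (f (Suc n)))" "(\<lambda>n. f (Suc n)) sums S"
  shows "(f has_sum S) {0<..}"
proof -
  have b: "bij_betw Suc UNIV {0<..}" by (rule bij_betwI[where g = "\<lambda>n. n - 1"]) auto
  have "((\<lambda>n. f (Suc n)) has_sum S) UNIV" using assms by (rule norm_summable_imp_has_sum)
  thus ?thesis using has_sum_reindex_bij_betw[OF b, of f S] by simp
qed

lemma zeta_deriv_sums:
  assumes "Re s > 1"
  shows "(\<lambda>n. of_nat (Suc n) powr (- s)) sums zeta s"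
    and "(\<lambda>n. - of_real (ln (real (Suc n))) * of_nat (Suc n) powr (- s)) sums deriv zeta s"
proof -
  define S where "S = {s. Re s > 1}"
  have op: "open S" by (simp add: S_def open_halfspace_Re_gt)
  have der: "((\<lambda>s. of_nat (Suc n) powr (- s)) has_field_derivative - of_real (ln (real (Suc n))) * of_nat (Suc n) powr (- s)) (at s)"
    if "s \<in> S" for n s
  proof -
    define N where "N = complex_of_nat (Suc n)"
    have N: "N \<noteq> 0" "Ln N = of_real (ln (real (Suc n)))" unfolding N_def by (simp_all add: Ln_of_nat del: of_nat_Suc)
    have "((\<lambda>s. N powr (- s)) has_field_derivative (Ln N * N powr (- s)) * (- 1)) (at s)"
      by (rule DERIV_chain2[of "\<lambda>z. N powr z", OF has_field_derivative_powr_right[OF N(1)]]) (auto intro!: derivative_eq_intros)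
    thus ?thesis unfolding N(2) N_def[symmetric] by simp
  qed
  have bd: "\<exists>d h. 0 < d \<and> summable h \<and> range h \<subseteq> \<real>\<^sub>\<ge>\<^sub>0 \<and>
      (\<forall>\<^sub>F n in sequentially. \<forall>y\<in>ball s d \<inter> S. cmod (of_nat (Suc n) powr (- y)) \<le> cmod (h n))"
    if s: "s \<in> S" for s
  proof -
    define d where "d = (Re s - 1) / 2"
    have d: "d > 0" using s by (simp add: d_def S_def)
    define h where "h = (\<lambda>n. complex_of_real (real (Suc n) powr (- (1 + d))))"
    have "summable (\<lambda>n. real (Suc n) powr (- (1 + d)))"
      by (subst summable_Suc_iff) (use d in \<open>simp add: summable_real_powr_iff\<close>)
    hence "summable h" unfolding h_def by (rule summable_of_real)
    moreover have "cmod (of_nat (Suc n) powr (- y)) \<le> cmod (h n)" if "y \<in> ball s d" for n y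
    proof -
      have "Re y > 1 + d" using Re_ball_bound[OF that] by (simp add: d_def field_simps)
      thus ?thesis unfolding norm_Suc_powr h_def by (simp add: powr_mono)
    qed
    moreover have "range h \<subseteq> \<real>\<^sub>\<ge>\<^sub>0" by (auto simp: h_def)
    ultimately show ?thesis using d by (intro exI[of _ d] exI[of _ h]) auto
  qed
  obtain g g' where g: "\<forall>x\<in>S. (\<lambda>n. of_nat (Suc n) powr (- x)) sums g x \<and>
     (\<lambda>n. - of_real (ln (real (Suc n))) * of_nat (Suc n) powr (- x)) sums g' x \<and> (g has_field_derivative g' x) (at x)"
    using series_and_derivative_comparison_complex[OF op der bd] by blast
  have zg: "zeta x = g x" if "x \<in> S" for x
    using g that zeta_eq_series[of x] by (auto simp: S_def sums_iff powr_minus_divide)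
  have "(zeta has_field_derivative g' s) (at s)"
    by (rule DERIV_cong_ev[THEN iffD1, of s s g zeta "g' s" "g' s"])
       (use g zg assms eventually_nhds_in_open[OF op, of s] in \<open>auto elim!: eventually_mono simp: S_def\<close>)
  hence "deriv zeta s = g' s" by (rule DERIV_imp_deriv)
  with g zg assms show "(\<lambda>n. of_nat (Suc n) powr (- s)) sums zeta s"
    "(\<lambda>n. - of_real (ln (real (Suc n))) * of_nat (Suc n) powr (- s)) sums deriv zeta s"
    by (auto simp: S_def)
qed

lemma nat_powr_of_real: "of_nat n powr (- complex_of_real \<sigma>) = of_real (real n powr (- \<sigma>))"
  by (subst powr_of_real[symmetric]) auto

text \<open>Summability is read off from the differentiated series of zeta at a real point.\<close>

lemma summable_ln_powr:
  fixes \<sigma> :: real assumes "\<sigma> > 1"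
  shows "summable (\<lambda>n. ln (real (Suc n)) * real (Suc n) powr (- \<sigma>))"
proof -
  have "(\<lambda>n. - of_real (ln (real (Suc n))) * of_nat (Suc n) powr (- complex_of_real \<sigma>)) sums deriv zeta (of_real \<sigma>)"
    by (rule zeta_deriv_sums) (use assms in simp)
  hence "summable (\<lambda>n. - Re (- of_real (ln (real (Suc n))) * of_nat (Suc n) powr (- complex_of_real \<sigma>)))"
    by (intro summable_minus summable_Re) (simp add: sums_iff)
  moreover have "- Re (- of_real (ln (real (Suc n))) * of_nat (Suc n) powr (- complex_of_real \<sigma>)) =
      ln (real (Suc n)) * real (Suc n) powr (- \<sigma>)" for n
    by (simp add: nat_powr_of_real del: of_nat_Suc)
  ultimately show ?thesis by (simp only:)
qed

lemma summable_mangoldt_powr: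
  fixes \<sigma> :: real assumes "\<sigma> > 1"
  shows "summable (\<lambda>n. mangoldt (Suc n) * real (Suc n) powr (- \<sigma>))"
proof (rule summable_comparison_test'[OF summable_ln_powr[OF assms]])
  show "norm (mangoldt (Suc n) * real (Suc n) powr (- \<sigma>)) \<le> ln (real (Suc n)) * real (Suc n) powr (- \<sigma>)" for n
    using mangoldt_le[of "Suc n"] by (auto simp: abs_mult mangoldt_nonneg intro!: mult_right_mono)
qed

lemma norm_nat_powr: "n > 0 \<Longrightarrow> norm (of_nat n powr (s::complex)) = real n powr Re s"
  using norm_Suc_powr[of "n - 1" s] by simp

lemma nat_powr_vertical:
  assumes "n > 0"
  shows "of_nat n powr (- Complex \<sigma> t) = of_real (real n powr (- \<sigma>)) * osc n t"
proof -
  have "- Complex \<sigma> t * of_real (ln (real n)) = of_real (- \<sigma> * ln (real n)) + (- (\<i> * of_real (ln (real n) * t)))"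
    by (simp add: complex_eq_iff)
  hence "of_nat n powr (- Complex \<sigma> t) = exp (of_real (- \<sigma> * ln (real n)) + (- (\<i> * of_real (ln (real n) * t))))"
    using assms by (simp only: powr_def Ln_of_nat) simp
  also have "\<dots> = of_real (exp (- \<sigma> * ln (real n))) * osc n t"
    by (simp only: exp_add exp_of_real)
  also have "exp (- \<sigma> * ln (real n)) = real n powr (- \<sigma>)" using assms by (simp add: powr_def)
  finally show ?thesis .
qed

text \<open>The absolutely convergent series of zeta and of the von Mangoldt function are
  multiplied; the sum of \<open>mangoldt d\<close> over the divisors d of n is ln n, which yields
  the series of \<open>- deriv zeta\<close>. The product form leaves the division by
  \<open>zeta s\<close> to places where it is known to be nonzero.\<close>

lemma zeta_log_deriv_has_sum:
  assumes s: "Re s > 1"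
  obtains X where "((\<lambda>n. mangoldt n * of_nat n powr (- s)) has_sum X) {0<..}" "zeta s * X = - deriv zeta s"
proof -
  have sz: "summable (\<lambda>n. norm (of_nat (Suc n) powr (- s)))"
  proof -
    have "summable (\<lambda>n. real (Suc n) powr (- Re s))"
      by (subst summable_Suc_iff) (use s in \<open>simp add: summable_real_powr_iff\<close>)
    thus ?thesis unfolding norm_Suc_powr by simp
  qed
  have sm: "summable (\<lambda>n. norm (mangoldt (Suc n) * of_nat (Suc n) powr (- s)))"
    using summable_mangoldt_powr[OF s] unfolding norm_mult norm_Suc_powr by simp
  have hz: "((\<lambda>n. of_nat n powr (- s)) has_sum zeta s) {0<..}"
    by (rule sums_Suc_imp_has_sum[OF sz zeta_deriv_sums(1)[OF s]])
  define X where "X = (\<Sum>n. mangoldt (Suc n) * of_nat (Suc n) powr (- s))"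
  have hX: "((\<lambda>n. mangoldt n * of_nat n powr (- s)) has_sum X) {0<..}"
    unfolding X_def by (rule sums_Suc_imp_has_sum[OF sm summable_sums[OF summable_norm_cancel[OF sm]]])
  have sz': "summable (\<lambda>n. norm (norm (of_nat (Suc n) powr (- s) :: complex)))" using sz by simp
  have sm': "summable (\<lambda>n. norm (norm (mangoldt (Suc n) * of_nat (Suc n) powr (- s) :: complex)))" using sm by simp
  obtain Z0 where Z0: "((\<lambda>n. norm (of_nat n powr (- s) :: complex)) has_sum Z0) {0<..}"
    using sums_Suc_imp_has_sum[OF sz' summable_sums[OF sz]] by blast
  obtain X0 where X0: "((\<lambda>n. norm (mangoldt n * of_nat n powr (- s) :: complex)) has_sum X0) {0<..}"
    using sums_Suc_imp_has_sum[OF sm' summable_sums[OF sm]] by blast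
  define h where "h = (\<lambda>(d, e). mangoldt d * of_nat d powr (- s) * of_nat e powr (- s) :: complex)"
  have h_abs: "(\<lambda>x. norm (h x)) summable_on ({0<..} \<times> {0<..})"
  proof (rule summable_on_SigmaI)
    show "((\<lambda>y. norm (h (x, y))) has_sum norm (mangoldt x * of_nat x powr (- s) :: complex) * Z0) {0<..}" for x
      unfolding h_def prod.case norm_mult[of "mangoldt x * of_nat x powr (- s)"] by (rule has_sum_cmult_right[OF Z0])
    show "(\<lambda>x. norm (mangoldt x * of_nat x powr (- s) :: complex) * Z0) summable_on {0<..}"
      using has_sum_cmult_left[OF X0, of Z0] by (rule has_sum_imp_summable)
  qed auto
  have hsum: "(h has_sum X * zeta s) ({0<..} \<times> {0<..})"
  proof (rule has_sum_SigmaI)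
    show "((\<lambda>y. h (x, y)) has_sum (mangoldt x * of_nat x powr (- s)) * zeta s) {0<..}" for x
      unfolding h_def prod.case by (rule has_sum_cmult_right[OF hz])
    show "((\<lambda>x. (mangoldt x * of_nat x powr (- s)) * zeta s) has_sum X * zeta s) {0<..}"
      by (rule has_sum_cmult_left[OF hX])
    show "h summable_on {0<..} \<times> {0<..}" by (rule abs_summable_summable[OF h_abs])
  qed
  define k where "k = (\<lambda>(n, d). mangoldt d * of_nat n powr (- s) :: complex)"
  \<comment> \<open>The pair (d, e) is sent to (d e, d), which groups the double series by n = d
    e.\<close>
  have "(h has_sum X * zeta s) ({0<..} \<times> {0<..}) \<longleftrightarrow> (k has_sum X * zeta s) (Sigma {0<..} (\<lambda>n. {d. d dvd n}))"
  proof (rule has_sum_reindex_bij_witness[of _ "\<lambda>(n, d). (d, n div d)" "\<lambda>(d, e). (d * e, d)"])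
    show "k (case a of (d, e) \<Rightarrow> (d * e, d)) = h a" if a: "a \<in> {0<..} \<times> {0<..}" for a
    proof -
      obtain d e where de: "a = (d, e)" "d > 0" "e > 0" using a by auto
      have "of_nat (d * e) powr (- s) = of_nat d powr (- s) * of_nat e powr (- s)"
        using powr_times_real[of "of_nat d" "of_nat e" "- s"] by simp
      thus ?thesis by (simp add: de k_def h_def)
    qed
  qed (auto elim!: dvdE)
  hence ksum: "(k has_sum X * zeta s) (Sigma {0<..} (\<lambda>n. {d. d dvd n}))" using hsum by simp
  have "((\<lambda>n. of_real (ln (real n)) * of_nat n powr (- s)) has_sum X * zeta s) {0<..}"
  proof (rule has_sum_SigmaD[OF ksum])
    fix n :: nat assume n: "n \<in> {0<..}"
    have "(\<Sum>d | d dvd n. k (n, d)) = (\<Sum>d | d dvd n. mangoldt d) * of_nat n powr (- s)"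
      by (simp add: k_def sum_distrib_right)
    also have "\<dots> = of_real (ln (real n)) * of_nat n powr (- s)" using n by (subst mangoldt_sum) auto
    finally show "((\<lambda>d. k (n, d)) has_sum of_real (ln (real n)) * of_nat n powr (- s)) {d. d dvd n}"
      using n by (intro has_sum_finiteI) auto
  qed
  moreover have "((\<lambda>n. of_real (ln (real n)) * of_nat n powr (- s)) has_sum - deriv zeta s) {0<..}"
  proof (rule sums_Suc_imp_has_sum)
    show "summable (\<lambda>n. norm (of_real (ln (real (Suc n))) * of_nat (Suc n) powr (- s) :: complex))"
      using summable_ln_powr[OF s] unfolding norm_mult norm_Suc_powr by simp
    show "(\<lambda>n. of_real (ln (real (Suc n))) * of_nat (Suc n) powr (- s)) sums - deriv zeta s"
      using sums_minus[OF zeta_deriv_sums(2)[OF s]] by simp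
  qed
  ultimately have "X * zeta s = - deriv zeta s" by (rule has_sum_unique)
  thus ?thesis using that hX by (simp add: mult.commute)
qed

lemma zeta_real_gt_1_nonzero:
  assumes "(\<sigma>::real) > 1" shows "zeta (of_real \<sigma>) \<noteq> 0"
proof -
  have "(\<lambda>n. of_nat (Suc n) powr (- complex_of_real \<sigma>)) sums zeta (of_real \<sigma>)"
    by (rule zeta_deriv_sums) (use assms in simp)
  hence "(\<lambda>n. Re (of_nat (Suc n) powr (- complex_of_real \<sigma>))) sums Re (zeta (of_real \<sigma>))" by (rule sums_Re)
  moreover have "Re (of_nat (Suc n) powr (- complex_of_real \<sigma>)) = real (Suc n) powr (- \<sigma>)" for n
    by (simp add: nat_powr_of_real del: of_nat_Suc)
  ultimately have *: "(\<lambda>n. real (Suc n) powr (- \<sigma>)) sums Re (zeta (of_real \<sigma>))" by simp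
  have "(\<Sum>n<1. real (Suc n) powr (- \<sigma>)) \<le> Re (zeta (of_real \<sigma>))"
    using * sum_le_suminf[of "\<lambda>n. real (Suc n) powr (- \<sigma>)" "{..<1}"] by (auto simp: sums_iff)
  thus ?thesis by auto
qed

text \<open>
  Up to a factor \<open>exp 1\<close> the sum is dominated by \<open>- \<zeta>' / \<zeta>\<close> at \<open>1 + 1 / y\<close>, which is \<open>O(y)\<close> by the simple
  pole at \<open>1\<close>.
\<close>

lemma sum_mangoldt_div_le:
  obtains C where "C > 0" "\<And>y. y \<ge> 1 \<Longrightarrow> (\<Sum>n\<in>{1..nat \<lfloor>exp y\<rfloor>}. mangoldt n / real n) \<le> C * y"
proof -
  obtain E where E: "E holomorphic_on {s. Re s > 0}" "E 1 = 1"
    "\<And>s. Re s > 0 \<Longrightarrow> s \<noteq> 1 \<Longrightarrow> E s = (s - 1) * zeta s" using zeta_times_s_minus_one by metis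
  have op: "open {s. Re s > 0}" by (simp add: open_halfspace_Re_gt)
  \<comment> \<open>On the segment [1, 2] the function E = (s - 1) zeta has no zero, including the
    point 1 where its value is 1. So E'/E is bounded there, and
    \<open>- deriv zeta s / zeta s\<close> differs from 1 / (s - 1) by E'/E only.\<close>
  define I where "I = (complex_of_real ` {1..2})"
  have I: "compact I" "I \<subseteq> {s. Re s > 0}" unfolding I_def by (auto intro!: compact_continuous_image continuous_intros)
  have Enz: "E z \<noteq> 0" if "z \<in> I" for z
  proof -
    from that obtain x where x: "z = of_real x" "x \<ge> 1" by (auto simp: I_def)
    show ?thesis
    proof (cases "x = 1")
      case False
      thus ?thesis using E(3)[of z] zeta_real_gt_1_nonzero[of x] x by auto
    qed (use E(2) x in auto)
  qed
  have "continuous_on I (\<lambda>z. deriv E z / E z)"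
    using holomorphic_on_imp_continuous_on[OF holomorphic_deriv[OF E(1) op]] holomorphic_on_imp_continuous_on[OF E(1)] I Enz
    by (intro continuous_intros) (auto intro: continuous_on_subset)
  hence "compact ((\<lambda>z. deriv E z / E z) ` I)" using I by (intro compact_continuous_image) auto
  then obtain M where M: "\<And>z. z \<in> I \<Longrightarrow> norm (deriv E z / E z) \<le> M"
    unfolding compact_eq_bounded_closed bounded_iff by blast
  have M0: "M \<ge> 0" 
  proof -
    have "1 \<in> I" unfolding I_def by (rule image_eqI[of _ _ 1]) auto
    from M[OF this] show ?thesis using norm_ge_zero order_trans by blast
  qed
  have key: "(\<Sum>n\<in>{1..nat \<lfloor>exp y\<rfloor>}. mangoldt n / real n) \<le> exp 1 * (1 + M) * y" if y: "y \<ge> 1" for y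
  proof -
    define \<sigma> where "\<sigma> = 1 + 1 / y"
    define s where "s = complex_of_real \<sigma>"
    have \<sigma>: "\<sigma> > 1" "\<sigma> \<le> 2" using y by (auto simp: \<sigma>_def field_simps)
    have sI: "s \<in> I" using \<sigma> by (auto simp: I_def s_def)
    have s1: "Re s > 1" "s \<noteq> 1" using \<sigma> by (auto simp: s_def)
    from zeta_log_deriv_has_sum[OF s1(1)] obtain X where
      X: "((\<lambda>n. mangoldt n * of_nat n powr (- s)) has_sum X) {0<..}" "zeta s * X = - deriv zeta s" by blast
    have zs: "zeta s \<noteq> 0" unfolding s_def by (rule zeta_real_gt_1_nonzero[OF \<sigma>(1)])
    have "(zeta has_field_derivative deriv zeta s) (at s)"
      by (rule holomorphic_derivI[OF zeta_holomorphic]) (use s1 in auto)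
    hence "((\<lambda>z. (z - 1) * zeta z) has_field_derivative zeta s + deriv zeta s * (s - 1)) (at s)"
      by (auto intro!: derivative_eq_intros)
    moreover have "\<forall>\<^sub>F z in nhds s. E z = (z - 1) * zeta z"
      using eventually_nhds_in_open[OF open_delete[OF op, of 1], of s] s1 E(3)
      by (auto elim!: eventually_mono)
    ultimately have "(E has_field_derivative zeta s + deriv zeta s * (s - 1)) (at s)"
      by (subst DERIV_cong_ev[OF refl _ refl])
    hence "deriv E s = zeta s + deriv zeta s * (s - 1)" by (rule DERIV_imp_deriv)
    moreover have "deriv zeta s = - (zeta s * X)" using X(2) by simp
    ultimately have "deriv E s = zeta s * (1 - X * (s - 1))" by (simp add: algebra_simps)
    moreover have "E s = zeta s * (s - 1)" using E(3)[of s] s1 by simp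
    ultimately have "deriv E s / E s = (zeta s * (1 - X * (s - 1))) / (zeta s * (s - 1))" by (simp only:)
    also have "\<dots> = 1 / (s - 1) - X" using zs s1 by (simp add: diff_divide_distrib)
    finally have "deriv E s / E s = 1 / (s - 1) - X" .
    hence "X = 1 / (s - 1) - deriv E s / E s" by simp
    also have "1 / (s - 1) = of_real y" using y by (simp add: s_def \<sigma>_def)
    finally have "norm X \<le> y + M"
      using norm_triangle_ineq4[of "of_real y" "deriv E s / E s"] M[OF sI] y by simp
    also have "\<dots> \<le> (1 + M) * y" using mult_left_mono[OF y M0] by (simp add: algebra_simps)
    finally have Xle: "Re X \<le> (1 + M) * y" using complex_Re_le_cmod[of X] by linarith
    have RX: "((\<lambda>n. mangoldt n * real n powr (- \<sigma>)) has_sum Re X) {0<..}"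
    proof -
      have "((\<lambda>n. Re (mangoldt n * of_nat n powr (- s))) has_sum Re X) {0<..}" by (rule has_sum_Re[OF X(1)])
      moreover have "Re (mangoldt n * of_nat n powr (- s)) = mangoldt n * real n powr (- \<sigma>)" if "n \<in> {0<..}" for n
        by (simp add: s_def nat_powr_of_real)
      ultimately show ?thesis by (subst (asm) has_sum_cong) auto
    qed
    have "(\<Sum>n\<in>{1..nat \<lfloor>exp y\<rfloor>}. mangoldt n / real n) \<le> (\<Sum>n\<in>{1..nat \<lfloor>exp y\<rfloor>}. exp 1 * (mangoldt n * real n powr (- \<sigma>)))"
    proof (rule sum_mono)
      fix n assume n: "n \<in> {1..nat \<lfloor>exp y\<rfloor>}"
      hence n': "real n \<le> exp y" "n \<ge> 1" by (auto simp: le_nat_iff le_floor_iff)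
      have "ln (real n) \<le> ln (exp y)" using n' by (intro ln_mono) auto
      hence "ln (real n) \<le> y" by simp
      hence "real n powr (1 / y) \<le> exp 1" using n' y by (simp add: powr_def field_simps)
      hence "1 \<le> exp 1 * real n powr (- (1 / y))" using n' by (simp add: powr_minus field_simps)
      hence "(mangoldt n / real n) * 1 \<le> (mangoldt n / real n) * (exp 1 * real n powr (- (1 / y)))"
        by (intro mult_left_mono) (auto simp: mangoldt_nonneg)
      also have "\<dots> = exp 1 * (mangoldt n * real n powr (- \<sigma>))"
      proof -
        have "- \<sigma> = - (1 / y) - 1" by (simp add: \<sigma>_def)
        hence "real n powr (- \<sigma>) = real n powr (- (1 / y)) / real n" using n' by (simp only: powr_diff) simp
        thus ?thesis by simp
      qed
      finally show "mangoldt n / real n \<le> exp 1 * (mangoldt n * real n powr (- \<sigma>))" by simp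
    qed
    also have "\<dots> = exp 1 * (\<Sum>n\<in>{1..nat \<lfloor>exp y\<rfloor>}. mangoldt n * real n powr (- \<sigma>))" by (simp add: sum_distrib_left)
    also have "(\<Sum>n\<in>{1..nat \<lfloor>exp y\<rfloor>}. mangoldt n * real n powr (- \<sigma>)) \<le> Re X"
      by (rule finite_sum_le_has_sum[OF RX]) (auto simp: mangoldt_nonneg)
    also have "exp 1 * Re X \<le> exp 1 * ((1 + M) * y)" using Xle by simp
    finally show ?thesis by (simp add: mult_ac)
  qed
  show ?thesis by (rule that[of "exp 1 * (1 + M)"]) (use key M0 in \<open>auto simp: add_pos_nonneg\<close>)
qed

section \<open>Zeros of the zeta function on the Riemann hypothesis\<close>

lemma zeta_nonzero:
  assumes "riemann_hypothesis" "Re s > 0" "Re s \<noteq> 1/2" "s \<noteq> 1"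
  shows "zeta s \<noteq> 0"
proof
  assume "zeta s = 0"
  moreover have "\<not> (\<exists>n::nat. n \<ge> 1 \<and> s = - 2 * of_nat n)" using assms(2) by auto
  ultimately show False using assms unfolding riemann_hypothesis_def by blast
qed

lemma holomorphic_zeta_log_deriv:
  assumes RH: "riemann_hypothesis" and R: "open R" "\<And>s. s \<in> R \<Longrightarrow> Re s > 1/2 \<and> s \<noteq> 1"
  shows "log_deriv_zeta holomorphic_on R"
proof -
  have h: "zeta holomorphic_on R" by (rule holomorphic_on_subset[OF zeta_holomorphic]) (use R(2) in auto)
  have "zeta s \<noteq> 0" if "s \<in> R" for s by (rule zeta_nonzero[OF RH]) (use R(2)[OF that] in auto)
  thus ?thesis by (intro holomorphic_intros holomorphic_deriv h R(1))
qed

text \<open>The radius is 13/8 = 3/2 + 1/8: points right of the critical line with real part at most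
  2 lie in the disc if their height differs from t by at most 1/8. One list of zeros therefore
  serves a whole short vertical segment.\<close>

abbreviation (input) zeros_near :: "real \<Rightarrow> real \<Rightarrow> complex list \<Rightarrow> bool" where
  "zeros_near C t \<rho>s \<equiv> (\<forall>\<rho>\<in>set \<rho>s. Re \<rho> = 1/2) \<and> real (length \<rho>s) \<le> C * ln t \<and>
      (\<forall>s. Re s > 1/2 \<longrightarrow> dist s (Complex 2 t) \<le> 13/8 \<longrightarrow>
         norm (log_deriv_zeta s - pole_sum \<rho>s s) \<le> C * ln t)"

text \<open>Landau's lemma is applied around 2 + it with radii 13/8 < 7/4 < 15/8. Within 7/4 the
  real part is at least 1/4, so the zeros found are nontrivial and lie on the critical line; within
  15/8 it is at least 1/8, where the growth bound holds; even radius 2 stays away from the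
  pole.\<close>

lemma zeta_log_deriv_zeros:
  assumes RH: "riemann_hypothesis"
  obtains C where "C > 0"
    "\<And>t. t \<ge> 4 \<Longrightarrow> \<exists>\<rho>s. zeros_near C t \<rho>s"
proof -
  obtain c where c: "c > 0" "\<And>t. norm (zeta (2 + \<i> * of_real t)) \<ge> c" using zeta_two_lower by metis
  obtain B where B: "B > 0" "\<And>s. Re s \<ge> 1/8 \<Longrightarrow> \<bar>Im s\<bar> \<ge> 1 \<Longrightarrow> norm (zeta s) \<le> B * norm s"
    using zeta_linear_growth by metis
  obtain C where C: "C > 0" "\<And>f S M. f holomorphic_on S \<Longrightarrow> open S \<Longrightarrow> cball 0 (15/8) \<subseteq> S \<Longrightarrow> f 0 \<noteq> 0 \<Longrightarrow>
       (\<And>z. z \<in> cball 0 (15/8) \<Longrightarrow> norm (f z) \<le> M) \<Longrightarrow>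
       \<exists>\<rho>s. (\<forall>\<rho>\<in>set \<rho>s. norm \<rho> \<le> 7/4 \<and> f \<rho> = 0) \<and>
         length \<rho>s \<le> C * (ln (M / norm (f 0)) + 1) \<and>
         (\<forall>z\<in>cball 0 (13/8). f z \<noteq> 0 \<longrightarrow>
            norm (deriv f z / f z - pole_sum \<rho>s z) \<le> C * (ln (M / norm (f 0)) + 1))"
    by (rule landau_log_derivative[of "13/8" "7/4" "15/8"]) auto
  \<comment> \<open>Since \<open>ln t >= 1\<close>, all additive constants in ln (2 B t / c) + 1 are
    absorbed by a multiple of ln t.\<close>
  define D where "D = \<bar>ln (2 * B / c)\<bar> + 2"
  show thesis
  proof (rule that[of "C * D"])
    show "C * D > 0" using C by (simp add: D_def)
    fix t :: real assume t: "t \<ge> 4"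
    define f where "f = (\<lambda>z. zeta (Complex 2 t + z))"
    define S where "S = ball (0::complex) 2"
    have Im: "Im (Complex 2 t + z) \<ge> 2" "Complex 2 t + z \<noteq> 1" if "norm z \<le> 2" for z
    proof -
      show *: "Im (Complex 2 t + z) \<ge> 2" using abs_Im_le_cmod[of z] that t by simp
      show "Complex 2 t + z \<noteq> 1" using * by (auto simp del: plus_complex.sel)
    qed
    have fS: "f holomorphic_on S"
    proof -
      have "(zeta \<circ> (\<lambda>z. Complex 2 t + z)) holomorphic_on S"
      proof (rule holomorphic_on_compose_gen[OF _ zeta_holomorphic])
        show "(\<lambda>z. Complex 2 t + z) ` S \<subseteq> - {1}"
        proof (rule image_subsetI)
          fix z assume "z \<in> S"
          hence "norm z \<le> 2" by (simp add: S_def)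
          thus "Complex 2 t + z \<in> - {1}" using Im(2) by simp
        qed
      qed (intro holomorphic_intros)
      thus ?thesis by (simp add: f_def o_def)
    qed
    have f0: "norm (f 0) \<ge> c" using c(2)[of t] by (simp add: f_def Complex_eq)
    hence f0': "f 0 \<noteq> 0" using c(1) by auto
    have sub: "cball (0::complex) (15/8) \<subseteq> S" unfolding S_def by auto
    have fM: "norm (f z) \<le> B * (2 * t)" if "z \<in> cball 0 (15/8)" for z
    proof -
      have z: "norm z \<le> 15/8" using that by simp
      have "norm (f z) \<le> B * norm (Complex 2 t + z)" unfolding f_def
        by (rule B(2)) (use Im(1)[of z] z abs_Re_le_cmod[of z] in auto)
      also have "norm (Complex 2 t + z) \<le> 2 * t"
        using norm_triangle_ineq[of "Complex 2 t" z] cmod_le[of "Complex 2 t"] z t by simp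
      finally show ?thesis using B(1) by simp
    qed
    obtain \<rho>s where \<rho>s: "\<forall>\<rho>\<in>set \<rho>s. norm \<rho> \<le> 7/4 \<and> f \<rho> = 0"
      "length \<rho>s \<le> C * (ln (B * (2 * t) / norm (f 0)) + 1)"
      "\<forall>z\<in>cball 0 (13/8). f z \<noteq> 0 \<longrightarrow>
            norm (deriv f z / f z - pole_sum \<rho>s z) \<le> C * (ln (B * (2 * t) / norm (f 0)) + 1)"
      using C(2)[OF fS _ sub f0' fM] unfolding S_def by blast
    have lnt: "ln t \<ge> 1"
    proof -
      have "exp 1 \<le> t" using exp_le t by linarith
      thus ?thesis using t by (subst ln_ge_iff) auto
    qed
    have bnd: "C * (ln (B * (2 * t) / norm (f 0)) + 1) \<le> C * D * ln t"
    proof -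
      have "ln (B * (2 * t) / norm (f 0)) \<le> ln (B * (2 * t) / c)"
      proof (rule ln_mono)
        show "B * (2 * t) / norm (f 0) \<le> B * (2 * t) / c"
          using B(1) t c(1) f0 by (intro divide_left_mono) (auto intro!: mult_pos_pos simp: f0')
      qed (use B(1) t f0' in auto)
      also have "B * (2 * t) / c = (2 * B / c) * t" by simp
      also have "ln \<dots> = ln (2 * B / c) + ln t" using B(1) c(1) t by (subst ln_mult) auto
      also have "\<dots> \<le> \<bar>ln (2 * B / c)\<bar> * ln t + ln t" 
        using mult_left_mono[OF lnt, of "\<bar>ln (2 * B / c)\<bar>"] by linarith
      finally have "ln (B * (2 * t) / norm (f 0)) + 1 \<le> D * ln t" using lnt unfolding D_def by (simp add: algebra_simps)
      thus ?thesis using C(1) by (simp add: mult.assoc)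
    qed
    define \<rho>s' where "\<rho>s' = map (\<lambda>\<rho>. Complex 2 t + \<rho>) \<rho>s"
    show "\<exists>\<rho>s. zeros_near (C * D) t \<rho>s"
    proof (intro exI[of _ \<rho>s'] conjI ballI allI impI)
      fix \<rho> assume "\<rho> \<in> set \<rho>s'"
      then obtain \<rho>' where \<rho>': "\<rho>' \<in> set \<rho>s" "\<rho> = Complex 2 t + \<rho>'" by (auto simp: \<rho>s'_def)
      have n: "norm \<rho>' \<le> 7/4" and z: "zeta \<rho> = 0" using \<rho>s(1) \<rho>' by (auto simp: f_def)
      have "Re \<rho> > 0" using \<rho>' n abs_Re_le_cmod[of \<rho>'] by simp
      moreover have "\<rho> \<noteq> 1" using Im(2)[of \<rho>'] n \<rho>' by auto
      ultimately show "Re \<rho> = 1/2" using zeta_nonzero[OF RH] z by blast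
    next
      show "real (length \<rho>s') \<le> C * D * ln t" using \<rho>s(2) bnd by (simp add: \<rho>s'_def)
    next
      fix s assume s: "Re s > 1/2" "dist s (Complex 2 t) \<le> 13/8"
      define z where "z = s - Complex 2 t"
      have z: "norm z \<le> 13/8" "Complex 2 t + z = s" using s by (auto simp: z_def dist_norm)
      have s1: "s \<noteq> 1" using Im(2)[of z] z by auto
      have "zeta s \<noteq> 0" by (rule zeta_nonzero[OF RH]) (use s s1 in auto)
      hence fz: "f z \<noteq> 0" "f z = zeta s" using z by (auto simp: f_def)
      have "(zeta has_field_derivative deriv zeta s) (at (Complex 2 t + z))"
        unfolding z(2) by (rule holomorphic_derivI[OF zeta_holomorphic]) (use s1 in auto)
      hence "(f has_field_derivative deriv zeta s * 1) (at z)" unfolding f_def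
        by (rule DERIV_chain2) (auto intro!: derivative_eq_intros)
      hence df: "deriv f z = deriv zeta s" by (simp add: DERIV_imp_deriv)
      have "pole_sum \<rho>s' s = pole_sum \<rho>s z"
        unfolding pole_sum_def \<rho>s'_def z_def by (simp add: o_def algebra_simps)
      thus "norm (log_deriv_zeta s - pole_sum \<rho>s' s) \<le> C * D * ln t"
        using \<rho>s(3) fz df z(1) bnd by fastforce
    qed
  qed
qed

text \<open>Each of the O(ln t) terms is at most 1 / (Re s - 1/2). This bound controls the parts of
  the contour outside the short segment and settles the case of very large x.\<close>

lemma zeta_log_deriv_pointwise:
  assumes RH: "riemann_hypothesis"
  obtains C where "C > 0"
    "\<And>s. Re s > 1/2 \<Longrightarrow> Re s \<le> 2 \<Longrightarrow> Im s \<ge> 4 \<Longrightarrow> norm (log_deriv_zeta s) \<le> C * ln (Im s) / (Re s - 1/2)"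
proof -
  obtain C where C: "C > 0" "\<And>t. t \<ge> 4 \<Longrightarrow> \<exists>\<rho>s. zeros_near C t \<rho>s"
    using zeta_log_deriv_zeros[OF RH] by blast
  have "norm (log_deriv_zeta s) \<le> 3 * C * ln (Im s) / (Re s - 1/2)" if s: "Re s > 1/2" "Re s \<le> 2" "Im s \<ge> 4" for s
  proof -
    define b where "b = Re s - 1/2"
    have b: "0 < b" "b \<le> 3/2" using s by (auto simp: b_def)
    obtain \<rho>s where \<rho>s: "\<forall>\<rho>\<in>set \<rho>s. Re \<rho> = 1/2" "real (length \<rho>s) \<le> C * ln (Im s)"
      "\<And>w. Re w > 1/2 \<Longrightarrow> dist w (Complex 2 (Im s)) \<le> 13/8 \<Longrightarrow>
         norm (log_deriv_zeta w - pole_sum \<rho>s w) \<le> C * ln (Im s)" using C(2)[OF s(3)] by blast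
    have "dist s (Complex 2 (Im s)) = \<bar>Re s - 2\<bar>" unfolding dist_norm by (simp add: cmod_def)
    hence 1: "norm (log_deriv_zeta s - pole_sum \<rho>s s) \<le> C * ln (Im s)" using s by (intro \<rho>s(3)) auto
    have "norm (pole_sum \<rho>s s) \<le> (\<Sum>\<rho>\<leftarrow>\<rho>s. 1 / b)"
      unfolding pole_sum_def
    proof (rule norm_sum_list_le)
      fix \<rho> assume "\<rho> \<in> set \<rho>s"
      hence "Re (s - \<rho>) = b" using \<rho>s(1) by (simp add: b_def)
      hence "b \<le> norm (s - \<rho>)" using complex_Re_le_cmod by metis
      thus "norm (1 / (s - \<rho>)) \<le> 1 / b" using b by (simp add: norm_divide frac_le)
    qed
    also have "\<dots> = length \<rho>s * (1 / b)" by (simp add: sum_list_triv)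
    also have "\<dots> \<le> C * ln (Im s) * (1 / b)" using \<rho>s(2) b by (intro mult_right_mono) auto
    finally have 2: "norm (pole_sum \<rho>s s) \<le> C * ln (Im s) / b" by simp
    have "ln (Im s) \<ge> 0" using s by simp
    hence "C * ln (Im s) * b \<le> C * ln (Im s) * 2" using C(1) b by (intro mult_left_mono) auto
    hence 3: "C * ln (Im s) \<le> 2 * (C * ln (Im s)) / b" using b by (simp add: field_simps)
    have "norm (log_deriv_zeta s) \<le> C * ln (Im s) / b + 2 * (C * ln (Im s)) / b"
      using 1 2 3 norm_triangle_sub[of "log_deriv_zeta s" "pole_sum \<rho>s s"] by linarith
    thus ?thesis by (simp add: b_def add_divide_distrib[symmetric])
  qed
  thus ?thesis using that[of "3 * C"] C(1) by simp
qed

section \<open>The smoothing kernel\<close>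

text \<open>A primitive exists on the convex open set, and the two horizontal integrals differ by
  its increments along the vertical sides, each of which is at most B times the height.\<close>

lemma rectangle_shift_bound:
  fixes f :: "complex \<Rightarrow> complex"
  assumes S: "open S" "convex S" "f holomorphic_on S"
    and x: "x1 \<le> x2" and sub: "\<And>x y. x1 \<le> x \<Longrightarrow> x \<le> x2 \<Longrightarrow> y \<in> {y1..y2} \<Longrightarrow> Complex x y \<in> S"
    and y: "y1 \<le> y2"
    and B: "\<And>y. y \<in> {y1..y2} \<Longrightarrow> norm (f (Complex x1 y)) \<le> B" "\<And>y. y \<in> {y1..y2} \<Longrightarrow> norm (f (Complex x2 y)) \<le> B"
  shows "norm (integral {x1..x2} (\<lambda>x. f (Complex x y1)) - integral {x1..x2} (\<lambda>x. f (Complex x y2))) \<le> 2 * B * (y2 - y1)"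
proof -
  obtain F where F: "\<And>z. z \<in> S \<Longrightarrow> (F has_field_derivative f z) (at z within S)"
    using holomorphic_convex_primitive'[OF S(2,1,3)] by blast
  hence F': "(F has_field_derivative f z) (at z)" if "z \<in> S" for z using that S(1) by (metis at_within_open)
  have int: "integral {x1..x2} (\<lambda>x. f (Complex x y)) = F (Complex x2 y) - F (Complex x1 y)" if "y \<in> {y1..y2}" for y
  proof (rule integral_unique, rule fundamental_theorem_of_calculus[OF x])
    fix x assume "x \<in> {x1..x2}"
    hence "Complex x y \<in> S" using sub that by auto
    hence "(F has_field_derivative f (Complex x y)) (at (Complex x y))" by (rule F')
    moreover have "((\<lambda>x. Complex x y) has_vector_derivative 1) (at x within {x1..x2})"
      unfolding Complex_eq by (auto intro!: derivative_eq_intros)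
    ultimately have "((F \<circ> (\<lambda>x. Complex x y)) has_vector_derivative 1 * f (Complex x y)) (at x within {x1..x2})"
      by (intro field_vector_diff_chain_within) (auto intro: has_field_derivative_at_within)
    thus "((\<lambda>x. F (Complex x y)) has_vector_derivative f (Complex x y)) (at x within {x1..x2})" by (simp add: o_def)
  qed
  have side: "norm (F (Complex x y1) - F (Complex x y2)) \<le> B * (y2 - y1)" if x': "x1 \<le> x" "x \<le> x2"
    and b: "\<And>y. y \<in> {y1..y2} \<Longrightarrow> norm (f (Complex x y)) \<le> B" for x
  proof -
    let ?L = "closed_segment (Complex x y1) (Complex x y2)"
    have L: "\<exists>v\<in>{y1..y2}. z = Complex x v" if "z \<in> ?L" for z
      using that y by (auto simp: closed_segment_same_Re closed_segment_eq_real_ivl complex_eq_iff intro!: bexI[of _ "Im z"])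
    have "norm (F (Complex x y1) - F (Complex x y2)) \<le> B * norm (Complex x y1 - Complex x y2)"
    proof (rule field_differentiable_bound[of ?L F f])
      fix z assume "z \<in> ?L"
      then obtain v where v: "v \<in> {y1..y2}" "z = Complex x v" using L by blast
      have "z \<in> S" using sub v x' by auto
      thus "(F has_field_derivative f z) (at z within ?L)" by (rule has_field_derivative_at_within[OF F'])
      show "norm (f z) \<le> B" using b v by auto
    qed auto
    also have "norm (Complex x y1 - Complex x y2) = y2 - y1" using y by (simp add: cmod_def)
    finally show ?thesis .
  qed
  have "integral {x1..x2} (\<lambda>x. f (Complex x y1)) - integral {x1..x2} (\<lambda>x. f (Complex x y2)) =
     (F (Complex x2 y1) - F (Complex x2 y2)) - (F (Complex x1 y1) - F (Complex x1 y2))"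
    using int y by simp
  also have "norm \<dots> \<le> B * (y2 - y1) + B * (y2 - y1)"
    using side[of x1] side[of x2] x B by (meson add_mono norm_triangle_ineq4 order_refl order_trans)
  finally show ?thesis by simp
qed

section \<open>The fourth power of the sinc function and its size\<close>

definition csinc :: "complex \<Rightarrow> complex" where
  "csinc z = (if z = 0 then 1 else sin z / z)"

lemma holomorphic_csinc: "csinc holomorphic_on UNIV"
proof (rule pole_theorem_0[of sin _ 0])
  show "csinc 0 = deriv sin 0" using DERIV_imp_deriv[OF DERIV_sin[of "0::complex"]] by (simp add: csinc_def)
qed (auto simp: csinc_def intro!: holomorphic_intros)

lemma norm_exp_i_le: "norm (exp (\<i> * z)) \<le> exp \<bar>Im z\<bar>" "norm (exp (- (\<i> * z))) \<le> exp \<bar>Im z\<bar>"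
  by (auto simp: norm_exp_eq_Re)

lemma norm_sin_le: "norm (sin z) \<le> exp \<bar>Im z\<bar>" for z :: complex
proof -
  have "norm (sin z) = norm (exp (\<i> * z) - exp (- (\<i> * z))) / 2"
    by (simp add: sin_exp_eq norm_divide norm_mult)
  also have "\<dots> \<le> (exp \<bar>Im z\<bar> + exp \<bar>Im z\<bar>) / 2"
    using norm_exp_i_le[of z] by (intro divide_right_mono order_trans[OF norm_triangle_ineq4] add_mono) auto
  finally show ?thesis by simp
qed

lemma norm_cos_le: "norm (cos z) \<le> exp \<bar>Im z\<bar>" for z :: complex
proof -
  have "norm (cos z) = norm (exp (\<i> * z) + exp (- (\<i> * z))) / 2"
    by (simp add: cos_exp_eq norm_divide)
  also have "\<dots> \<le> (exp \<bar>Im z\<bar> + exp \<bar>Im z\<bar>) / 2"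
    using norm_exp_i_le[of z] by (intro divide_right_mono order_trans[OF norm_triangle_ineq] add_mono) auto
  finally show ?thesis by simp
qed

text \<open>The mean value inequality for sin on the segment from 0 to z; there the derivative cos
  has norm at most \<open>exp \<bar>Im z\<bar>\<close>.\<close>

lemma norm_csinc_le: "norm (csinc z) \<le> exp \<bar>Im z\<bar>"
proof (cases "z = 0")
  case False
  have "norm (sin z - sin 0) \<le> exp \<bar>Im z\<bar> * norm (z - 0)"
  proof (rule field_differentiable_bound[of "closed_segment 0 z" sin cos])
    fix w assume "w \<in> closed_segment 0 z"
    then obtain u where u: "w = u *\<^sub>R z" "0 \<le> u" "u \<le> 1" by (auto simp: closed_segment_def)
    have "\<bar>Im w\<bar> \<le> \<bar>Im z\<bar>" using u by (simp add: abs_mult mult_left_le_one_le)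
    thus "norm (cos w) \<le> exp \<bar>Im z\<bar>" using norm_cos_le[of w] by (meson exp_le_cancel_iff order_trans)
  qed (auto intro!: derivative_eq_intros)
  thus ?thesis using False by (simp add: csinc_def norm_divide field_simps)
qed (simp add: csinc_def)

text \<open>
  The fourth power makes \<open>(\<bar>x\<bar> + x\<^sup>2) * kern x\<close> integrable and the kernel non-negative.
\<close>

definition kern :: "complex \<Rightarrow> complex" where
  "kern z = csinc z ^ 4"

lemma holomorphic_kern: "kern holomorphic_on A"
  unfolding kern_def using holomorphic_on_subset[OF holomorphic_csinc] by (intro holomorphic_intros) auto

lemma continuous_kern: "continuous_on A kern"
  by (rule holomorphic_on_imp_continuous_on[OF holomorphic_kern])

lemma norm_kern_le_exp: "norm (kern z) \<le> exp (4 * \<bar>Im z\<bar>)"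
proof -
  have "norm (kern z) \<le> exp \<bar>Im z\<bar> ^ 4"
    unfolding kern_def norm_power by (intro power_mono norm_csinc_le) auto
  thus ?thesis by (simp add: exp_of_nat_mult[symmetric])
qed

lemma norm_kern_le_power4: "z \<noteq> 0 \<Longrightarrow> norm (kern z) \<le> exp (4 * \<bar>Im z\<bar>) / norm z ^ 4"
proof -
  assume z: "z \<noteq> 0"
  have "norm (kern z) = norm (sin z) ^ 4 / norm z ^ 4"
    using z by (simp add: kern_def csinc_def norm_power norm_divide power_divide)
  also have "\<dots> \<le> exp \<bar>Im z\<bar> ^ 4 / norm z ^ 4"
    by (intro divide_right_mono power_mono norm_sin_le) auto
  finally show ?thesis by (simp add: exp_of_nat_mult[symmetric])
qed

text \<open>Combines the two previous bounds, for small and for large real part, into inverse-square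
  decay, whose integral is an arctangent.\<close>

lemma norm_kern_le: "norm (kern z) \<le> 2 * exp (4 * \<bar>Im z\<bar>) / (1 + (Re z)\<^sup>2)"
proof (cases "\<bar>Re z\<bar> \<le> 1")
  case True
  hence "1 + (Re z)\<^sup>2 \<le> 2" by (simp add: abs_square_le_1)
  hence "exp (4 * \<bar>Im z\<bar>) * (1 + (Re z)\<^sup>2) \<le> exp (4 * \<bar>Im z\<bar>) * 2" by (intro mult_left_mono) auto
  hence "exp (4 * \<bar>Im z\<bar>) \<le> 2 * exp (4 * \<bar>Im z\<bar>) / (1 + (Re z)\<^sup>2)"
    by (simp add: pos_le_divide_eq add_pos_nonneg mult.commute)
  thus ?thesis using norm_kern_le_exp[of z] by linarith
next
  case False
  hence "1 \<le> \<bar>Re z\<bar>" by simp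
  hence r1: "1 \<le> (Re z)\<^sup>2" by (metis one_le_power power2_abs)
  have "(Re z)\<^sup>2 \<le> (norm z)\<^sup>2" using abs_Re_le_cmod[of z] by (metis abs_ge_zero power2_abs power_mono)
  hence "(Re z)\<^sup>2 * (Re z)\<^sup>2 \<le> (norm z)\<^sup>2 * (norm z)\<^sup>2" by (intro mult_mono) auto
  hence "(Re z)\<^sup>2 * (Re z)\<^sup>2 \<le> norm z ^ 4" by (simp add: power2_eq_square power4_eq_xxxx mult.assoc)
  moreover have "(Re z)\<^sup>2 * 1 \<le> (Re z)\<^sup>2 * (Re z)\<^sup>2" using r1 by (intro mult_left_mono) auto
  ultimately have "1 + (Re z)\<^sup>2 \<le> 2 * norm z ^ 4" using r1 by simp
  hence "exp (4 * \<bar>Im z\<bar>) / norm z ^ 4 \<le> exp (4 * \<bar>Im z\<bar>) / ((1 + (Re z)\<^sup>2) / 2)"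
    by (intro divide_left_mono) (auto intro!: mult_pos_pos add_pos_nonneg simp: False)
  also have "\<dots> = 2 * exp (4 * \<bar>Im z\<bar>) / (1 + (Re z)\<^sup>2)" by simp
  finally show ?thesis using norm_kern_le_power4[of z] False by fastforce
qed

lemma kern_of_real: "kern (of_real x) = of_real (norm (kern (of_real x)))"
proof -
  obtain r where r: "csinc (of_real x) = of_real r"
  proof (cases "x = 0")
    case False
    thus ?thesis using that[of "sin x / x"] by (simp add: csinc_def sin_of_real)
  qed (use that[of 1] in \<open>simp add: csinc_def\<close>)
  hence "kern (of_real x) = of_real (r ^ 4)" by (simp add: kern_def)
  thus ?thesis by (simp add: norm_power)
qed

section \<open>Improper integrals and the Fourier transform of the kernel\<close>

lemma integral_tail_inverse_square:
  fixes f :: "real \<Rightarrow> complex"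
  assumes f: "continuous_on {-V..V} f" and B: "B \<ge> 0" and UV: "0 < U" "U \<le> V"
    and fx: "\<And>x. U \<le> \<bar>x\<bar> \<Longrightarrow> \<bar>x\<bar> \<le> V \<Longrightarrow> norm (f x) \<le> B / x\<^sup>2"
  shows "norm (integral {-V..V} f - integral {-U..U} f) \<le> 2 * B / U"
proof -
  have int: "f integrable_on {a..b}" if "-V \<le> a" "b \<le> V" for a b
    by (rule integrable_continuous_interval) (rule continuous_on_subset[OF f], use that in auto)
  have "((\<lambda>x. B / x\<^sup>2) has_integral (- (B / V) - - (B / U))) {U..V}"
    using UV by (intro fundamental_theorem_of_calculus)
      (auto simp flip: has_real_derivative_iff_has_vector_derivative intro!: derivative_eq_intros simp: power2_eq_square)
  hence q: "integral {U..V} (\<lambda>x. B / x\<^sup>2) = B / U - B / V" "(\<lambda>x. B / x\<^sup>2) integrable_on {U..V}"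
    by (auto simp: integral_unique has_integral_integrable)
  have "((\<lambda>x. B / x\<^sup>2) has_integral (- (B / (- U)) - - (B / (- V)))) {-V..-U}"
    using UV by (intro fundamental_theorem_of_calculus)
      (auto simp flip: has_real_derivative_iff_has_vector_derivative intro!: derivative_eq_intros simp: power2_eq_square)
  hence q': "integral {-V..-U} (\<lambda>x. B / x\<^sup>2) = B / U - B / V" "(\<lambda>x. B / x\<^sup>2) integrable_on {-V..-U}"
    by (auto simp: integral_unique has_integral_integrable)
  have 1: "integral {-V..V} f = integral {-V..-U} f + integral {-U..V} f"
    by (rule Henstock_Kurzweil_Integration.integral_combine[symmetric]) (use UV int in auto)
  have 2: "integral {-U..V} f = integral {-U..U} f + integral {U..V} f"
    by (rule Henstock_Kurzweil_Integration.integral_combine[symmetric]) (use UV int in auto)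
  have 3: "norm (integral {U..V} f) \<le> integral {U..V} (\<lambda>x. B / x\<^sup>2)"
    by (rule integral_norm_bound_integral) (use UV int q fx in auto)
  have 4: "norm (integral {-V..-U} f) \<le> integral {-V..-U} (\<lambda>x. B / x\<^sup>2)"
    by (rule integral_norm_bound_integral) (use UV int q' fx in auto)
  have "integral {-V..V} f - integral {-U..U} f = integral {-V..-U} f + integral {U..V} f" using 1 2 by simp
  also have "norm \<dots> \<le> (B / U - B / V) + (B / U - B / V)"
    using norm_triangle_ineq[of "integral {-V..-U} f" "integral {U..V} f"] 3 4 q(1) q'(1) by linarith
  also have "\<dots> \<le> 2 * B / U" using B UV by simp
  finally show ?thesis .
qed

text \<open>The value w is the improper integral over the line, obtained as the limit of symmetric
  truncations; what matters is the explicit rate of convergence.\<close>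

lemma integral_inverse_square_decay:
  fixes f :: "real \<Rightarrow> complex"
  assumes f: "continuous_on UNIV f" "\<And>x. norm (f x) \<le> B / (1 + x\<^sup>2)"
  obtains w where "\<And>U. U > 0 \<Longrightarrow> norm (integral {-U..U} f - w) \<le> 2 * B / U"
proof -
  have B: "B \<ge> 0" using order_trans[OF norm_ge_zero f(2)[of 0]] by simp
  have fx: "norm (f x) \<le> B / x\<^sup>2" if "x \<noteq> 0" for x
  proof -
    have "B / (1 + x\<^sup>2) \<le> B / x\<^sup>2" using B that by (intro divide_left_mono) (auto intro!: mult_pos_pos add_pos_nonneg)
    thus ?thesis using f(2)[of x] by linarith
  qed
  have diff: "norm (integral {-V..V} f - integral {-U..U} f) \<le> 2 * B / U" if "0 < U" "U \<le> V" for U V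
    by (rule integral_tail_inverse_square) (use that B fx in \<open>auto intro: continuous_on_subset[OF f(1)]\<close>)
  define g where "g = (\<lambda>n. integral {-real (Suc n)..real (Suc n)} f)"
  have "Cauchy g"
  proof (rule metric_CauchyI)
    fix e :: real assume e: "e > 0"
    obtain N where N: "4 * B / e < real N" using reals_Archimedean2 by blast
    have gN: "dist (g n) (g N) < e / 2" if "n \<ge> N" for n
    proof -
      have "dist (g n) (g N) \<le> 2 * B / real (Suc N)" unfolding dist_norm g_def by (rule diff) (use that in auto)
      also have "4 * B / e < real (Suc N)" using N by simp
      hence "2 * B / real (Suc N) < e / 2" using e B by (simp add: field_simps)
      finally show ?thesis .
    qed
    show "\<exists>M. \<forall>m\<ge>M. \<forall>n\<ge>M. dist (g m) (g n) < e"
      using gN dist_triangle_half_l by (metis dist_commute)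
  qed
  then obtain w where w: "g \<longlonglongrightarrow> w" using Cauchy_convergent convergent_def by blast
  have "norm (integral {-U..U} f - w) \<le> 2 * B / U" if U: "U > 0" for U
  proof -
    obtain N where N: "U < real N" using reals_Archimedean2 by blast
    have "(\<lambda>n. norm (g n - integral {-U..U} f)) \<longlonglongrightarrow> norm (w - integral {-U..U} f)"
      by (intro tendsto_intros w)
    moreover have "\<forall>\<^sub>F n in sequentially. norm (g n - integral {-U..U} f) \<le> 2 * B / U"
      using eventually_ge_at_top[of N] unfolding g_def by eventually_elim (rule diff, use N U in auto)
    ultimately have "norm (w - integral {-U..U} f) \<le> 2 * B / U" by (intro tendsto_upperbound) auto
    thus ?thesis by (simp add: norm_minus_commute)
  qed
  thus ?thesis using that by blast
qed

lemma norm_diff_le_three: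
  fixes a b :: "'a :: real_normed_vector"
  assumes "norm (p - a) \<le> x" "norm (q - b) \<le> y" "norm (p - q) \<le> z"
  shows "norm (a - b) \<le> x + y + z"
proof -
  have "a - b = (q - b) - (p - a) + (p - q)" by simp
  also have "norm \<dots> \<le> norm (q - b) + norm (p - a) + norm (p - q)"
    by (intro order_trans[OF norm_triangle_ineq] add_mono norm_triangle_ineq4) auto
  finally show ?thesis using assms by linarith
qed

text \<open>W is the Fourier transform of the kernel on the real line. Moving the line down by y
  multiplies the integral by \<open>exp (omega * y)\<close>, while the kernel grows only like
  \<open>exp (4 * y)\<close>; letting y tend to infinity gives the vanishing beyond 4, as in the
  Paley-Wiener theorem.\<close>

lemma kern_fourier:
  obtains W :: "real \<Rightarrow> complex" where
    "\<And>\<omega> y U. y \<ge> 0 \<Longrightarrow> U > 0 \<Longrightarrow>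
       norm (integral {-U..U} (\<lambda>x. kern (Complex x (-y)) * exp (- (\<i> * of_real (\<omega> * x)))) - of_real (exp (\<omega> * y)) * W \<omega>)
         \<le> 4 * exp (4 * y) / U"
    "\<And>\<omega>. norm (W \<omega>) \<le> 6" "\<And>\<omega>. \<omega> > 4 \<Longrightarrow> W \<omega> = 0"
proof -
  define f where "f = (\<lambda>\<omega> z. kern z * exp (- (\<i> * of_real \<omega> * z)))"
  have holf: "f \<omega> holomorphic_on A" for \<omega> A unfolding f_def by (intro holomorphic_intros holomorphic_kern)
  have contf: "continuous_on UNIV (\<lambda>x. f \<omega> (Complex x (-y)))" for \<omega> y
    by (rule continuous_on_compose2[OF holomorphic_on_imp_continuous_on[OF holf]])
       (auto intro!: continuous_intros simp: Complex_eq)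
  have bound: "norm (f \<omega> (Complex x (-y))) \<le> (2 * exp (4 * \<bar>y\<bar>) * exp (- \<omega> * y)) / (1 + x\<^sup>2)" for \<omega> x y
  proof -
    have "norm (f \<omega> (Complex x (-y))) = norm (kern (Complex x (-y))) * exp (- \<omega> * y)"
      by (simp add: f_def norm_mult norm_exp_eq_Re)
    also have "\<dots> \<le> 2 * exp (4 * \<bar>y\<bar>) / (1 + x\<^sup>2) * exp (- \<omega> * y)"
      using norm_kern_le[of "Complex x (-y)"] by (intro mult_right_mono) auto
    finally show ?thesis by (simp add: field_simps)
  qed
  have "\<exists>w. \<forall>U>0. norm (integral {-U..U} (\<lambda>x. f \<omega> (Complex x (-y))) - w) \<le> 2 * (2 * exp (4 * \<bar>y\<bar>) * exp (- \<omega> * y)) / U" for \<omega> y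
    using integral_inverse_square_decay[OF contf bound] by metis
  then obtain w where w: "\<And>\<omega> y U. U > 0 \<Longrightarrow>
     norm (integral {-U..U} (\<lambda>x. f \<omega> (Complex x (-y))) - w \<omega> y) \<le> 2 * (2 * exp (4 * \<bar>y\<bar>) * exp (- \<omega> * y)) / U"
    by metis
  define W where "W = (\<lambda>\<omega>. w \<omega> 0)"
  \<comment> \<open>Cauchy's theorem on a rectangle of half-width U; the vertical sides and both
    truncation errors are O(1 / U).\<close>
  have wW: "w \<omega> y = W \<omega>" if y: "y \<ge> 0" for \<omega> y
  proof -
    define B where "B = 2 * exp (4 * y) * exp (\<bar>\<omega>\<bar> * y)"
    define C where "C = 2 * (2 * exp (4 * \<bar>y\<bar>) * exp (- \<omega> * y)) + 2 * (2 * exp (4 * \<bar>0::real\<bar>) * exp (- \<omega> * 0)) + 2 * B * y"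
    have "norm (w \<omega> y - W \<omega>) \<le> C / U" if U: "U \<ge> 1" for U
    proof -
      have side: "norm (f \<omega> (Complex x v)) \<le> B / U" if v: "v \<in> {-y..0}" "\<bar>x\<bar> = U" for v x
      proof -
        have "norm (f \<omega> (Complex x (-(-v)))) \<le> (2 * exp (4 * \<bar>-v\<bar>) * exp (- \<omega> * (-v))) / (1 + x\<^sup>2)" by (rule bound)
        also have "\<dots> \<le> (2 * exp (4 * y) * exp (\<bar>\<omega>\<bar> * y)) / U"
        proof (intro frac_le mult_mono)
          have "- \<omega> * (-v) \<le> \<bar>- \<omega> * (-v)\<bar>" by (rule abs_ge_self)
          also have "\<dots> = \<bar>\<omega>\<bar> * \<bar>v\<bar>" by (simp add: abs_mult)
          also have "\<dots> \<le> \<bar>\<omega>\<bar> * y" using v by (intro mult_left_mono) auto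
          finally show "exp (- \<omega> * (-v)) \<le> exp (\<bar>\<omega>\<bar> * y)" by simp
          have "x\<^sup>2 = U\<^sup>2" using v by (metis power2_abs)
          moreover have "U * 1 \<le> U * U" using U by (intro mult_left_mono) auto
          ultimately show "U \<le> 1 + x\<^sup>2" by (simp add: power2_eq_square)
        qed (use v U in auto)
        finally show ?thesis by (simp add: B_def)
      qed
      have "norm (integral {-U..U} (\<lambda>x. f \<omega> (Complex x (-y))) - integral {-U..U} (\<lambda>x. f \<omega> (Complex x 0))) \<le> 2 * (B / U) * (0 - (- y))"
        by (rule rectangle_shift_bound[of UNIV]) (use U y holf side in auto)
      hence 1: "norm (integral {-U..U} (\<lambda>x. f \<omega> (Complex x (-y))) - integral {-U..U} (\<lambda>x. f \<omega> (Complex x (-0)))) \<le> 2 * B * y / U"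
        by (simp add: mult_ac)
      have U0: "U > 0" using U by simp
      have "norm (w \<omega> y - W \<omega>) \<le> 2 * (2 * exp (4 * \<bar>y\<bar>) * exp (- \<omega> * y)) / U
          + 2 * (2 * exp (4 * \<bar>0::real\<bar>) * exp (- \<omega> * 0)) / U + 2 * B * y / U"
        using norm_diff_le_three[OF w[OF U0, of \<omega> y] w[OF U0, of \<omega> 0] 1] unfolding W_def .
      thus ?thesis by (simp add: C_def add_divide_distrib)
    qed
    hence ev: "\<forall>\<^sub>F U in at_top. norm (w \<omega> y - W \<omega>) \<le> C / U" by (rule eventually_mono[OF eventually_ge_at_top[of 1]])
    have "((\<lambda>U. C / U) \<longlongrightarrow> 0) at_top" by (intro tendsto_divide_0[OF tendsto_const] filterlim_at_top_imp_at_infinity filterlim_ident)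
    hence "norm (w \<omega> y - W \<omega>) \<le> 0" by (rule tendsto_lowerbound[OF _ ev]) auto
    thus ?thesis by simp
  qed
  have main: "norm (integral {-U..U} (\<lambda>x. kern (Complex x (-y)) * exp (- (\<i> * of_real (\<omega> * x)))) - of_real (exp (\<omega> * y)) * W \<omega>)
         \<le> 4 * exp (4 * y) / U" if y: "y \<ge> 0" and U: "U > 0" for \<omega> y U
  proof -
    have eq: "kern (Complex x (-y)) * exp (- (\<i> * of_real (\<omega> * x))) = of_real (exp (\<omega> * y)) * f \<omega> (Complex x (-y))" for x
    proof -
      have "- (\<i> * of_real (\<omega> * x)) = of_real (\<omega> * y) + (- (\<i> * of_real \<omega> * Complex x (-y)))"
        by (simp add: complex_eq_iff)
      hence "exp (- (\<i> * of_real (\<omega> * x))) = exp (of_real (\<omega> * y)) * exp (- (\<i> * of_real \<omega> * Complex x (-y)))"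
        by (simp only: exp_add)
      thus ?thesis unfolding f_def by (simp only: exp_of_real mult_ac)
    qed
    have "integral {-U..U} (\<lambda>x. kern (Complex x (-y)) * exp (- (\<i> * of_real (\<omega> * x)))) - of_real (exp (\<omega> * y)) * W \<omega>
      = of_real (exp (\<omega> * y)) * (integral {-U..U} (\<lambda>x. f \<omega> (Complex x (-y))) - w \<omega> y)"
      unfolding eq wW[OF y] by (simp add: algebra_simps)
    also have "norm \<dots> = exp (\<omega> * y) * norm (integral {-U..U} (\<lambda>x. f \<omega> (Complex x (-y))) - w \<omega> y)"
      by (simp add: norm_mult)
    also have "\<dots> \<le> exp (\<omega> * y) * (2 * (2 * exp (4 * \<bar>y\<bar>) * exp (- \<omega> * y)) / U)"
      using w[OF U] by (intro mult_left_mono) auto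
    also have "\<dots> = 4 * exp (4 * y) / U * (exp (\<omega> * y) * exp (- \<omega> * y))" using y by simp
    also have "exp (\<omega> * y) * exp (- \<omega> * y) = 1" by (simp add: exp_add[symmetric])
    finally show ?thesis by simp
  qed
  \<comment> \<open>Taking U = 1, the integral over [-1, 1] is at most
    \<open>2 * exp (4 * y)\<close> and the truncation error at most \<open>4 * exp (4 * y)\<close>,
    hence the 6.\<close>
  have W6: "exp (\<omega> * y) * norm (W \<omega>) \<le> 6 * exp (4 * y)" if y: "y \<ge> 0" for \<omega> y
  proof -
    have "norm (integral {-1..1} (\<lambda>x. kern (Complex x (-y)) * exp (- (\<i> * of_real (\<omega> * x))))) \<le> exp (4 * y) * (1 - (-1))"
    proof (rule integral_bound)
      show "continuous_on {-1..1} (\<lambda>x. kern (Complex x (-y)) * exp (- (\<i> * of_real (\<omega> * x))))"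
        by (intro continuous_intros continuous_on_compose2[OF continuous_kern[of UNIV]]) (auto simp: Complex_eq intro!: continuous_intros)
      show "norm (kern (Complex x (-y)) * exp (- (\<i> * of_real (\<omega> * x)))) \<le> exp (4 * y)" for x
        using norm_kern_le_exp[of "Complex x (-y)"] y by (simp add: norm_mult norm_exp_eq_Re)
    qed auto
    hence "norm (of_real (exp (\<omega> * y)) * W \<omega>) \<le> exp (4 * y) * (1 - (-1)) + 4 * exp (4 * y) / 1"
      using main[OF y, of 1 \<omega>] norm_triangle_sub[of "of_real (exp (\<omega> * y)) * W \<omega>"] by (smt (verit) norm_minus_commute)
    thus ?thesis by (simp add: norm_mult)
  qed
  show ?thesis
  proof (rule that[OF main])
    show "norm (W \<omega>) \<le> 6" for \<omega> using W6[of 0 \<omega>] by simp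
    show "W \<omega> = 0" if "\<omega> > 4" for \<omega>
    proof -
      have "norm (W \<omega>) \<le> 6 * exp ((4 - \<omega>) * y)" if "y \<ge> 0" for y
        using W6[OF that, of \<omega>] by (simp add: left_diff_distrib exp_diff field_simps)
      hence ev: "\<forall>\<^sub>F y in at_top. norm (W \<omega>) \<le> 6 * exp ((4 - \<omega>) * y)"
        by (rule eventually_mono[OF eventually_ge_at_top[of 0]])
      have "filterlim (\<lambda>y. (4 - \<omega>) * y) at_bot at_top"
        using that by (intro filterlim_tendsto_neg_mult_at_bot[OF tendsto_const] filterlim_ident) auto
      hence "((\<lambda>y. 6 * exp ((4 - \<omega>) * y)) \<longlongrightarrow> 6 * 0) at_top"
        by (intro tendsto_intros filterlim_compose[OF exp_at_bot])
      hence "norm (W \<omega>) \<le> 6 * 0" by (rule tendsto_lowerbound[OF _ ev]) auto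
      thus ?thesis by simp
    qed
  qed auto
qed

section \<open>Comparing a sum over zeros with its averages\<close>

lemma Re_inverse_pos_eq: "Re (1 / d) = Re d / (norm d)\<^sup>2"
  by (simp add: Re_divide cmod_power2)

text \<open>Moving from distance b to distance a from the pole shrinks the modulus by at most the
  ratio a / b, because only the horizontal part shrinks. With
  \<open>Re (1 / d) = b / norm d ^ 2\<close> this bounds the difference by a multiple of the
  positive real part.\<close>

lemma inverse_shift_left:
  fixes d :: complex
  assumes "Re d = b" "0 < a" "a \<le> b"
  shows "norm (1 / (d - of_real (b - a)) - 1 / d) \<le> b / a * Re (1 / d)"
proof -
  define e where "e = d - of_real (b - a)"
  have Re: "Re e = a" "Im e = Im d" using assms by (auto simp: e_def)
  have nz: "d \<noteq> 0" "e \<noteq> 0" using Re assms by auto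
  have "b\<^sup>2 * (norm e)\<^sup>2 - a\<^sup>2 * (norm d)\<^sup>2 = (b\<^sup>2 - a\<^sup>2) * (Im d)\<^sup>2"
    using Re assms by (simp add: cmod_power2 algebra_simps)
  also have "\<dots> \<ge> 0" using assms by (intro mult_nonneg_nonneg) (auto intro!: power_mono)
  finally have "(a * norm d)\<^sup>2 \<le> (b * norm e)\<^sup>2" by (simp add: power_mult_distrib)
  hence le: "a * norm d \<le> b * norm e" by (rule power2_le_imp_le) (use assms in auto)
  have "1 / e - 1 / d = of_real (b - a) / (e * d)" using nz by (simp add: field_simps e_def)
  hence "norm (1 / e - 1 / d) = (b - a) / (norm e * norm d)"
    using assms by (simp add: norm_divide norm_mult del: of_real_diff)
  also have "\<dots> \<le> b / (a / b * norm d * norm d)"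
    using assms nz le by (intro frac_le mult_right_mono mult_pos_pos) (auto simp: field_simps)
  also have "\<dots> = b / a * Re (1 / d)" using assms nz unfolding Re_inverse_pos_eq by (simp add: power2_eq_square)
  finally show ?thesis by (simp add: e_def)
qed

lemma norm_shift_vertical:
  fixes d :: complex
  assumes "Re d = b" "0 < b"
  shows "norm d \<le> (1 + \<bar>v\<bar> / b) * norm (d + \<i> * of_real v)"
    "norm (d + \<i> * of_real v) \<le> (1 + \<bar>v\<bar> / b) * norm d"
proof -
  have b: "b \<le> norm d" "b \<le> norm (d + \<i> * of_real v)"
    using complex_Re_le_cmod[of d] complex_Re_le_cmod[of "d + \<i> * of_real v"] assms by auto
  have n: "norm (\<i> * of_real v) = \<bar>v\<bar>" by (simp add: norm_mult)
  have v: "\<bar>v\<bar> \<le> \<bar>v\<bar> / b * m" if "b \<le> m" for m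
    using mult_left_mono[OF that, of "\<bar>v\<bar> / b"] assms by simp
  have "norm d \<le> norm (d + \<i> * of_real v) + \<bar>v\<bar>" using norm_triangle_ineq4[of "d + \<i> * of_real v" "\<i> * of_real v"] n by simp
  thus "norm d \<le> (1 + \<bar>v\<bar> / b) * norm (d + \<i> * of_real v)" using v[OF b(2)] by (simp add: algebra_simps)
  have "norm (d + \<i> * of_real v) \<le> norm d + \<bar>v\<bar>" using norm_triangle_ineq[of d "\<i> * of_real v"] n by simp
  thus "norm (d + \<i> * of_real v) \<le> (1 + \<bar>v\<bar> / b) * norm d" using v[OF b(1)] by (simp add: algebra_simps)
qed

text \<open>Since d and its vertical shift both have norm at least b, a shift by v changes the
  modulus by a factor of at most \<open>1 + \<bar>v\<bar> / b\<close>.\<close>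

lemma inverse_shift_vertical:
  fixes d :: complex
  assumes "Re d = b" "0 < b"
  shows "norm (1 / (d + \<i> * of_real v) - 1 / d) \<le> \<bar>v\<bar> / b * (1 + \<bar>v\<bar> / b) * Re (1 / d)"
    "Re (1 / (d + \<i> * of_real v)) \<ge> Re (1 / d) / (1 + \<bar>v\<bar> / b)\<^sup>2"
proof -
  define e where "e = d + \<i> * of_real v"
  define q where "q = 1 + \<bar>v\<bar> / b"
  have q: "q > 0" using assms by (simp add: q_def add_pos_nonneg)
  have Re: "Re e = b" using assms by (auto simp: e_def)
  have nz: "d \<noteq> 0" "e \<noteq> 0" using Re assms by auto
  have le: "norm d \<le> q * norm e" "norm e \<le> q * norm d" unfolding e_def q_def by (rule norm_shift_vertical[OF assms])+
  have "1 / e - 1 / d = - (\<i> * of_real v) / (e * d)" using nz by (simp add: field_simps e_def)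
  hence "norm (1 / e - 1 / d) = \<bar>v\<bar> / (norm e * norm d)" by (simp add: norm_divide norm_mult)
  also have "\<dots> \<le> \<bar>v\<bar> / (norm d / q * norm d)"
    using nz le q by (intro divide_left_mono mult_right_mono mult_pos_pos) (auto simp: field_simps)
  also have "\<dots> = \<bar>v\<bar> / b * q * Re (1 / d)" using assms nz unfolding Re_inverse_pos_eq by (simp add: power2_eq_square)
  finally show "norm (1 / (d + \<i> * of_real v) - 1 / d) \<le> \<bar>v\<bar> / b * (1 + \<bar>v\<bar> / b) * Re (1 / d)"
    by (simp only: e_def q_def)
  have "Re (1 / d) / q\<^sup>2 = b / (q * norm d)\<^sup>2" unfolding Re_inverse_pos_eq assms(1) by (simp add: power_mult_distrib)
  also have "\<dots> \<le> b / (norm e)\<^sup>2" using le nz q assms by (intro divide_left_mono power_mono mult_pos_pos) auto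
  also have "\<dots> = Re (1 / e)" unfolding Re_inverse_pos_eq Re ..
  finally show "Re (1 / (d + \<i> * of_real v)) \<ge> Re (1 / d) / (1 + \<bar>v\<bar> / b)\<^sup>2" by (simp only: e_def q_def)
qed

lemma continuous_on_pole_sum:
  assumes "\<And>\<rho> s. \<rho> \<in> set \<rho>s \<Longrightarrow> s \<in> A \<Longrightarrow> s \<noteq> \<rho>"
  shows "continuous_on A (pole_sum \<rho>s)"
  using assms
proof (induction \<rho>s)
  case (Cons \<rho> \<rho>s)
  have "continuous_on A (\<lambda>s. 1 / (s - \<rho>) + pole_sum \<rho>s s)"
    using Cons by (intro continuous_intros Cons.IH) auto
  thus ?case by (simp add: pole_sum_def)
qed (simp add: pole_sum_def)

text \<open>This is where having all zeros on one vertical line is decisive: every term has positive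
  real part, and each difference is bounded by a multiple of the real part of its own term, so the
  termwise estimates add up to the real part of the whole sum without cancellation.\<close>

lemma pole_sum_estimates:
  assumes \<rho>s: "\<forall>\<rho>\<in>set \<rho>s. Re s - Re \<rho> = b" and b: "0 < b"
  shows "Re (pole_sum \<rho>s s) \<ge> 0"
    "0 < a \<Longrightarrow> a \<le> b \<Longrightarrow> norm (pole_sum \<rho>s (s - of_real (b - a)) - pole_sum \<rho>s s) \<le> b / a * Re (pole_sum \<rho>s s)"
    "norm (pole_sum \<rho>s (s + \<i> * of_real v) - pole_sum \<rho>s s) \<le> \<bar>v\<bar> / b * (1 + \<bar>v\<bar> / b) * Re (pole_sum \<rho>s s)"
    "Re (pole_sum \<rho>s (s + \<i> * of_real v)) \<ge> Re (pole_sum \<rho>s s) / (1 + \<bar>v\<bar> / b)\<^sup>2"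
proof -
  have Re_sum: "Re (pole_sum \<rho>s s) = (\<Sum>\<rho>\<leftarrow>\<rho>s. Re (1 / (s - \<rho>)))" for \<rho>s s
    unfolding pole_sum_def by (induction \<rho>s) auto
  have d: "Re (s - \<rho>) = b" if "\<rho> \<in> set \<rho>s" for \<rho> using \<rho>s that by simp
  show "Re (pole_sum \<rho>s s) \<ge> 0" unfolding Re_sum
    by (rule sum_list_nonneg) (use d b in \<open>auto simp: Re_inverse_pos_eq simp del: minus_complex.sel Re_divide\<close>)
  have *: "norm (pole_sum \<rho>s s' - pole_sum \<rho>s s) \<le> K * Re (pole_sum \<rho>s s)"
    if "\<And>\<rho>. \<rho> \<in> set \<rho>s \<Longrightarrow> norm (1 / (s' - \<rho>) - 1 / (s - \<rho>)) \<le> K * Re (1 / (s - \<rho>))" for s' K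
  proof -
    have "norm (pole_sum \<rho>s s' - pole_sum \<rho>s s) = norm (\<Sum>\<rho>\<leftarrow>\<rho>s. 1 / (s' - \<rho>) - 1 / (s - \<rho>))"
      unfolding pole_sum_def sum_list_subtractf ..
    also have "\<dots> \<le> (\<Sum>\<rho>\<leftarrow>\<rho>s. K * Re (1 / (s - \<rho>)))" using that by (rule norm_sum_list_le)
    also have "\<dots> = K * Re (pole_sum \<rho>s s)" unfolding Re_sum by (rule sum_list_const_mult)
    finally show ?thesis .
  qed
  show "norm (pole_sum \<rho>s (s - of_real (b - a)) - pole_sum \<rho>s s) \<le> b / a * Re (pole_sum \<rho>s s)" if "0 < a" "a \<le> b"
    by (rule *) (use inverse_shift_left[OF d that] in \<open>simp add: algebra_simps\<close>)
  show "norm (pole_sum \<rho>s (s + \<i> * of_real v) - pole_sum \<rho>s s) \<le> \<bar>v\<bar> / b * (1 + \<bar>v\<bar> / b) * Re (pole_sum \<rho>s s)"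
    by (rule *) (use inverse_shift_vertical(1)[OF d b] in \<open>simp add: algebra_simps\<close>)
  have "Re (pole_sum \<rho>s s) / (1 + \<bar>v\<bar> / b)\<^sup>2 = (\<Sum>\<rho>\<leftarrow>\<rho>s. Re (1 / (s - \<rho>)) / (1 + \<bar>v\<bar> / b)\<^sup>2)"
    unfolding Re_sum divide_inverse[of _ "(1 + \<bar>v\<bar> / b)\<^sup>2"] by (rule sum_list_mult_const[symmetric])
  also have "\<dots> \<le> Re (pole_sum \<rho>s (s + \<i> * of_real v))" unfolding Re_sum
    using inverse_shift_vertical(2)[OF d b, of _ v] by (intro sum_list_mono) (simp add: algebra_simps)
  finally show "Re (pole_sum \<rho>s (s + \<i> * of_real v)) \<ge> Re (pole_sum \<rho>s s) / (1 + \<bar>v\<bar> / b)\<^sup>2" .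
qed

lemma integral_inverse_1_plus_square_le:
  assumes "X \<ge> 0" "c \<ge> 0"
  shows "(\<lambda>x::real. c / (1 + x\<^sup>2)) integrable_on {-X..X}" "integral {-X..X} (\<lambda>x::real. c / (1 + x\<^sup>2)) \<le> c * pi"
proof -
  have "((\<lambda>x::real. c / (1 + x\<^sup>2)) has_integral (c * arctan X - c * arctan (-X))) {-X..X}"
    using assms by (intro fundamental_theorem_of_calculus)
      (auto simp flip: has_real_derivative_iff_has_vector_derivative intro!: derivative_eq_intros simp: divide_inverse)
  moreover have "c * arctan X - c * arctan (-X) \<le> c * pi"
  proof -
    have "arctan X - arctan (-X) \<le> pi" using arctan_ubound[of X] by (simp add: arctan_minus)
    from mult_left_mono[OF this assms(2)] show ?thesis by (simp add: algebra_simps)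
  qed
  ultimately show "(\<lambda>x::real. c / (1 + x\<^sup>2)) integrable_on {-X..X}" "integral {-X..X} (\<lambda>x::real. c / (1 + x\<^sup>2)) \<le> c * pi"
    by (auto simp: integral_unique has_integral_integrable)
qed

text \<open>The weight is \<open>\<bar>x\<bar> * (1 + \<bar>x\<bar>)\<close>, the factor by which a
  vertical shift of \<open>b * x\<close> is controlled in \<open>pole_sum_estimates\<close>.\<close>

lemma kern_moment_le: "(\<bar>x\<bar> + x\<^sup>2) * norm (kern (of_real x)) \<le> 4 / (1 + x\<^sup>2)"
proof (cases "\<bar>x\<bar> \<le> 1")
  case True
  hence x2: "x\<^sup>2 \<le> 1" by (simp add: abs_square_le_1)
  have "(\<bar>x\<bar> + x\<^sup>2) * norm (kern (of_real x)) \<le> 2 * 1"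
    using True x2 norm_kern_le_exp[of "of_real x"] by (intro mult_mono) auto
  also have "\<dots> \<le> 4 / (1 + x\<^sup>2)" using x2 by (simp add: pos_le_divide_eq add_pos_nonneg)
  finally show ?thesis by simp
next
  case False
  hence x1: "1 < \<bar>x\<bar>" by simp
  have "\<bar>x\<bar> * 1 \<le> \<bar>x\<bar> * \<bar>x\<bar>" using x1 by (intro mult_left_mono) auto
  hence xx: "\<bar>x\<bar> \<le> x\<^sup>2" by (simp add: power2_eq_square)
  have x2: "x\<^sup>2 \<ge> 1" using xx x1 by linarith
  have "(\<bar>x\<bar> + x\<^sup>2) * norm (kern (of_real x)) \<le> (2 * x\<^sup>2) * (1 / x ^ 4)"
    using xx x1 norm_kern_le_power4[of "of_real x"] by (intro mult_mono) auto
  also have "\<dots> = 2 / x\<^sup>2" using x1 by (simp add: power2_eq_square power4_eq_xxxx)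
  also have "\<dots> = 4 / (2 * x\<^sup>2)" by simp
  also have "\<dots> \<le> 4 / (1 + x\<^sup>2)" using x2 by (intro divide_left_mono mult_pos_pos add_pos_nonneg) auto
  finally show ?thesis .
qed

lemma kern_mass_pos: "integral {-1..1} (\<lambda>x. norm (kern (of_real x))) > 0"
proof -
  have cont: "continuous_on {-1..1::real} (\<lambda>x. norm (kern (of_real x)))"
    by (intro continuous_intros continuous_on_compose2[OF continuous_kern[of UNIV]]) auto
  have "integral {-1..1} (\<lambda>x. norm (kern (of_real x))) \<noteq> 0"
  proof
    assume "integral {-1..1} (\<lambda>x. norm (kern (of_real x))) = 0"
    hence "\<forall>x\<in>{-1..1}. norm (kern (of_real x)) = 0"
      using integral_eq_0_iff[OF cont] by simp
    hence "norm (kern (of_real 0)) = 0" by (rule bspec) simp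
    thus False by (simp add: kern_def csinc_def)
  qed
  moreover have "integral {-1..1} (\<lambda>x. norm (kern (of_real x))) \<ge> 0" by (rule integral_nonneg) (auto intro: integrable_continuous_interval[OF cont])
  ultimately show ?thesis by linarith
qed

text \<open>
  The real part of the average controls \<open>Re (pole_sum \<rho>s s)\<close> because all terms are positive; this
  real part in turn controls the oscillation of \<open>pole_sum \<rho>s\<close> around \<open>s\<close>.
\<close>

lemma pole_sum_le_average:
  obtains C where "C > 0"
    "\<And>\<rho>s s a b X. \<forall>\<rho>\<in>set \<rho>s. Re s - Re \<rho> = b \<Longrightarrow> 0 < a \<Longrightarrow> a \<le> b \<Longrightarrow> 1 \<le> X \<Longrightarrow>
       norm (pole_sum \<rho>s (s - of_real (b - a))) \<le>
         C * (b / a) * norm (integral {-X..X} (\<lambda>x. pole_sum \<rho>s (s + \<i> * of_real (b * x)) * kern (of_real x)))"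
proof -
  define k where "k = (\<lambda>x::real. norm (kern (of_real x)))"
  define c where "c = integral {-1..1} k"
  have c: "c > 0" unfolding c_def k_def by (rule kern_mass_pos)
  \<comment> \<open>Below, Q is at most 4 / c times the norm of the average, and replacing the
    average by the value at s costs at most 4 pi Q; together this gives 16 pi / c.\<close>
  define C1 where "C1 = (1 + 16 * pi / c) / c"
  define C where "C = C1 + 4 / c"
  have C1: "C1 > 0" using c by (simp add: C1_def add_pos_nonneg)
  have Cp: "C > 0" using c C1 by (simp add: C_def add_pos_pos)
  have kc: "continuous_on A k" for A unfolding k_def
    by (intro continuous_intros continuous_on_compose2[OF continuous_kern[of UNIV]]) auto
  have k0: "k x \<ge> 0" for x by (simp add: k_def)
  show ?thesis
  proof (rule that[OF Cp])
    fix \<rho>s :: "complex list" and s a b X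
    assume \<rho>s: "\<forall>\<rho>\<in>set \<rho>s. Re s - Re \<rho> = b" and a: "0 < a" "a \<le> b" and X: "(1::real) \<le> X"
    have b: "b > 0" using a by simp
    define g where "g = (\<lambda>x. pole_sum \<rho>s (s + \<i> * of_real (b * x)))"
    define Q where "Q = Re (pole_sum \<rho>s s)"
    note est = pole_sum_estimates[OF \<rho>s b]
    have Q: "Q \<ge> 0" unfolding Q_def by (rule est)
    have gc: "continuous_on A g" for A
    proof -
      have "continuous_on ((\<lambda>x. s + \<i> * of_real (b * x)) ` A) (pole_sum \<rho>s)"
        by (rule continuous_on_pole_sum) (use \<rho>s b in fastforce)
      thus ?thesis unfolding g_def by (rule continuous_on_compose2) (auto intro!: continuous_intros)
    qed
    have int: "(\<lambda>x. g x * of_real (k x)) integrable_on {u..v}" for u v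
      by (intro integrable_continuous_interval continuous_intros gc kc)
    have intk: "k integrable_on {u..v}" for u v by (intro integrable_continuous_interval kc)
    define I where "I = integral {-X..X} (\<lambda>x. g x * of_real (k x))"
    have IX: "integral {-X..X} (\<lambda>x. pole_sum \<rho>s (s + \<i> * of_real (b * x)) * kern (of_real x)) = I"
      unfolding I_def g_def k_def using kern_of_real by metis
    have vb: "\<bar>b * x\<bar> / b = \<bar>x\<bar>" for x using b by (simp add: abs_mult)
    have g1: "norm (g x - pole_sum \<rho>s s) \<le> \<bar>x\<bar> * (1 + \<bar>x\<bar>) * Q" for x
      using est(3)[where v = "b * x"] unfolding vb g_def Q_def by simp
    have g2: "Re (g x) \<ge> Q / (1 + \<bar>x\<bar>)\<^sup>2" for x
      using est(4)[where v = "b * x"] unfolding vb g_def Q_def by simp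
    \<comment> \<open>For \<open>\<bar>x\<bar> <= 1\<close> the loss
      \<open>(1 + \<bar>x\<bar>)^2\<close> is at most 4. The rest of the range only helps, because
      the integrand has nonnegative real part.\<close>
    have "Q / 4 * c \<le> Re I"
    proof -
      have "Q / 4 * c = integral {-1..1} (\<lambda>x. Q / 4 * k x)" unfolding c_def by simp
      also have "\<dots> \<le> integral {-1..1} (\<lambda>x. Re (g x) * k x)"
      proof (rule integral_le)
        show "Q / 4 * k x \<le> Re (g x) * k x" if "x \<in> {-1..1}" for x
        proof (rule mult_right_mono[OF _ k0])
          have "(1 + \<bar>x\<bar>)\<^sup>2 \<le> 2\<^sup>2" using that by (intro power_mono) auto
          hence "Q / 4 \<le> Q / (1 + \<bar>x\<bar>)\<^sup>2" using Q by (intro divide_left_mono) (auto intro!: mult_pos_pos)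
          thus "Q / 4 \<le> Re (g x)" using g2[of x] by linarith
        qed
      qed (auto intro!: integrable_continuous_interval continuous_intros gc kc)
      also have "\<dots> \<le> integral {-X..X} (\<lambda>x. Re (g x) * k x)"
      proof -
        have "0 \<le> Re (g x) * k x" for x
        proof (rule mult_nonneg_nonneg[OF _ k0])
          have "0 \<le> Q / (1 + \<bar>x\<bar>)\<^sup>2" using Q by simp
          thus "0 \<le> Re (g x)" using g2[of x] by linarith
        qed
        thus ?thesis using X
          by (intro integral_subset_le integrable_continuous_interval continuous_intros gc kc) auto
      qed
      also have "\<dots> = Re I"
      proof -
        have "((\<lambda>x. g x * of_real (k x)) has_integral I) {-X..X}" unfolding I_def using int by (rule integrable_integral)
        from has_integral_linear[OF this bounded_linear_Re] show ?thesis by (simp add: o_def integral_unique)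
      qed
      finally show ?thesis .
    qed
    hence "Q / 4 * c \<le> norm I" using complex_Re_le_cmod[of I] by linarith
    hence QI: "Q \<le> 4 / c * norm I" using c by (simp add: field_simps)
    define m where "m = integral {-X..X} k"
    have mc: "c \<le> m" unfolding c_def m_def by (rule integral_subset_le) (use X k0 intk in auto)
    have "norm (I - pole_sum \<rho>s s * of_real m) \<le> 4 * Q * pi"
    proof -
      have "((\<lambda>x. g x * of_real (k x) - pole_sum \<rho>s s * of_real (k x)) has_integral (I - pole_sum \<rho>s s * of_real m)) {-X..X}"
        unfolding I_def m_def
        by (intro has_integral_diff has_integral_mult_right integrable_integral[OF int] has_integral_of_real integrable_integral[OF intk])
      hence "I - pole_sum \<rho>s s * of_real m = integral {-X..X} (\<lambda>x. g x * of_real (k x) - pole_sum \<rho>s s * of_real (k x))"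
        by (simp add: integral_unique)
      also have "norm \<dots> \<le> integral {-X..X} (\<lambda>x. 4 * Q / (1 + x\<^sup>2))"
      proof (rule integral_norm_bound_integral)
        fix x
        have "norm (g x * of_real (k x) - pole_sum \<rho>s s * of_real (k x)) = norm (g x - pole_sum \<rho>s s) * k x"
          using k0[of x] by (simp add: left_diff_distrib[symmetric] norm_mult)
        also have "\<dots> \<le> (\<bar>x\<bar> * (1 + \<bar>x\<bar>) * Q) * k x" by (rule mult_right_mono[OF g1 k0])
        also have "\<dots> = Q * ((\<bar>x\<bar> + x\<^sup>2) * k x)" by (simp add: algebra_simps power2_eq_square)
        also have "\<dots> \<le> Q * (4 / (1 + x\<^sup>2))" using Q kern_moment_le[of x] unfolding k_def by (intro mult_left_mono) auto
        finally show "norm (g x * of_real (k x) - pole_sum \<rho>s s * of_real (k x)) \<le> 4 * Q / (1 + x\<^sup>2)" by (simp add: mult_ac)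
        show "(\<lambda>x. g x * of_real (k x) - pole_sum \<rho>s s * of_real (k x)) integrable_on {-X..X}"
          by (intro integrable_continuous_interval continuous_intros gc kc)
        show "(\<lambda>x. 4 * Q / (1 + x\<^sup>2)) integrable_on {-X..X}"
          by (rule integral_inverse_1_plus_square_le) (use X Q in auto)
      qed
      also have "\<dots> \<le> 4 * Q * pi" by (rule integral_inverse_1_plus_square_le) (use X Q in auto)
      finally show ?thesis .
    qed
    hence "norm (pole_sum \<rho>s s * of_real m) \<le> norm I + 4 * Q * pi"
      using norm_triangle_sub[of "pole_sum \<rho>s s * of_real m" I] by (simp add: norm_minus_commute)
    hence "norm (pole_sum \<rho>s s) * m \<le> norm I + 4 * Q * pi" using mc c by (simp add: norm_mult)
    moreover have "norm (pole_sum \<rho>s s) * c \<le> norm (pole_sum \<rho>s s) * m" using mc by (intro mult_left_mono) auto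
    moreover have "4 * Q * pi \<le> 4 * (4 / c * norm I) * pi" using QI by (intro mult_right_mono mult_left_mono) auto
    ultimately have "norm (pole_sum \<rho>s s) * c \<le> (1 + 16 * pi / c) * norm I" by (simp add: algebra_simps)
    hence P1: "norm (pole_sum \<rho>s s) \<le> C1 * norm I" using c by (simp add: C1_def field_simps)
    have ba: "b / a \<ge> 1" using a by simp
    have "norm (pole_sum \<rho>s (s - of_real (b - a))) \<le> norm (pole_sum \<rho>s s) + b / a * Q"
      using est(2)[OF a] norm_triangle_sub[of "pole_sum \<rho>s (s - of_real (b - a))" "pole_sum \<rho>s s"] by (simp add: Q_def)
    also have "\<dots> \<le> 1 * (C1 * norm I) + b / a * (4 / c * norm I)" using P1 QI ba by (intro add_mono mult_left_mono) auto
    also have "\<dots> \<le> b / a * (C1 * norm I) + b / a * (4 / c * norm I)" using ba C1 c by (intro add_mono mult_right_mono) auto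
    also have "\<dots> = C * (b / a) * norm I" by (simp add: C_def algebra_simps)
    finally show "norm (pole_sum \<rho>s (s - of_real (b - a))) \<le>
         C * (b / a) * norm (integral {-X..X} (\<lambda>x. pole_sum \<rho>s (s + \<i> * of_real (b * x)) * kern (of_real x)))"
      unfolding IX .
  qed
qed

section \<open>Reduction to a Dirichlet polynomial\<close>

text \<open>For the transform W of the kernel, \<open>W (b * ln n)\<close> vanishes when n > exp (4
  / b), so the range of summation covers all nonzero terms.\<close>

abbreviation (input) mangoldt_poly :: "(real \<Rightarrow> complex) \<Rightarrow> real \<Rightarrow> real \<Rightarrow> complex" where
  "mangoldt_poly W b t \<equiv>
     (\<Sum>n\<in>{1..nat \<lfloor>exp (4/b)\<rfloor>}. mangoldt n * W (b * ln n) * of_nat n powr (- Complex (1/2 + b) t))"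

text \<open>On the line of real part 2 the Dirichlet series converges absolutely and can be
  integrated term by term against the shifted kernel. Each n contributes the transform at frequency
  \<open>b * ln n\<close>, up to an error of at most 1, and these errors are weighted by the
  convergent series of \<open>mangoldt n / n^2\<close>.\<close>

lemma log_deriv_line_two_average:
  fixes W :: "real \<Rightarrow> complex"
  assumes RH: "riemann_hypothesis"
    and W: "\<And>\<omega> y U. y \<ge> 0 \<Longrightarrow> U > 0 \<Longrightarrow>
       norm (integral {-U..U} (\<lambda>x. kern (Complex x (-y)) * exp (- (\<i> * of_real (\<omega> * x)))) - of_real (exp (\<omega> * y)) * W \<omega>)
         \<le> 4 * exp (4 * y) / U"
    and W0: "\<And>\<omega>. \<omega> > 4 \<Longrightarrow> W \<omega> = 0"
  obtains C where "C > 0"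
    "\<And>T t b. T \<ge> 8 \<Longrightarrow> 0 < b \<Longrightarrow> b \<le> 1/8 \<Longrightarrow> 6 \<le> b * ln T \<Longrightarrow>
       norm (integral {-(T/(2*b))..T/(2*b)} (\<lambda>x. log_deriv_zeta (Complex 2 (t + b * x)) *
                kern (Complex x (-((3/2 - b)/b)))) +
             (mangoldt_poly W b t)) \<le> C"
proof -
  define S2 where "S2 = (\<Sum>n. mangoldt (Suc n) * real (Suc n) powr (- 2))"
  have sm: "summable (\<lambda>n. mangoldt (Suc n) * real (Suc n) powr (- 2))" by (rule summable_mangoldt_powr) auto
  have S2: "((\<lambda>n. mangoldt n * real n powr (- 2)) has_sum S2) {0<..}"
    unfolding S2_def by (rule sums_Suc_imp_has_sum) (use sm summable_sums[OF sm] in \<open>auto simp: abs_mult\<close>)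
  have S20: "S2 \<ge> 0" unfolding S2_def by (rule suminf_nonneg[OF sm]) (auto simp: mangoldt_nonneg)
  \<comment> \<open>The tail of the series at 2 bounds the truncation error uniformly on the whole
    line. Cutting at a finite N, chosen after T, replaces an interchange of an infinite sum with the
    integral.\<close>
  define \<epsilon> where "\<epsilon> = (\<lambda>N. S2 - (\<Sum>n\<in>{1..N}. mangoldt n * real n powr (- 2)))"
  have \<epsilon>: "\<epsilon> \<longlonglongrightarrow> 0"
  proof -
    have "(\<lambda>N. \<Sum>n<N. mangoldt (Suc n) * real (Suc n) powr (- 2)) \<longlonglongrightarrow> S2"
      unfolding S2_def by (rule summable_LIMSEQ[OF sm])
    moreover have "(\<Sum>n<N. mangoldt (Suc n) * real (Suc n) powr (- 2)) = (\<Sum>n\<in>{1..N}. mangoldt n * real n powr (- 2))" for N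
      by (rule sum.reindex_bij_witness[of _ "\<lambda>n. n - 1" Suc]) auto
    ultimately have "(\<lambda>N. S2 - (\<Sum>n\<in>{1..N}. mangoldt n * real n powr (- 2))) \<longlonglongrightarrow> S2 - S2"
      by (intro tendsto_intros) (simp only:)
    thus ?thesis by (simp add: \<epsilon>_def)
  qed
  have tail: "norm (log_deriv_zeta s + (\<Sum>n\<in>{1..N}. mangoldt n * of_nat n powr (- s))) \<le> \<epsilon> N" if s: "Re s = 2" for s N
  proof -
    have zs: "zeta s \<noteq> 0" by (rule zeta_nonzero[OF RH]) (use s in auto)
    obtain X where X: "((\<lambda>n. mangoldt n * of_nat n powr (- s)) has_sum X) {0<..}" "zeta s * X = - deriv zeta s"
      using zeta_log_deriv_has_sum[of s] s by auto
    have "deriv zeta s = - (zeta s * X)" using X(2) by simp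
    hence FX: "log_deriv_zeta s = - X" using zs by simp
    have 1: "((\<lambda>n. mangoldt n * of_nat n powr (- s)) has_sum (X - (\<Sum>n\<in>{1..N}. mangoldt n * of_nat n powr (- s)))) ({0<..} - {1..N})"
      by (rule has_sum_Diff[OF X(1)]) (auto intro: has_sum_finiteI)
    have 2: "((\<lambda>n. mangoldt n * real n powr (- 2)) has_sum \<epsilon> N) ({0<..} - {1..N})"
      unfolding \<epsilon>_def by (rule has_sum_Diff[OF S2]) (auto intro: has_sum_finiteI)
    have 3: "((\<lambda>n. norm (mangoldt n * of_nat n powr (- s) :: complex)) has_sum \<epsilon> N) ({0<..} - {1..N})"
      using 2 s by (subst has_sum_cong[where g = "\<lambda>n. mangoldt n * real n powr (- 2)"]) (auto simp: norm_mult norm_nat_powr)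
    have "norm (X - (\<Sum>n\<in>{1..N}. mangoldt n * of_nat n powr (- s))) \<le> \<epsilon> N" by (rule norm_has_sum_bound[OF 3 1])
    thus ?thesis unfolding FX by (simp add: norm_minus_commute)
  qed
  have \<epsilon>0: "\<epsilon> N \<ge> 0" for N using order_trans[OF norm_ge_zero tail[of 2 N]] by simp
  show thesis
  proof (rule that[of "1 + S2"])
    show "1 + S2 > 0" using S20 by simp
    fix T t b :: real assume T: "T \<ge> 8" and b: "0 < b" "b \<le> 1/8" "6 \<le> b * ln T"
    \<comment> \<open>With this U the heights \<open>t + b * x\<close> stay within T / 2 of t, and
      the truncation error \<open>4 * T / U = 8 * b\<close> of the transform is at most 1.\<close>
    define U where "U = T / (2 * b)"
    define c where "c = (3/2 - b) / b"
    have U: "U > 0" using T b by (simp add: U_def)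
    have c0: "c \<ge> 0" using b by (simp add: c_def)
    have eT: "exp (4 * c) \<le> T"
    proof -
      have "4 * c \<le> 6 / b" using b by (simp add: c_def field_simps)
      also have "\<dots> \<le> ln T" using b by (simp add: field_simps)
      finally have "exp (4 * c) \<le> exp (ln T)" by simp
      thus ?thesis using T by simp
    qed
    define N0 where "N0 = nat \<lfloor>exp (4/b)\<rfloor>"
    have "\<forall>\<^sub>F N in sequentially. \<epsilon> N < 1 / (2 * pi * T)"
      by (rule order_tendstoD(2)[OF \<epsilon>]) (use T in auto)
    then obtain N1 where N1: "\<And>N. N \<ge> N1 \<Longrightarrow> \<epsilon> N < 1 / (2 * pi * T)" unfolding eventually_sequentially by blast
    define N where "N = max N0 N1"
    have N: "N \<ge> N0" "\<epsilon> N \<le> 1 / (2 * pi * T)" using N1[of N] by (auto simp: N_def)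
    define G where "G = (\<lambda>x. log_deriv_zeta (Complex 2 (t + b * x)))"
    define k where "k = (\<lambda>x. kern (Complex x (-c)))"
    have kc: "continuous_on A k" for A unfolding k_def
      by (intro continuous_on_compose2[OF continuous_kern[of UNIV]]) (auto simp: Complex_eq intro!: continuous_intros)
    have kb: "norm (k x) \<le> 2 * T / (1 + x\<^sup>2)" for x
    proof -
      have "norm (k x) \<le> 2 * exp (4 * c) / (1 + x\<^sup>2)" using norm_kern_le[of "Complex x (-c)"] c0 by (simp add: k_def)
      also have "\<dots> \<le> 2 * T / (1 + x\<^sup>2)" using eT by (intro divide_right_mono) auto
      finally show ?thesis .
    qed
    have Gc: "continuous_on A G" for A
    proof -
      have "continuous_on {s. 1 < Re s} log_deriv_zeta"
        by (intro holomorphic_on_imp_continuous_on holomorphic_zeta_log_deriv[OF RH] open_halfspace_Re_gt) auto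
      thus ?thesis unfolding G_def by (rule continuous_on_compose2) (auto simp: Complex_eq intro!: continuous_intros)
    qed
    define P where "P = (\<lambda>x. \<Sum>n\<in>{1..N}. mangoldt n * of_nat n powr (- Complex 2 (t + b * x)))"
    define a where "a = (\<lambda>n. mangoldt n * of_nat n powr (- Complex 2 t) :: complex)"
    have Peq: "P x = (\<Sum>n\<in>{1..N}. a n * exp (- (\<i> * of_real (b * ln n * x))))" for x
      unfolding P_def a_def
    proof (rule sum.cong)
      fix n assume n: "n \<in> {1..N}"
      have "of_nat n powr (- Complex 2 (t + b * x)) = of_nat n powr (- Complex 2 t) * exp (- (\<i> * of_real (b * ln n * x)))"
        using n by (simp add: nat_powr_vertical exp_add[symmetric] algebra_simps)
      thus "mangoldt n * of_nat n powr (- Complex 2 (t + b * x)) = mangoldt n * of_nat n powr (- Complex 2 t) * exp (- (\<i> * of_real (b * ln n * x)))"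
        by simp
    qed simp
    have Pc: "continuous_on A P" for A unfolding Peq by (intro continuous_intros)
    have e1: "norm (integral {-U..U} (\<lambda>x. G x * k x) + integral {-U..U} (\<lambda>x. P x * k x)) \<le> 1"
    proof -
      have "integral {-U..U} (\<lambda>x. G x * k x) + integral {-U..U} (\<lambda>x. P x * k x) = integral {-U..U} (\<lambda>x. G x * k x + P x * k x)"
        by (rule integral_add[symmetric]; intro integrable_continuous_interval continuous_intros Gc kc Pc)
      also have "norm \<dots> \<le> integral {-U..U} (\<lambda>x. (\<epsilon> N * (2 * T)) / (1 + x\<^sup>2))"
      proof (rule integral_norm_bound_integral)
        fix x
        have "norm (G x * k x + P x * k x) = norm (G x + P x) * norm (k x)" by (simp add: norm_mult[symmetric] algebra_simps)
        also have "\<dots> \<le> \<epsilon> N * (2 * T / (1 + x\<^sup>2))" unfolding G_def P_def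
          by (intro mult_mono tail kb) (auto simp: \<epsilon>0)
        finally show "norm (G x * k x + P x * k x) \<le> (\<epsilon> N * (2 * T)) / (1 + x\<^sup>2)" by simp
        show "(\<lambda>x. G x * k x + P x * k x) integrable_on {-U..U}"
          by (intro integrable_continuous_interval continuous_intros Gc kc Pc)
        show "(\<lambda>x. \<epsilon> N * (2 * T) / (1 + x\<^sup>2)) integrable_on {-U..U}"
          by (rule integral_inverse_1_plus_square_le) (use U T \<epsilon>0 in auto)
      qed
      also have "\<dots> \<le> \<epsilon> N * (2 * T) * pi" by (rule integral_inverse_1_plus_square_le) (use U T \<epsilon>0 in auto)
      also have "\<dots> \<le> 1 / (2 * pi * T) * (2 * T) * pi" using N(2) T by (intro mult_right_mono) auto
      also have "\<dots> = 1" using T by simp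
      finally show ?thesis .
    qed
    define J where "J = (\<lambda>n. integral {-U..U} (\<lambda>x. k x * exp (- (\<i> * of_real (b * ln (real n) * x)))))"
    have PJ: "integral {-U..U} (\<lambda>x. P x * k x) = (\<Sum>n\<in>{1..N}. a n * J n)"
    proof -
      have "integral {-U..U} (\<lambda>x. P x * k x) = integral {-U..U} (\<lambda>x. \<Sum>n\<in>{1..N}. a n * (k x * exp (- (\<i> * of_real (b * ln n * x)))))"
        unfolding Peq sum_distrib_right by (simp add: mult_ac)
      also have "\<dots> = (\<Sum>n\<in>{1..N}. integral {-U..U} (\<lambda>x. a n * (k x * exp (- (\<i> * of_real (b * ln n * x))))))"
        by (rule integral_sum) (auto intro!: integrable_continuous_interval continuous_intros kc)
      also have "\<dots> = (\<Sum>n\<in>{1..N}. a n * J n)" unfolding J_def by simp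
      finally show ?thesis .
    qed
    have Jn: "norm (J n - of_real (exp (b * ln n * c)) * W (b * ln n)) \<le> 1" for n
    proof -
      have "norm (J n - of_real (exp (b * ln n * c)) * W (b * ln n)) \<le> 4 * exp (4 * c) / U"
        unfolding J_def k_def by (rule W[OF c0 U])
      also have "\<dots> \<le> 4 * T / U" using eT U by (intro divide_right_mono) auto
      also have "\<dots> = 8 * b" using T b by (simp add: U_def)
      finally show ?thesis using b by simp
    qed
    define D where "D = (\<Sum>n\<in>{1..N0}. mangoldt n * W (b * ln n) * of_nat n powr (- Complex (1/2 + b) t))"
    have DN: "D = (\<Sum>n\<in>{1..N}. a n * (of_real (exp (b * ln n * c)) * W (b * ln n)))"
    proof -
      have "D = (\<Sum>n\<in>{1..N}. mangoldt n * W (b * ln n) * of_nat n powr (- Complex (1/2 + b) t))"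
        unfolding D_def
      proof (rule sum.mono_neutral_left)
        show "\<forall>n\<in>{1..N} - {1..N0}. mangoldt n * W (b * ln n) * of_nat n powr (- Complex (1/2 + b) t) = 0"
        proof
          fix n assume n: "n \<in> {1..N} - {1..N0}"
          hence "n > N0" by auto
          hence "real n > exp (4 / b)" unfolding N0_def by (simp add: nat_less_iff floor_less_iff)
          hence "ln (real n) > ln (exp (4 / b))" by (subst ln_less_cancel_iff) (use n in auto)
          hence "b * ln (real n) > 4" using b by (simp add: field_simps)
          thus "mangoldt n * W (b * ln n) * of_nat n powr (- Complex (1/2 + b) t) = 0" using W0 by simp
        qed
      qed (use N in auto)
      also have "\<dots> = (\<Sum>n\<in>{1..N}. a n * (of_real (exp (b * ln n * c)) * W (b * ln n)))"
      proof (rule sum.cong)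
        fix n assume n: "n \<in> {1..N}"
        \<comment> \<open>As \<open>b * c = 3/2 - b\<close>, the factor
          \<open>exp (b * ln n * c)\<close> converts n^(-2) into n^(-1/2 - b).\<close>
        have bc: "b * c = 3/2 - b" using b by (simp add: c_def)
        have pw: "of_nat n powr z = exp (z * of_real (ln n))" for z :: complex
          using n by (simp add: powr_def Ln_of_nat)
        have e: "- Complex 2 t * of_real (ln n) + of_real ((3/2 - b) * ln n) = - Complex (1/2 + b) t * of_real (ln n)"
          by (simp add: complex_eq_iff algebra_simps)
        have "of_real (exp (b * ln n * c)) = exp (of_real ((3/2 - b) * ln n) :: complex)"
          unfolding bc[symmetric] by (simp add: exp_of_real[symmetric] mult_ac)
        hence "of_nat n powr (- Complex 2 t) * of_real (exp (b * ln n * c)) = of_nat n powr (- Complex (1/2 + b) t)"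
          by (simp only: pw exp_add[symmetric] e)
        hence "a n * (of_real (exp (b * ln n * c)) * W (b * ln n)) = mangoldt n * of_nat n powr (- Complex (1/2 + b) t) * W (b * ln n)"
          unfolding a_def by (simp only: mult.assoc[symmetric]) (simp only: mult.assoc)
        thus "mangoldt n * W (b * ln n) * of_nat n powr (- Complex (1/2 + b) t) = a n * (of_real (exp (b * ln n * c)) * W (b * ln n))"
          by (simp only: mult_ac)
      qed simp
      finally show ?thesis .
    qed
    have e2: "norm (integral {-U..U} (\<lambda>x. P x * k x) - D) \<le> S2"
    proof -
      have "integral {-U..U} (\<lambda>x. P x * k x) - D = (\<Sum>n\<in>{1..N}. a n * (J n - of_real (exp (b * ln n * c)) * W (b * ln n)))"
        unfolding PJ DN sum_subtractf[symmetric] right_diff_distrib ..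
      also have "norm \<dots> \<le> (\<Sum>n\<in>{1..N}. mangoldt n * real n powr (- 2))"
      proof (rule sum_norm_le)
        fix n assume n: "n \<in> {1..N}"
        have "norm (a n * (J n - of_real (exp (b * ln n * c)) * W (b * ln n))) \<le> norm (a n) * 1"
          unfolding norm_mult using Jn by (intro mult_left_mono) auto
        also have "norm (a n) = mangoldt n * real n powr (- 2)" using n by (simp add: a_def norm_mult norm_nat_powr)
        finally show "norm (a n * (J n - of_real (exp (b * ln n * c)) * W (b * ln n))) \<le> mangoldt n * real n powr (- 2)" by simp
      qed
      also have "\<dots> \<le> S2" using \<epsilon>0[of N] by (simp add: \<epsilon>_def)
      finally show ?thesis .
    qed
    have "norm (integral {-U..U} (\<lambda>x. G x * k x) + D) \<le> 1 + S2"
    proof -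
      have "integral {-U..U} (\<lambda>x. G x * k x) + D = (integral {-U..U} (\<lambda>x. G x * k x) + integral {-U..U} (\<lambda>x. P x * k x))
         - (integral {-U..U} (\<lambda>x. P x * k x) - D)" by simp
      thus ?thesis using e1 e2 norm_triangle_ineq4 by (smt (verit))
    qed
    thus "norm (integral {-(T/(2*b))..T/(2*b)} (\<lambda>x. log_deriv_zeta (Complex 2 (t + b * x)) *
                kern (Complex x (-((3/2 - b)/b)))) +
             (mangoldt_poly W b t)) \<le> 1 + S2"
      unfolding G_def k_def D_def U_def c_def N0_def .
  qed
qed

text \<open>Four changes, each costing O(ln T), lead from the average of the pole sum to the
  polynomial: the pole sum is replaced by F on the short range X (\<open>stepA\<close>), the range
  is extended to U (\<open>stepB\<close>), the line is moved to real part 2 (\<open>stepC\<close>),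
  and the Dirichlet series is inserted (\<open>stepD\<close>).\<close>

lemma log_deriv_le_dirichlet_polynomial:
  assumes RH: "riemann_hypothesis"
  obtains C and W :: "real \<Rightarrow> complex" where "C > 0" "\<And>\<omega>. norm (W \<omega>) \<le> 6"
    "\<And>T t a b. T \<ge> 8 \<Longrightarrow> T \<le> t \<Longrightarrow> t \<le> 2 * T \<Longrightarrow> 0 < a \<Longrightarrow> a \<le> b \<Longrightarrow> b \<le> 1/8 \<Longrightarrow> 6 \<le> b * ln T \<Longrightarrow>
      norm (log_deriv_zeta (Complex (1/2 + a) t)) \<le>
      C * (b / a) * (norm (mangoldt_poly W b t) + ln T)"
proof -
  obtain W :: "real \<Rightarrow> complex" where W: "\<And>\<omega> y U. y \<ge> 0 \<Longrightarrow> U > 0 \<Longrightarrow>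
       norm (integral {-U..U} (\<lambda>x. kern (Complex x (-y)) * exp (- (\<i> * of_real (\<omega> * x)))) - of_real (exp (\<omega> * y)) * W \<omega>)
         \<le> 4 * exp (4 * y) / U"
    "\<And>\<omega>. norm (W \<omega>) \<le> 6" "\<And>\<omega>. \<omega> > 4 \<Longrightarrow> W \<omega> = 0"
    using kern_fourier by blast
  obtain Cd where Cd: "Cd > 0" "\<And>T t b. T \<ge> 8 \<Longrightarrow> 0 < b \<Longrightarrow> b \<le> 1/8 \<Longrightarrow> 6 \<le> b * ln T \<Longrightarrow>
       norm (integral {-(T/(2*b))..T/(2*b)} (\<lambda>x. log_deriv_zeta (Complex 2 (t + b * x)) *
                kern (Complex x (-((3/2 - b)/b)))) +
             (mangoldt_poly W b t)) \<le> Cd"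
    using log_deriv_line_two_average[OF RH W(1,3)] by blast
  obtain Cz where Cz: "Cz > 0" "\<And>t. t \<ge> 4 \<Longrightarrow> \<exists>\<rho>s. zeros_near Cz t \<rho>s"
    using zeta_log_deriv_zeros[OF RH] by blast
  obtain Cp where Cp: "Cp > 0"
    "\<And>s. Re s > 1/2 \<Longrightarrow> Re s \<le> 2 \<Longrightarrow> Im s \<ge> 4 \<Longrightarrow> norm (log_deriv_zeta s) \<le> Cp * ln (Im s) / (Re s - 1/2)"
    using zeta_log_deriv_pointwise[OF RH] by blast
  obtain Ca where Ca: "Ca > 0"
    "\<And>\<rho>s s a b X. \<forall>\<rho>\<in>set \<rho>s. Re s - Re \<rho> = b \<Longrightarrow> 0 < a \<Longrightarrow> a \<le> b \<Longrightarrow> 1 \<le> X \<Longrightarrow>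
       norm (pole_sum \<rho>s (s - of_real (b - a))) \<le>
         Ca * (b / a) * norm (integral {-X..X} (\<lambda>x. pole_sum \<rho>s (s + \<i> * of_real (b * x)) * kern (of_real x)))"
    using pole_sum_le_average by blast
  define F where "F = (\<lambda>s. log_deriv_zeta s)"
  have F: "F holomorphic_on {s. Re s > 1/2} \<inter> {s. Im s > 0}"
    unfolding F_def
    by (intro holomorphic_zeta_log_deriv[OF RH] open_Int open_halfspace_Re_gt open_halfspace_Im_gt) auto
  \<comment> \<open>112 = 64 + 48: the tail beyond X and the vertical sides of the rectangle. The
    last term comes from replacing F by the pole sum.\<close>
  define K where "K = Cd + 112 * Cp + 4 * pi * Cz"
  define C where "C = Ca + Ca * K + 2 * Cz"
  have K0: "K > 0" using Cd(1) Cp(1) Cz(1) by (simp add: K_def add_pos_nonneg)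
  have C0: "C > 0" using Ca(1) K0 Cz(1) by (simp add: C_def add_pos_pos)
  show ?thesis
  proof (rule that[OF C0 W(2)])
    fix T t a b :: real
    assume T: "T \<ge> 8" and t: "T \<le> t" "t \<le> 2 * T" and a: "0 < a" "a \<le> b" and b: "b \<le> 1/8" "6 \<le> b * ln T"
    define D where "D = (mangoldt_poly W b t)"
    define L where "L = ln T"
    have b0: "b > 0" using a by simp
    have L1: "L \<ge> 1"
    proof -
      have "exp 1 \<le> T" using exp_le T by linarith
      thus ?thesis unfolding L_def using T by (subst ln_ge_iff) auto
    qed
    have lnt: "ln u \<le> 2 * L" "u \<ge> 4" if "T / 2 \<le> u" "u \<le> 5 * T / 2" for u
    proof -
      show u4: "u \<ge> 4" using that T by simp
      have "u \<le> 8 * T" using that T by simp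
      also have "\<dots> \<le> T * T" using T by (intro mult_right_mono) auto
      finally have "ln u \<le> ln (T * T)" using u4 by (intro ln_mono) auto
      thus "ln u \<le> 2 * L" using T by (simp add: ln_mult L_def)
    qed
    define U where "U = T / (2 * b)"
    \<comment> \<open>For \<open>\<bar>x\<bar> <= X\<close> the shift \<open>b * x\<close> is at
      most 1/8, so that the points stay in the disc where a single list of zeros describes
      F.\<close>
    define X where "X = 1 / (8 * b)"
    define c where "c = (3/2 - b) / b"
    have U: "U > 0" using T b0 by (simp add: U_def)
    have X: "X \<ge> 1" "X \<le> U" using b0 b(1) T by (auto simp: X_def U_def field_simps)
    have c0: "c \<ge> 0" using b0 b(1) by (simp add: c_def)
    have bc: "b * c = 3/2 - b" using b0 by (simp add: c_def)
    have eT: "exp (4 * c) \<le> T"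
    proof -
      have "4 * c \<le> 6 / b" using b0 by (simp add: c_def field_simps)
      also have "\<dots> \<le> ln T" using b0 b(2) by (simp add: field_simps)
      finally have "exp (4 * c) \<le> exp (ln T)" by simp
      thus ?thesis using T by simp
    qed
    define s1 where "s1 = Complex (1/2 + b) t"
    define f where "f = (\<lambda>z. F (s1 + \<i> * of_real b * z) * kern z)"
    \<comment> \<open>In the rotated variable, \<open>Im z < 1\<close> means right of the critical
      line and \<open>Re z > - t / b\<close> means above the real axis, hence away from the pole at
      1. Lowering z by c reaches real part 2.\<close>
    define S where "S = {z. Im z < 1} \<inter> {z. Re z > - t / b}"
    have arg: "s1 + \<i> * of_real b * Complex x y = Complex (1/2 + b - b * y) (t + b * x)" for x y
      by (simp add: s1_def complex_eq_iff)
    have bx: "\<bar>b * x\<bar> \<le> T / 2" if "\<bar>x\<bar> \<le> U" for x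
      using mult_left_mono[OF that, of b] b0 by (simp add: abs_mult U_def)
    have S: "open S" "convex S" unfolding S_def
      by (auto intro!: open_Int open_halfspace_Im_lt open_halfspace_Re_gt convex_Int convex_halfspace_Im_lt convex_halfspace_Re_gt)
    have holf: "f holomorphic_on S"
    proof -
      have "(F \<circ> (\<lambda>z. s1 + \<i> * of_real b * z)) holomorphic_on S"
      proof (rule holomorphic_on_compose_gen[OF _ F])
        show "(\<lambda>z. s1 + \<i> * of_real b * z) ` S \<subseteq> {s. Re s > 1/2} \<inter> {s. Im s > 0}"
        proof (rule image_subsetI)
          fix z assume z: "z \<in> S"
          have "b * Im z < b * 1" using z b0 by (intro mult_strict_left_mono) (auto simp: S_def)
          moreover have "t + b * Re z > 0" using z b0 by (simp add: S_def field_simps)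
          ultimately show "s1 + \<i> * of_real b * z \<in> {s. Re s > 1/2} \<inter> {s. Im s > 0}" by (simp add: s1_def)
        qed
      qed (intro holomorphic_intros)
      thus ?thesis unfolding f_def by (intro holomorphic_intros holomorphic_kern) (simp add: o_def)
    qed
    have inS: "Complex x y \<in> S" if "\<bar>x\<bar> \<le> U" "y \<le> 0" for x y
    proof -
      have "- t < b * x" using bx[OF that(1)] t T by linarith
      hence "- t / b < x" using b0 by (simp add: field_simps)
      thus ?thesis using that by (simp add: S_def)
    qed
    have Fb: "norm (F (Complex (1/2 + b - b * y) (t + b * x))) \<le> 2 * Cp * L / b" if "\<bar>x\<bar> \<le> U" "y \<in> {-c..0}" for x y
    proof -
      have y: "b * y \<le> 0" "- (3/2 - b) \<le> b * y" using that(2) b0 mult_left_mono[of "-c" y b] bc by (auto simp: mult_nonneg_nonpos)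
      have h: "T / 2 \<le> t + b * x" "t + b * x \<le> 5 * T / 2" using bx[OF that(1)] t by (auto simp: abs_le_iff)
      have "norm (F (Complex (1/2 + b - b * y) (t + b * x))) \<le> Cp * ln (t + b * x) / (b - b * y)"
        using Cp(2)[of "Complex (1/2 + b - b * y) (t + b * x)"] y b0 lnt(2)[OF h] that(2) by (simp add: F_def)
      also have "\<dots> \<le> Cp * (2 * L) / b"
        using Cp(1) lnt[OF h] y b0 L1 by (intro frac_le mult_left_mono) auto
      finally show ?thesis by (simp add: mult_ac)
    qed
    define g where "g = (\<lambda>x. f (Complex x 0))"
    have geq: "g x = F (Complex (1/2 + b) (t + b * x)) * kern (of_real x)" for x
    proof -
      have "g x = F (s1 + \<i> * of_real b * Complex x 0) * kern (Complex x 0)" by (simp add: g_def f_def)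
      thus ?thesis unfolding arg by (simp add: Complex_eq)
    qed
    have gc: "continuous_on {-U..U} g" unfolding g_def
      by (rule continuous_on_compose2[OF holomorphic_on_imp_continuous_on[OF holf]])
         (auto simp: Complex_eq intro!: continuous_intros inS[unfolded Complex_eq, where y = 0, simplified])
    define IU where "IU = integral {-U..U} g"
    define IX where "IX = integral {-X..X} g"
    \<comment> \<open>The pointwise bound O(L / b) for F is compensated by the tail of the kernel,
      which is O(1 / X) = O(b).\<close>
    have "norm (IU - IX) \<le> 2 * (4 * Cp * L / b) / X" unfolding IU_def IX_def
    proof (rule integral_tail_inverse_square[OF gc])
      fix x assume x: "X \<le> \<bar>x\<bar>" "\<bar>x\<bar> \<le> U"
      hence x0: "x \<noteq> 0" using X by auto
      have "norm (g x) \<le> (2 * Cp * L / b) * (2 / (1 + x\<^sup>2))" unfolding geq norm_mult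
        using Fb[OF x(2), of 0] c0 norm_kern_le[of "of_real x"] Cp(1) L1 b0 by (intro mult_mono) auto
      also have "\<dots> \<le> (2 * Cp * L / b) * (2 / x\<^sup>2)"
        using x0 Cp(1) L1 b0 by (intro mult_left_mono divide_left_mono mult_pos_pos add_pos_nonneg) auto
      finally show "norm (g x) \<le> (4 * Cp * L / b) / x\<^sup>2" by simp
    qed (use Cp(1) L1 b0 X in auto)
    also have "2 * (4 * Cp * L / b) / X = 64 * Cp * L" using b0 by (simp add: X_def)
    finally have stepB: "norm (IU - IX) \<le> 64 * Cp * L" .
    have t4: "T / 2 \<le> t" "t \<le> 5 * T / 2" using t T by auto
    obtain \<rho>s where \<rho>s: "\<forall>\<rho>\<in>set \<rho>s. Re \<rho> = 1/2"
      "\<And>s. Re s > 1/2 \<Longrightarrow> dist s (Complex 2 t) \<le> 13/8 \<Longrightarrow> norm (F s - pole_sum \<rho>s s) \<le> Cz * ln t"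
      using Cz(2)[OF lnt(2)[OF t4]] unfolding F_def by blast
    have ps: "norm (F s - pole_sum \<rho>s s) \<le> 2 * Cz * L" if "Re s > 1/2" "dist s (Complex 2 t) \<le> 13/8" for s
    proof -
      have "Cz * ln t \<le> Cz * (2 * L)" using lnt(1)[OF t4] Cz(1) by (intro mult_left_mono) auto
      thus ?thesis using \<rho>s(2)[OF that] by (simp only: mult_ac)
    qed
    define I0 where "I0 = integral {-X..X} (\<lambda>x. pole_sum \<rho>s (s1 + \<i> * of_real (b * x)) * kern (of_real x))"
    have s1x: "s1 + \<i> * of_real (b * x) = Complex (1/2 + b) (t + b * x)" for x by (simp add: s1_def complex_eq_iff)
    have stepA: "norm (IX - I0) \<le> 4 * pi * Cz * L"
    proof -
      have "continuous_on (range (\<lambda>x. s1 + \<i> * of_real (b * x))) (pole_sum \<rho>s)"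
        by (rule continuous_on_pole_sum) (use \<rho>s(1) b0 in \<open>force simp: s1_def\<close>)
      hence pc: "continuous_on {-X..X} (\<lambda>x. pole_sum \<rho>s (s1 + \<i> * of_real (b * x)))"
        by (rule continuous_on_compose2) (auto intro!: continuous_intros)
      have kc: "continuous_on {-X..X} (\<lambda>x. kern (of_real x))"
        by (intro continuous_on_compose2[OF continuous_kern[of UNIV]]) (auto intro!: continuous_intros)
      have gX: "continuous_on {-X..X} g" by (rule continuous_on_subset[OF gc]) (use X in auto)
      have "IX - I0 = integral {-X..X} (\<lambda>x. g x - pole_sum \<rho>s (s1 + \<i> * of_real (b * x)) * kern (of_real x))"
        unfolding IX_def I0_def
        by (rule integral_diff[symmetric]; intro integrable_continuous_interval continuous_intros gX pc kc)
      also have "norm \<dots> \<le> integral {-X..X} (\<lambda>x. (4 * Cz * L) / (1 + x\<^sup>2))"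
      proof (rule integral_norm_bound_integral)
        fix x assume x: "x \<in> {-X..X}"
        hence "\<bar>x\<bar> \<le> X" by auto
        from mult_left_mono[OF this, of b] have bx: "\<bar>b * x\<bar> \<le> 1/8" using b0 by (simp add: abs_mult X_def)
        have "dist (Complex (1/2 + b) (t + b * x)) (Complex 2 t) \<le> \<bar>b - 3/2\<bar> + \<bar>b * x\<bar>"
          unfolding dist_norm using cmod_le[of "Complex (1/2 + b) (t + b * x) - Complex 2 t"] by simp
        also have "\<dots> \<le> 13/8" using bx b0 b(1) by simp
        finally have "norm (F (Complex (1/2 + b) (t + b * x)) - pole_sum \<rho>s (Complex (1/2 + b) (t + b * x))) \<le> 2 * Cz * L"
          using b0 by (intro ps) auto
        hence "norm ((F (Complex (1/2 + b) (t + b * x)) - pole_sum \<rho>s (Complex (1/2 + b) (t + b * x))) * kern (of_real x))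
           \<le> (2 * Cz * L) * (2 / (1 + x\<^sup>2))" unfolding norm_mult
          using norm_kern_le[of "of_real x"] Cz(1) L1 by (intro mult_mono) auto
        thus "norm (g x - pole_sum \<rho>s (s1 + \<i> * of_real (b * x)) * kern (of_real x)) \<le> (4 * Cz * L) / (1 + x\<^sup>2)"
          unfolding s1x geq by (simp add: left_diff_distrib)
      next
        show "(\<lambda>x. g x - pole_sum \<rho>s (s1 + \<i> * of_real (b * x)) * kern (of_real x)) integrable_on {-X..X}"
          by (intro integrable_continuous_interval continuous_intros gX pc kc)
        show "(\<lambda>x. (4 * Cz * L) / (1 + x\<^sup>2)) integrable_on {-X..X}"
          by (rule integral_inverse_1_plus_square_le) (use X Cz(1) L1 in auto)
      qed
      also have "\<dots> \<le> 4 * Cz * L * pi" by (rule integral_inverse_1_plus_square_le) (use X Cz(1) L1 in auto)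
      finally show ?thesis by (simp add: mult_ac)
    qed
    define IR where "IR = integral {-U..U} (\<lambda>x. f (Complex x (-c)))"
    \<comment> \<open>On the vertical sides the kernel is at most 2 T / U^2 = O(b^2 / T), which
      outweighs both the size O(L / b) of F and the height c of the rectangle.\<close>
    define B where "B = (2 * Cp * L / b) * (2 * T / (1 + U\<^sup>2))"
    have "norm (IR - IU) \<le> 2 * B * (0 - (- c))" unfolding IR_def IU_def g_def
    proof (rule rectangle_shift_bound[OF S holf])
      have side: "norm (f (Complex x y)) \<le> B" if x: "\<bar>x\<bar> = U" and y: "y \<in> {-c..0}" for x y
      proof -
        have "norm (kern (Complex x y)) \<le> 2 * exp (4 * \<bar>y\<bar>) / (1 + x\<^sup>2)" using norm_kern_le[of "Complex x y"] by simp
        also have "x\<^sup>2 = U\<^sup>2" using x by (metis power2_abs)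
        also have "2 * exp (4 * \<bar>y\<bar>) / (1 + U\<^sup>2) \<le> 2 * exp (4 * c) / (1 + U\<^sup>2)"
          using y by (intro divide_right_mono) auto
        also have "\<dots> \<le> 2 * T / (1 + U\<^sup>2)" using eT by (intro divide_right_mono) auto
        finally have kb: "norm (kern (Complex x y)) \<le> 2 * T / (1 + U\<^sup>2)" .
        show ?thesis unfolding f_def arg norm_mult B_def
          using Fb[of x y] x y kb Cp(1) L1 b0 by (intro mult_mono) auto
      qed
      show "norm (f (Complex (- U) y)) \<le> B" "norm (f (Complex U y)) \<le> B" if "y \<in> {-c..0}" for y
        using side that U by auto
    qed (use U c0 inS in auto)
    also have "2 * B * (0 - (- c)) \<le> 48 * Cp * L"
    proof -
      have "2 * T / (1 + U\<^sup>2) \<le> 2 * T / U\<^sup>2" using T U by (intro divide_left_mono mult_pos_pos add_pos_nonneg) auto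
      also have "\<dots> = 8 * b\<^sup>2 / T" using T b0 by (simp add: U_def power2_eq_square field_simps)
      also have "\<dots> \<le> 8 * b\<^sup>2" using T divide_left_mono[of 1 T "8 * b\<^sup>2"] by simp
      finally have "B \<le> (2 * Cp * L / b) * (8 * b\<^sup>2)" unfolding B_def using Cp(1) L1 b0 by (intro mult_left_mono) auto
      also have "\<dots> = 16 * Cp * L * b" using b0 by (simp add: power2_eq_square)
      finally have "B * c \<le> (16 * Cp * L * b) * c" using c0 by (rule mult_right_mono)
      also have "\<dots> = 16 * Cp * L * (3/2 - b)" unfolding bc[symmetric] by simp
      also have "\<dots> \<le> 16 * Cp * L * (3/2)" using Cp(1) L1 b0 by (intro mult_left_mono) auto
      finally show ?thesis by simp
    qed
    finally have stepC: "norm (IR - IU) \<le> 48 * Cp * L" .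
    have stepD: "norm (IR + D) \<le> Cd * L"
    proof -
      have "f (Complex x (-c)) = F (Complex 2 (t + b * x)) * kern (Complex x (-c))" for x
        unfolding f_def arg using bc by simp
      hence "norm (IR + D) \<le> Cd" using Cd(2)[OF T b0 b, of t] unfolding IR_def D_def U_def F_def c_def by simp
      also have "\<dots> \<le> Cd * L" using Cd(1) L1 by simp
      finally show ?thesis .
    qed
    have "norm I0 \<le> norm D + K * L"
    proof -
      have "I0 = - D + (IR + D) - (IR - IU) - (IU - IX) - (IX - I0)" by simp
      hence "norm I0 \<le> norm (- D) + norm (IR + D) + norm (IR - IU) + norm (IU - IX) + norm (IX - I0)"
        by (smt (verit) norm_triangle_ineq norm_triangle_ineq4)
      also have "\<dots> \<le> norm D + Cd * L + 48 * Cp * L + 64 * Cp * L + 4 * pi * Cz * L"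
        using stepA stepB stepC stepD by simp
      also have "\<dots> = norm D + K * L" by (simp add: K_def algebra_simps)
      finally show ?thesis .
    qed
    moreover have ba: "1 \<le> b / a" using a by simp
    ultimately have I0: "Ca * (b / a) * norm I0 \<le> Ca * (b / a) * (norm D + K * L)"
      using Ca(1) a b0 by (intro mult_left_mono) auto
    define s where "s = Complex (1/2 + a) t"
    have ss1: "s = s1 - of_real (b - a)" by (simp add: s_def s1_def complex_eq_iff)
    have "\<forall>\<rho>\<in>set \<rho>s. Re s1 - Re \<rho> = b" using \<rho>s(1) by (simp add: s1_def)
    from Ca(2)[OF this a X(1)] have p: "norm (pole_sum \<rho>s s) \<le> Ca * (b / a) * norm I0" unfolding ss1 I0_def .
    have "dist s (Complex 2 t) \<le> 13/8"
      unfolding dist_norm using cmod_le[of "s - Complex 2 t"] a b by (simp add: s_def)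
    hence "norm (F s - pole_sum \<rho>s s) \<le> 2 * Cz * L" using a by (intro ps) (auto simp: s_def)
    hence "norm (F s) \<le> Ca * (b / a) * (norm D + K * L) + 2 * Cz * L"
      using p I0 norm_triangle_sub[of "F s" "pole_sum \<rho>s s"] by linarith
    also have "\<dots> \<le> Ca * (b / a) * (norm D + K * L) + (b / a) * (2 * Cz * L)"
      using mult_right_mono[OF ba, of "2 * Cz * L"] Cz(1) L1 by simp
    also have "\<dots> = (b / a) * (Ca * norm D + (Ca * K + 2 * Cz) * L)" by (simp add: algebra_simps)
    also have "\<dots> \<le> (b / a) * (C * norm D + C * L)"
      using ba Ca(1) K0 Cz(1) L1 unfolding C_def by (intro mult_left_mono add_mono mult_right_mono) auto
    also have "\<dots> = C * (b / a) * (norm D + L)" by (simp only: distrib_left mult_ac)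
    finally show "norm (log_deriv_zeta (Complex (1/2 + a) t)) \<le>
      C * (b / a) * (norm (mangoldt_poly W b t) + ln T)"
      unfolding F_def s_def D_def L_def .
  qed
qed

section \<open>Sums over primes and prime powers\<close>

lemma sum_power_from_2_le:
  fixes q :: real
  assumes "0 \<le> q" "q \<le> 3/4"
  shows "(\<Sum>j\<in>{2..N}. q ^ j) \<le> 4 * q\<^sup>2"
proof -
  have sm: "summable (\<lambda>n. q ^ n)" using assms by (intro summable_geometric) auto
  have "(\<Sum>j\<in>{2..N}. q ^ j) \<le> (\<Sum>j\<in>{2..<2+N}. q ^ j)" using assms by (intro sum_mono2) auto
  also have "\<dots> = (\<Sum>j<N. q ^ (j + 2))" 
    by (rule sum.reindex_bij_witness[of _ "\<lambda>j. j + 2" "\<lambda>j. j - 2"]) (auto simp del: add_2_eq_Suc')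
  also have "\<dots> = q\<^sup>2 * (\<Sum>j<N. q ^ j)" by (simp only: sum_distrib_left power_add mult.commute[of "q\<^sup>2"])
  also have "\<dots> \<le> q\<^sup>2 * 4"
  proof (rule mult_left_mono)
    have "(\<Sum>j<N. q ^ j) \<le> (\<Sum>j. q ^ j)" using assms sm by (intro sum_le_suminf) auto
    also have "(\<Sum>j. q ^ j) = 1 / (1 - q)" using assms by (intro suminf_geometric) auto
    also have "1 / (1 - q) \<le> 4" using assms by (simp add: field_simps)
    finally show "(\<Sum>j<N. q ^ j) \<le> 4" .
  qed simp
  finally show ?thesis by simp
qed

text \<open>Both sums reduce to the sum of ln p / p over primes: in the first, one factor ln p is at
  most y; in the second, the powers of p with exponent at least 2 contribute O(ln p / p). The first
  will bound the variance, the second the prime powers that are discarded.\<close>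

lemma prime_log_sums:
  obtains C where "C > 0"
    "\<And>y. y \<ge> 1 \<Longrightarrow> (\<Sum>p | prime p \<and> p \<le> nat \<lfloor>exp y\<rfloor>. (ln (real p))\<^sup>2 / real p) \<le> C * y\<^sup>2"
    "\<And>y. y \<ge> 1 \<Longrightarrow> (\<Sum>n | n \<in> {1..nat \<lfloor>exp y\<rfloor>} \<and> \<not> prime n. mangoldt n / sqrt (real n)) \<le> C * y"
proof -
  obtain C where C: "C > 0" "\<And>y. y \<ge> 1 \<Longrightarrow> (\<Sum>n\<in>{1..nat \<lfloor>exp y\<rfloor>}. mangoldt n / real n) \<le> C * y"
    using sum_mangoldt_div_le by blast
  have pr: "(\<Sum>p | prime p \<and> p \<le> nat \<lfloor>exp y\<rfloor>. ln (real p) / real p) \<le> C * y" if y: "y \<ge> 1" for y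
  proof -
    have "(\<Sum>p | prime p \<and> p \<le> nat \<lfloor>exp y\<rfloor>. ln (real p) / real p) = (\<Sum>p | prime p \<and> p \<le> nat \<lfloor>exp y\<rfloor>. mangoldt p / real p)"
      by (intro sum.cong) auto
    also have "\<dots> \<le> (\<Sum>n\<in>{1..nat \<lfloor>exp y\<rfloor>}. mangoldt n / real n)"
      by (intro sum_mono2) (auto simp: mangoldt_nonneg Suc_le_eq prime_gt_0_nat)
    finally show ?thesis using C(2)[OF y] by linarith
  qed
  show ?thesis
  proof (rule that[of "4 * C"])
    show "4 * C > 0" using C by simp
    fix y :: real assume y: "y \<ge> 1"
    define N where "N = nat \<lfloor>exp y\<rfloor>"
    define Pr where "Pr = {p. prime p \<and> p \<le> N}"
    have finPr: "finite Pr" unfolding Pr_def by auto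
    have "(\<Sum>p\<in>Pr. (ln (real p))\<^sup>2 / real p) \<le> (\<Sum>p\<in>Pr. y * (ln (real p) / real p))"
    proof (rule sum_mono)
      fix p assume p: "p \<in> Pr"
      hence p1: "p \<ge> 1" "real p \<le> exp y" by (auto simp: Pr_def N_def Suc_le_eq prime_gt_0_nat le_nat_iff le_floor_iff)
      have "ln (real p) \<le> ln (exp y)" using p1 by (intro ln_mono) auto
      hence "ln (real p) * (ln (real p) / real p) \<le> y * (ln (real p) / real p)" using p1 by (intro mult_right_mono) auto
      thus "(ln (real p))\<^sup>2 / real p \<le> y * (ln (real p) / real p)" by (simp add: power2_eq_square)
    qed
    also have "\<dots> = y * (\<Sum>p\<in>Pr. ln (real p) / real p)" by (simp add: sum_distrib_left)
    also have "\<dots> \<le> y * (C * y)" using pr[OF y] y unfolding Pr_def N_def by (intro mult_left_mono) auto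
    also have "\<dots> \<le> 4 * C * y\<^sup>2" using C(1) by (simp add: power2_eq_square)
    finally show "(\<Sum>p | prime p \<and> p \<le> nat \<lfloor>exp y\<rfloor>. (ln (real p))\<^sup>2 / real p) \<le> 4 * C * y\<^sup>2"
      unfolding Pr_def N_def .
    define g where "g = (\<lambda>n. mangoldt n / sqrt (real n) :: real)"
    have g0: "g n \<ge> 0" for n by (simp add: g_def mangoldt_nonneg)
    define h where "h = (\<lambda>(p, j). p ^ j :: nat)"
    have "sum g {n. n \<in> {1..N} \<and> \<not> prime n} = sum g {n. n \<in> {1..N} \<and> \<not> prime n \<and> primepow n}"
      by (rule sum.mono_neutral_right) (auto simp: g_def mangoldt_def)
    also have "\<dots> \<le> sum g (h ` (Pr \<times> {2..N}))"
    proof (rule sum_mono2)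
      show "{n. n \<in> {1..N} \<and> \<not> prime n \<and> primepow n} \<subseteq> h ` (Pr \<times> {2..N})"
      proof
        fix n assume n: "n \<in> {n. n \<in> {1..N} \<and> \<not> prime n \<and> primepow n}"
        then obtain p j where pj: "prime p" "j > 0" "n = p ^ j" by (auto simp: primepow_def)
        have "j \<noteq> 1" using n pj by auto
        hence j2: "j \<ge> 2" using pj by simp
        \<comment> \<open>A crude box for base and exponent suffices, since all terms are
          nonnegative.\<close>
        have "j < 2 ^ j" by simp
        also have "2 ^ j \<le> p ^ j" using pj prime_ge_2_nat by (intro power_mono) auto
        finally have "j \<le> N" using n pj by auto
        moreover have "p \<le> N"
        proof -
          have "p ^ 1 \<le> p ^ j" using pj prime_ge_1_nat by (intro power_increasing) auto
          thus ?thesis using n pj by auto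
        qed
        ultimately show "n \<in> h ` (Pr \<times> {2..N})" using pj j2 by (intro image_eqI[of _ _ "(p, j)"]) (auto simp: h_def Pr_def)
      qed
    qed (use finPr g0 in auto)
    also have "\<dots> \<le> sum (g \<circ> h) (Pr \<times> {2..N})" by (rule sum_image_le) (use finPr g0 in auto)
    also have "\<dots> = (\<Sum>p\<in>Pr. \<Sum>j\<in>{2..N}. g (h (p, j)))" by (simp add: sum.cartesian_product)
    also have "\<dots> \<le> (\<Sum>p\<in>Pr. 4 * (ln (real p) / real p))"
    proof (rule sum_mono)
      fix p assume p: "p \<in> Pr"
      hence pp: "prime p" "p \<ge> 2" by (auto simp: Pr_def prime_ge_2_nat)
      define q where "q = 1 / sqrt (real p)"
      have q0: "q \<ge> 0" by (simp add: q_def)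
      \<comment> \<open>The extreme case is p = 2, where 1 / sqrt 2 is below 3/4; this keeps the
        geometric series bounded by 4.\<close>
      have "4/3 \<le> sqrt (real p)" using pp by (intro real_le_rsqrt) (simp add: power2_eq_square)
      hence q: "q \<le> 3/4" unfolding q_def using pp by (simp add: field_simps)
      have "(\<Sum>j\<in>{2..N}. g (h (p, j))) = (\<Sum>j\<in>{2..N}. ln (real p) * q ^ j)"
      proof (rule sum.cong[OF refl])
        fix j assume "j \<in> {2..N}"
        thus "g (h (p, j)) = ln (real p) * q ^ j"
          using pp by (simp add: g_def h_def q_def real_sqrt_power power_one_over)
      qed
      also have "\<dots> = ln (real p) * (\<Sum>j\<in>{2..N}. q ^ j)" by (simp add: sum_distrib_left)
      also have "\<dots> \<le> ln (real p) * (4 * q\<^sup>2)" using pp q q0 by (intro mult_left_mono sum_power_from_2_le) auto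
      also have "q\<^sup>2 = 1 / real p" using pp by (simp add: q_def power_divide)
      finally show "(\<Sum>j\<in>{2..N}. g (h (p, j))) \<le> 4 * (ln (real p) / real p)" by (simp add: mult_ac)
    qed
    also have "\<dots> = 4 * (\<Sum>p\<in>Pr. ln (real p) / real p)" by (simp add: sum_distrib_left)
    also have "\<dots> \<le> 4 * (C * y)" using pr[OF y] unfolding Pr_def N_def by simp
    finally show "(\<Sum>n | n \<in> {1..nat \<lfloor>exp y\<rfloor>} \<and> \<not> prime n. mangoldt n / sqrt (real n)) \<le> 4 * C * y"
      unfolding g_def N_def by simp
  qed
qed

section \<open>Moments of Dirichlet polynomials\<close>

lemma norm_integral_exp_le:
  fixes \<theta> :: real
  assumes "\<theta> \<noteq> 0" "u \<le> v"
  shows "norm (integral {u..v} (\<lambda>t. exp (\<i> * of_real (\<theta> * t)))) \<le> 2 / \<bar>\<theta>\<bar>"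
proof -
  have "((\<lambda>t. exp (\<i> * of_real (\<theta> * t))) has_integral
     (exp (\<i> * of_real (\<theta> * v)) / (\<i> * of_real \<theta>) - exp (\<i> * of_real (\<theta> * u)) / (\<i> * of_real \<theta>))) {u..v}"
  proof (rule fundamental_theorem_of_calculus[OF assms(2)])
    fix x :: real
    have "((\<lambda>z. exp (\<i> * of_real \<theta> * z) / (\<i> * of_real \<theta>)) has_field_derivative exp (\<i> * of_real \<theta> * of_real x)) (at (of_real x))"
      using assms by (auto intro!: derivative_eq_intros)
    from has_vector_derivative_real_field[OF this]
    show "((\<lambda>t. exp (\<i> * of_real (\<theta> * t)) / (\<i> * of_real \<theta>)) has_vector_derivative exp (\<i> * of_real (\<theta> * x))) (at x within {u..v})"
      by (simp add: mult.assoc has_vector_derivative_at_within)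
  qed
  hence "integral {u..v} (\<lambda>t. exp (\<i> * of_real (\<theta> * t))) =
     exp (\<i> * of_real (\<theta> * v)) / (\<i> * of_real \<theta>) - exp (\<i> * of_real (\<theta> * u)) / (\<i> * of_real \<theta>)"
    by (rule integral_unique)
  also have "norm \<dots> \<le> 1 / \<bar>\<theta>\<bar> + 1 / \<bar>\<theta>\<bar>"
    by (rule order_trans[OF norm_triangle_ineq4]) (simp add: norm_divide norm_mult norm_exp_eq_Re)
  finally show ?thesis by simp
qed

lemma abs_ln_diff_ge:
  fixes m n N :: nat
  assumes "m \<noteq> n" "m \<in> {1..N}" "n \<in> {1..N}"
  shows "\<bar>ln (real m) - ln (real n)\<bar> \<ge> 1 / real N"
  using assms
proof (induction m n rule: linorder_wlog)
  case (le m n)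
  hence mn: "m < n" "m \<ge> 1" "n \<le> N" by auto
  have "ln (real m / real n) \<le> real m / real n - 1" using mn by (intro ln_le_minus_one) auto
  also have "\<dots> = - ((real n - real m) / real n)" using mn by (simp add: field_simps)
  finally have "ln (real n) - ln (real m) \<ge> (real n - real m) / real n" using mn by (simp add: ln_div)
  moreover have "1 / real N \<le> (real n - real m) / real n" using mn by (intro frac_le) auto
  ultimately show ?case by linarith
next
  case (sym m n)
  thus ?case by (simp add: abs_minus_commute)
qed

text \<open>Distinct frequencies differ by at least 1 / N, so each off-diagonal integral is at most
  2 N; Cauchy-Schwarz on the coefficients costs another N. The resulting N^2 is harmless for lengths
  up to the square root of T.\<close>

lemma dirichlet_polynomial_mean_square:
  fixes B :: "nat \<Rightarrow> complex"
  assumes A: "A \<subseteq> {1..N}" and T: "T \<ge> 0"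
  shows "integral {T..2*T} (\<lambda>t. (norm (\<Sum>n\<in>A. B n * osc n t))\<^sup>2)
     \<le> (T + 2 * real N ^ 2) * (\<Sum>n\<in>A. (norm (B n))\<^sup>2)"
proof -
  have fin: "finite A" using A finite_subset by blast
  define e where "e = (\<lambda>m n (t::real). exp (\<i> * of_real ((ln (real n) - ln (real m)) * t)))"
  have ec: "continuous_on S (e m n)" for S m n unfolding e_def by (intro continuous_intros)
  define S where "S = (\<lambda>t. \<Sum>n\<in>A. B n * osc n t)"
  have Sc: "continuous_on X S" for X unfolding S_def by (intro continuous_intros)
  have sq: "of_real ((norm (S t))\<^sup>2) = (\<Sum>m\<in>A. \<Sum>n\<in>A. B m * cnj (B n) * e m n t)" for t
  proof -
    have "of_real ((norm (S t))\<^sup>2) = S t * cnj (S t)" by (rule complex_norm_square)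
    also have "\<dots> = (\<Sum>m\<in>A. \<Sum>n\<in>A. B m * osc m t * cnj (B n * osc n t))"
      unfolding S_def cnj_sum sum_product ..
    also have "\<dots> = (\<Sum>m\<in>A. \<Sum>n\<in>A. B m * cnj (B n) * e m n t)"
    proof (intro sum.cong refl)
      fix m n
      have "osc m t * cnj (osc n t) = e m n t"
        unfolding e_def by (simp add: exp_cnj exp_add[symmetric] algebra_simps)
      thus "B m * osc m t * cnj (B n * osc n t) = B m * cnj (B n) * e m n t"
        by (simp add: mult_ac)
    qed
    finally show ?thesis .
  qed
  define I where "I = (\<lambda>m n. integral {T..2*T} (e m n))"
  have h1: "((\<lambda>t. of_real ((norm (S t))\<^sup>2)) has_integral (\<Sum>m\<in>A. \<Sum>n\<in>A. B m * cnj (B n) * I m n)) {T..2*T}"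
    unfolding sq I_def
    by (intro has_integral_sum fin has_integral_mult_right integrable_integral integrable_continuous_interval ec)
  have h2: "((\<lambda>t. complex_of_real ((norm (S t))\<^sup>2)) has_integral of_real (integral {T..2*T} (\<lambda>t. (norm (S t))\<^sup>2))) {T..2*T}"
    by (intro has_integral_of_real integrable_integral integrable_continuous_interval continuous_intros Sc)
  have eq: "complex_of_real (integral {T..2*T} (\<lambda>t. (norm (S t))\<^sup>2)) = (\<Sum>m\<in>A. \<Sum>n\<in>A. B m * cnj (B n) * I m n)"
    by (rule has_integral_unique[OF h2 h1])
  have Ib: "norm (I m n) \<le> (if m = n then T else 0) + 2 * real N" if "m \<in> A" "n \<in> A" for m n
  proof (cases "m = n")
    case True
    have "e n n = (\<lambda>_. 1)" by (simp add: e_def)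
    hence "I m n = of_real T" using True T by (simp add: I_def scaleR_conv_of_real)
    thus ?thesis using True T by simp
  next
    case False
    have N0: "N > 0" using that A by force
    have th: "\<bar>ln (real n) - ln (real m)\<bar> \<ge> 1 / real N" by (rule abs_ln_diff_ge) (use False that A in auto)
    moreover have "1 / real N > 0" using N0 by simp
    ultimately have nz: "ln (real n) - ln (real m) \<noteq> 0" by linarith
    have "norm (I m n) \<le> 2 / \<bar>ln (real n) - ln (real m)\<bar>"
      unfolding I_def e_def by (rule norm_integral_exp_le[OF nz]) (use T in auto)
    also have "\<dots> \<le> 2 / (1 / real N)" using th nz N0 by (intro divide_left_mono mult_pos_pos) auto
    finally show ?thesis using False by simp
  qed
  have "integral {T..2*T} (\<lambda>t. (norm (S t))\<^sup>2) \<le> norm (complex_of_real (integral {T..2*T} (\<lambda>t. (norm (S t))\<^sup>2)))" by simp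
  also have "\<dots> \<le> (\<Sum>m\<in>A. \<Sum>n\<in>A. norm (B m) * norm (B n) * ((if m = n then T else 0) + 2 * real N))"
    unfolding eq
  proof (intro sum_norm_le)
    fix m n assume "m \<in> A" "n \<in> A"
    thus "norm (B m * cnj (B n) * I m n) \<le> norm (B m) * norm (B n) * ((if m = n then T else 0) + 2 * real N)"
      unfolding norm_mult complex_mod_cnj by (intro mult_left_mono Ib) auto
  qed
  also have "\<dots> = (\<Sum>m\<in>A. \<Sum>n\<in>A. (if m = n then T * (norm (B m))\<^sup>2 else 0) + 2 * real N * (norm (B m) * norm (B n)))"
    by (intro sum.cong refl) (auto simp: algebra_simps power2_eq_square)
  also have "\<dots> = T * (\<Sum>n\<in>A. (norm (B n))\<^sup>2) + 2 * real N * (\<Sum>n\<in>A. norm (B n))\<^sup>2"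
    unfolding sum.distrib using fin
    by (simp add: sum_distrib_left[symmetric] power2_eq_square sum_product)
  also have "\<dots> \<le> T * (\<Sum>n\<in>A. (norm (B n))\<^sup>2) + 2 * real N * ((\<Sum>n\<in>A. (norm (B n))\<^sup>2) * real N)"
  proof -
    have "(\<Sum>n\<in>A. norm (B n))\<^sup>2 \<le> (\<Sum>n\<in>A. (norm (B n))\<^sup>2) * card A"
      by (rule sum_squared_le_sum_of_squares)
    also have "\<dots> \<le> (\<Sum>n\<in>A. (norm (B n))\<^sup>2) * real N"
    proof -
      have "card A \<le> N" using card_mono[OF _ A] by simp
      thus ?thesis by (intro mult_left_mono sum_nonneg) auto
    qed
    finally show ?thesis by (intro add_left_mono mult_left_mono) auto
  qed
  also have "\<dots> = (T + 2 * real N ^ 2) * (\<Sum>n\<in>A. (norm (B n))\<^sup>2)" by (simp add: algebra_simps power2_eq_square)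
  finally show ?thesis unfolding S_def .
qed

text \<open>
  A product of \<open>k\<close> primes has at most \<open>k\<close> distinct prime factors, hence at most \<open>k ^ k\<close>
  representations as an ordered product of \<open>k\<close> primes.
\<close>

lemma prime_polynomial_moment:
  fixes c :: "nat \<Rightarrow> complex"
  assumes P: "P \<subseteq> {p. prime p \<and> p \<le> Y}" and T: "T \<ge> 0"
  shows "integral {T..2*T} (\<lambda>t. norm (\<Sum>p\<in>P. c p * osc p t) ^ (2 * k))
     \<le> (T + 2 * (real Y ^ k)\<^sup>2) * (real k ^ k * (\<Sum>p\<in>P. (norm (c p))\<^sup>2) ^ k)"
proof -
  have finP: "finite P" using P by (rule finite_subset) auto
  define E where "E = (PiE {..<k} (\<lambda>_. P) :: (nat \<Rightarrow> nat) set)"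
  have finE: "finite E" unfolding E_def by (intro finite_PiE finP) auto
  define \<pi> where "\<pi> = (\<lambda>f :: nat \<Rightarrow> nat. \<Prod>i<k. f i)"
  define A where "A = \<pi> ` E"
  have EP: "f i \<in> P" if "f \<in> E" "i < k" for f i using that by (auto simp: E_def)
  have Epr: "prime (f i)" "f i \<le> Y" if "f \<in> E" "i < k" for f i using EP[OF that] P by auto
  have A1: "A \<subseteq> {1..Y ^ k}"
  proof
    fix n assume "n \<in> A"
    then obtain f where f: "f \<in> E" "n = \<pi> f" by (auto simp: A_def)
    have "\<pi> f \<le> (\<Prod>i<k. Y)" unfolding \<pi>_def using Epr(2)[OF f(1)] by (intro prod_mono) auto
    moreover have "\<pi> f > 0" unfolding \<pi>_def using Epr(1)[OF f(1)] by (intro prod_pos) (auto simp: prime_gt_0_nat)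
    ultimately show "n \<in> {1..Y ^ k}" using f by simp
  qed
  define B where "B = (\<lambda>n. \<Sum>f\<in>{f \<in> E. \<pi> f = n}. \<Prod>i<k. c (f i))"
  define Q where "Q = (\<lambda>t. \<Sum>p\<in>P. c p * osc p t)"
  have Qk: "Q t ^ k = (\<Sum>n\<in>A. B n * osc n t)" for t :: real
  proof -
    have "Q t ^ k = (\<Prod>i<k. Q t)" by simp
    also have "\<dots> = (\<Sum>f\<in>E. \<Prod>i<k. c (f i) * osc (f i) t)"
      unfolding Q_def E_def by (rule prod_sum_PiE) (auto intro: finP)
    also have "\<dots> = (\<Sum>f\<in>E. (\<Prod>i<k. c (f i)) * osc (\<pi> f) t)"
    proof (rule sum.cong[OF refl])
      fix f assume f: "f \<in> E"
      have "ln (real (\<pi> f)) = (\<Sum>i<k. ln (real (f i)))"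
        unfolding \<pi>_def of_nat_prod using Epr(1)[OF f] by (intro ln_prod) (auto simp: prime_gt_0_nat)
      hence "osc (\<pi> f) t = exp (\<Sum>i<k. - (\<i> * of_real (ln (real (f i)) * t)))"
        by (simp add: sum_distrib_left sum_distrib_right sum_negf)
      also have "\<dots> = (\<Prod>i<k. osc (f i) t)" by (rule exp_sum) simp
      finally show "(\<Prod>i<k. c (f i) * osc (f i) t) =
         (\<Prod>i<k. c (f i)) * osc (\<pi> f) t" by (simp add: prod.distrib)
    qed
    also have "\<dots> = (\<Sum>n\<in>A. \<Sum>f\<in>{f \<in> E. \<pi> f = n}. (\<Prod>i<k. c (f i)) * osc (\<pi> f) t)"
      unfolding A_def by (rule sum.image_gen[OF finE])
    also have "\<dots> = (\<Sum>n\<in>A. B n * osc n t)"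
      unfolding B_def sum_distrib_right by (intro sum.cong refl) auto
    finally show ?thesis .
  qed
  have card: "card {f \<in> E. \<pi> f = n} \<le> k ^ k" if n: "n \<in> A" for n
  proof -
    obtain f0 where f0: "f0 \<in> E" "n = \<pi> f0" using n by (auto simp: A_def)
    \<comment> \<open>Each entry of f is a prime dividing the product of the entries of
      \<open>f0\<close>, hence equals one of them.\<close>
    have "{f \<in> E. \<pi> f = n} \<subseteq> PiE {..<k} (\<lambda>_. f0 ` {..<k})"
    proof
      fix f assume f: "f \<in> {f \<in> E. \<pi> f = n}"
      have "f i \<in> f0 ` {..<k}" if i: "i < k" for i
      proof -
        have "f i dvd \<pi> f" unfolding \<pi>_def using i by (intro dvd_prodI) auto
        hence "f i dvd (\<Prod>j<k. f0 j)" using f f0 by (simp add: \<pi>_def)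
        then obtain j where j: "j < k" "f i dvd f0 j"
          using Epr(1)[of f i] f i by (auto simp: prime_dvd_prod_iff)
        hence "f i = f0 j" using Epr(1)[of f i] Epr(1)[OF f0(1) j(1)] f i by (simp add: primes_dvd_imp_eq)
        thus ?thesis using j by auto
      qed
      thus "f \<in> PiE {..<k} (\<lambda>_. f0 ` {..<k})" using f unfolding E_def by (auto simp: PiE_iff)
    qed
    hence "card {f \<in> E. \<pi> f = n} \<le> card (PiE {..<k} (\<lambda>_. f0 ` {..<k}))" by (intro card_mono finite_PiE) auto
    also have "\<dots> = card (f0 ` {..<k}) ^ k" by (simp add: card_PiE)
    also have "\<dots> \<le> k ^ k" using card_image_le[of "{..<k}" f0] by (intro power_mono) auto
    finally show ?thesis .
  qed
  have "(\<Sum>n\<in>A. (norm (B n))\<^sup>2) \<le> (\<Sum>n\<in>A. \<Sum>f\<in>{f \<in> E. \<pi> f = n}. real k ^ k * (\<Prod>i<k. (norm (c (f i)))\<^sup>2))"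
  proof (rule sum_mono)
    fix n assume n: "n \<in> A"
    have "norm (B n) \<le> (\<Sum>f\<in>{f \<in> E. \<pi> f = n}. \<Prod>i<k. norm (c (f i)))"
      unfolding B_def by (rule sum_norm_le) (simp add: prod_norm)
    hence "(norm (B n))\<^sup>2 \<le> (\<Sum>f\<in>{f \<in> E. \<pi> f = n}. \<Prod>i<k. norm (c (f i)))\<^sup>2" by (intro power_mono) auto
    also have "\<dots> \<le> (\<Sum>f\<in>{f \<in> E. \<pi> f = n}. (\<Prod>i<k. norm (c (f i)))\<^sup>2) * card {f \<in> E. \<pi> f = n}"
      \<comment> \<open>Cauchy-Schwarz over the representations of n; their number is the only loss
        compared with the diagonal.\<close>
      by (rule sum_squared_le_sum_of_squares)
    also have "\<dots> \<le> (\<Sum>f\<in>{f \<in> E. \<pi> f = n}. (\<Prod>i<k. norm (c (f i)))\<^sup>2) * real (k ^ k)"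
      using card[OF n] by (intro mult_left_mono sum_nonneg) (auto simp del: of_nat_power)
    also have "\<dots> = (\<Sum>f\<in>{f \<in> E. \<pi> f = n}. real k ^ k * (\<Prod>i<k. (norm (c (f i)))\<^sup>2))"
      by (simp add: sum_distrib_left prod_power_distrib mult.commute)
    finally show "(norm (B n))\<^sup>2 \<le> (\<Sum>f\<in>{f \<in> E. \<pi> f = n}. real k ^ k * (\<Prod>i<k. (norm (c (f i)))\<^sup>2))" .
  qed
  also have "\<dots> = (\<Sum>f\<in>E. real k ^ k * (\<Prod>i<k. (norm (c (f i)))\<^sup>2))"
    unfolding A_def by (rule sum.image_gen[OF finE, symmetric])
  also have "\<dots> = real k ^ k * (\<Prod>i<k. \<Sum>p\<in>P. (norm (c p))\<^sup>2)"
    unfolding E_def by (subst prod_sum_PiE) (auto simp: sum_distrib_left finP)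
  also have "(\<Prod>i<k. \<Sum>p\<in>P. (norm (c p))\<^sup>2) = (\<Sum>p\<in>P. (norm (c p))\<^sup>2) ^ k" by simp
  finally have Bsum: "(\<Sum>n\<in>A. (norm (B n))\<^sup>2) \<le> real k ^ k * (\<Sum>p\<in>P. (norm (c p))\<^sup>2) ^ k" .
  have "norm (Q t) ^ (2 * k) = (norm (\<Sum>n\<in>A. B n * osc n t))\<^sup>2" for t
    unfolding Qk[symmetric] norm_power by (simp add: power_mult[symmetric] mult.commute)
  hence "integral {T..2*T} (\<lambda>t. norm (Q t) ^ (2 * k)) \<le> (T + 2 * real (Y ^ k) ^ 2) * (\<Sum>n\<in>A. (norm (B n))\<^sup>2)"
    using dirichlet_polynomial_mean_square[OF A1 T, of B] by simp
  also have "\<dots> \<le> (T + 2 * real (Y ^ k) ^ 2) * (real k ^ k * (\<Sum>p\<in>P. (norm (c p))\<^sup>2) ^ k)"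
    using Bsum T by (intro mult_left_mono) auto
  finally show ?thesis unfolding Q_def by simp
qed

text \<open>A set that is not measurable has measure 0 by convention, so monotonicity holds without
  knowing that A is measurable.\<close>

lemma measure_subset_le:
  assumes "A \<subseteq> B" "B \<in> lmeasurable"
  shows "measure lebesgue A \<le> measure lebesgue B"
proof (cases "A \<in> sets lebesgue")
  case True
  thus ?thesis using assms by (intro measure_mono_fmeasurable)
qed (simp add: measure_notin_sets)

text \<open>Markov's inequality for the m-th power, on the superlevel set of Q, which is compact by
  continuity.\<close>

lemma measure_large_values_le:
  fixes Q :: "real \<Rightarrow> complex"
  assumes Q: "continuous_on {u..v} Q" and V: "V \<ge> 0" and A: "A \<subseteq> {t \<in> {u..v}. norm (Q t) \<ge> V}"
  shows "V ^ m * measure lebesgue A \<le> integral {u..v} (\<lambda>t. norm (Q t) ^ m)"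
proof -
  define E where "E = {t \<in> {u..v}. norm (Q t) \<ge> V}"
  have "closed E" unfolding E_def
    using continuous_closed_preimage[OF continuous_on_norm[OF Q] closed_atLeastAtMost closed_atLeast[of V]]
    by (simp add: vimage_def Int_def)
  moreover have "bounded E" by (rule bounded_subset[OF bounded_closed_interval[of u v]]) (auto simp: E_def)
  ultimately have "compact E" by (simp add: compact_eq_bounded_closed)
  hence lE: "E \<in> lmeasurable" by (rule lmeasurable_compact)
  have c: "(\<lambda>t. norm (Q t) ^ m) absolutely_integrable_on {u..v}"
    by (rule absolutely_integrable_continuous_real) (intro continuous_intros Q)
  have cE: "(\<lambda>t. norm (Q t) ^ m) integrable_on E"
  proof -
    have "E \<subseteq> {u..v}" by (auto simp: E_def)
    from set_integrable_subset[OF c fmeasurableD[OF lE] this] show ?thesis by (rule set_lebesgue_integral_eq_integral(1))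
  qed
  have one: "(\<lambda>t. 1::real) integrable_on E" using lE by (simp add: lmeasurable_iff_integrable_on)
  have "V ^ m * measure lebesgue A \<le> V ^ m * measure lebesgue E"
    using A V lE unfolding E_def by (intro mult_left_mono measure_subset_le) auto
  also have "V ^ m * measure lebesgue E = integral E (\<lambda>t. V ^ m * 1)"
    by (simp only: integral_mult_right lmeasure_integral[OF lE])
  also have "\<dots> \<le> integral E (\<lambda>t. norm (Q t) ^ m)"
    using one cE V by (intro integral_le integrable_on_mult_right) (auto simp: E_def intro!: power_mono)
  also have "\<dots> \<le> integral {u..v} (\<lambda>t. norm (Q t) ^ m)"
    using cE c by (intro integral_subset_le) (auto simp: E_def intro: set_lebesgue_integral_eq_integral(1))
  finally show ?thesis .
qed

section \<open>Large deviations\<close>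

abbreviation (input) prime_range :: "real \<Rightarrow> nat set" where
  "prime_range b \<equiv> {p. prime p \<and> p \<le> nat \<lfloor>exp (4/b)\<rfloor>}"

text \<open>The proper prime powers contribute O(1 / b), hence O(ln T), and move into the error
  term. The remaining coefficients depend on b only, not on t, so moments over t apply.\<close>

lemma log_deriv_le_prime_polynomial:
  assumes RH: "riemann_hypothesis"
  obtains C C' and c :: "real \<Rightarrow> nat \<Rightarrow> complex" where "C > 0" "C' > 0"
    "\<And>b. 0 < b \<Longrightarrow> b \<le> 1/8 \<Longrightarrow> (\<Sum>p\<in>prime_range b. (norm (c b p))\<^sup>2) \<le> C' / b\<^sup>2"
    "\<And>T t a b. T \<ge> 8 \<Longrightarrow> T \<le> t \<Longrightarrow> t \<le> 2 * T \<Longrightarrow> 0 < a \<Longrightarrow> a \<le> b \<Longrightarrow> b \<le> 1/8 \<Longrightarrow> 6 \<le> b * ln T \<Longrightarrow>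
      norm (log_deriv_zeta (Complex (1/2 + a) t)) \<le>
      C * (b / a) * (norm (\<Sum>p\<in>prime_range b. c b p * osc p t) + ln T)"
proof -
  obtain C1 and W :: "real \<Rightarrow> complex" where C1: "C1 > 0" and W: "\<And>\<omega>. norm (W \<omega>) \<le> 6" and
    main: "\<And>T t a b. T \<ge> 8 \<Longrightarrow> T \<le> t \<Longrightarrow> t \<le> 2 * T \<Longrightarrow> 0 < a \<Longrightarrow> a \<le> b \<Longrightarrow> b \<le> 1/8 \<Longrightarrow> 6 \<le> b * ln T \<Longrightarrow>
      norm (log_deriv_zeta (Complex (1/2 + a) t)) \<le>
      C1 * (b / a) * (norm (mangoldt_poly W b t) + ln T)"
    using log_deriv_le_dirichlet_polynomial[OF RH] by blast
  obtain Cq where Cq: "Cq > 0"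
    "\<And>y. y \<ge> 1 \<Longrightarrow> (\<Sum>p | prime p \<and> p \<le> nat \<lfloor>exp y\<rfloor>. (ln (real p))\<^sup>2 / real p) \<le> Cq * y\<^sup>2"
    "\<And>y. y \<ge> 1 \<Longrightarrow> (\<Sum>n | n \<in> {1..nat \<lfloor>exp y\<rfloor>} \<and> \<not> prime n. mangoldt n / sqrt (real n)) \<le> Cq * y"
    using prime_log_sums by blast
  define c where "c = (\<lambda>b p. of_real (ln (real p)) * W (b * ln (real p)) * of_real (real p powr (- (1/2 + b))) :: complex)"
  have half: "real n powr (- (1/2 + b)) \<le> 1 / sqrt (real n)" if "n > 0" "b > 0" for n :: nat and b :: real
  proof -
    have "real n powr (- (1/2 + b)) \<le> real n powr (- (1/2))" using that by (intro powr_mono) auto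
    also have "\<dots> = 1 / sqrt (real n)" using that by (simp add: powr_minus_divide powr_half_sqrt)
    finally show ?thesis .
  qed
  show ?thesis
  \<comment> \<open>576 = 36 * 16, where 36 is the square of the bound 6 for W and 16 / b^2 is the
    square of the logarithmic length 4 / b.\<close>
  proof (rule that[of "C1 * (1 + 4 * Cq)" "576 * Cq" c])
    show "C1 * (1 + 4 * Cq) > 0" "576 * Cq > 0" using C1 Cq(1) by auto
  next
    fix b :: real assume b: "0 < b" "b \<le> 1/8"
    have "(\<Sum>p\<in>prime_range b. (norm (c b p))\<^sup>2) \<le>
      (\<Sum>p\<in>prime_range b. 36 * ((ln (real p))\<^sup>2 / real p))"
    proof (rule sum_mono)
      fix p assume "p \<in> prime_range b"
      hence p: "p \<ge> 1" by (auto simp: Suc_le_eq prime_gt_0_nat)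
      have "norm (c b p) \<le> ln (real p) * 6 * (1 / sqrt (real p))"
        unfolding c_def norm_mult using p half[of p b] b W by (intro mult_mono) auto
      hence "(norm (c b p))\<^sup>2 \<le> (ln (real p) * 6 * (1 / sqrt (real p)))\<^sup>2" by (intro power_mono) auto
      also have "\<dots> = 36 * ((ln (real p))\<^sup>2 / real p)" using p by (simp add: power_mult_distrib power_divide)
      finally show "(norm (c b p))\<^sup>2 \<le> 36 * ((ln (real p))\<^sup>2 / real p)" .
    qed
    also have "\<dots> = 36 * (\<Sum>p\<in>prime_range b. (ln (real p))\<^sup>2 / real p)" by (simp add: sum_distrib_left)
    also have "\<dots> \<le> 36 * (Cq * (4/b)\<^sup>2)" using b by (intro mult_left_mono Cq(2)) (auto simp: field_simps)
    also have "\<dots> = 576 * Cq / b\<^sup>2" by (simp add: power_divide)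
    finally show "(\<Sum>p\<in>prime_range b. (norm (c b p))\<^sup>2) \<le> 576 * Cq / b\<^sup>2" .
  next
    fix T t a b :: real
    assume T: "T \<ge> 8" "T \<le> t" "t \<le> 2 * T" "0 < a" "a \<le> b" "b \<le> 1/8" "6 \<le> b * ln T"
    have b: "b > 0" using T by simp
    define N where "N = nat \<lfloor>exp (4/b)\<rfloor>"
    define D where "D = (\<Sum>n\<in>{1..N}. mangoldt n * W (b * ln n) * of_nat n powr (- Complex (1/2 + b) t))"
    define D1 where "D1 = (\<Sum>p | prime p \<and> p \<le> N. c b p * osc p t)"
    have split: "{1..N} = {p. prime p \<and> p \<le> N} \<union> {n. n \<in> {1..N} \<and> \<not> prime n}" by (auto simp: Suc_le_eq prime_gt_0_nat)
    define D2 where "D2 = (\<Sum>n | n \<in> {1..N} \<and> \<not> prime n. mangoldt n * W (b * ln n) * of_nat n powr (- Complex (1/2 + b) t))"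
    have "D = (\<Sum>p | prime p \<and> p \<le> N. mangoldt p * W (b * ln p) * of_nat p powr (- Complex (1/2 + b) t)) + D2"
      unfolding D_def D2_def by (subst split, rule sum.union_disjoint) auto
    also have "(\<Sum>p | prime p \<and> p \<le> N. mangoldt p * W (b * ln p) * of_nat p powr (- Complex (1/2 + b) t)) = D1"
      unfolding D1_def
    proof (rule sum.cong[OF refl])
      fix p assume "p \<in> {p. prime p \<and> p \<le> N}"
      thus "mangoldt p * W (b * ln p) * of_nat p powr (- Complex (1/2 + b) t) = c b p * osc p t"
        unfolding c_def by (subst nat_powr_vertical) (auto simp: prime_gt_0_nat)
    qed
    finally have DD: "D = D1 + D2" .
    have "norm D2 \<le> (\<Sum>n | n \<in> {1..N} \<and> \<not> prime n. 6 * (mangoldt n / sqrt (real n)))"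
      unfolding D2_def
    proof (rule sum_norm_le)
      fix n assume "n \<in> {n. n \<in> {1..N} \<and> \<not> prime n}"
      hence n: "n > 0" by auto
      have "norm (mangoldt n * W (b * ln n) * of_nat n powr (- Complex (1/2 + b) t)) \<le> mangoldt n * 6 * (1 / sqrt (real n))"
        unfolding norm_mult norm_nat_powr[OF n] using half[OF n b] W by (intro mult_mono) (auto simp: mangoldt_nonneg)
      thus "norm (mangoldt n * W (b * ln n) * of_nat n powr (- Complex (1/2 + b) t)) \<le> 6 * (mangoldt n / sqrt (real n))"
        by (simp add: mult_ac)
    qed
    also have "\<dots> = 6 * (\<Sum>n | n \<in> {1..N} \<and> \<not> prime n. mangoldt n / sqrt (real n))" by (simp add: sum_distrib_left)
    also have "\<dots> \<le> 6 * (Cq * (4 / b))" unfolding N_def using b T by (intro mult_left_mono Cq(3)) (auto simp: field_simps)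
    also have "\<dots> = 4 * Cq * (6 / b)" by simp
    also have "\<dots> \<le> 4 * Cq * ln T" using T b Cq(1) by (intro mult_left_mono) (auto simp: field_simps)
    finally have D2: "norm D2 \<le> 4 * Cq * ln T" .
    have L: "ln T \<ge> 0" using T by simp
    have "norm D + ln T \<le> norm D1 + (1 + 4 * Cq) * ln T"
      using D2 norm_triangle_ineq[of D1 D2] unfolding DD by (simp add: algebra_simps)
    also have "\<dots> \<le> (1 + 4 * Cq) * norm D1 + (1 + 4 * Cq) * ln T" using Cq(1) by (simp add: algebra_simps)
    finally have le: "norm D + ln T \<le> (1 + 4 * Cq) * (norm D1 + ln T)" by (simp only: distrib_left)
    have "norm (log_deriv_zeta (Complex (1/2 + a) t)) \<le> C1 * (b / a) * (norm D + ln T)"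
      unfolding D_def N_def by (rule main[OF T])
    also have "\<dots> \<le> C1 * (b / a) * ((1 + 4 * Cq) * (norm D1 + ln T))"
      using le C1 b T by (intro mult_left_mono) auto
    also have "\<dots> = C1 * (1 + 4 * Cq) * (b / a) * (norm D1 + ln T)" by (simp only: mult_ac)
    finally show "norm (log_deriv_zeta (Complex (1/2 + a) t)) \<le>
      C1 * (1 + 4 * Cq) * (b / a) * (norm (\<Sum>p\<in>prime_range b. c b p * osc p t) + ln T)"
      unfolding D1_def N_def .
  qed
qed

lemma large_values_large_T:
  assumes RH: "riemann_hypothesis" and \<alpha>: "\<alpha> > 0"
  obtains c x0 T0 where "c > 0" "x0 \<ge> 2" "T0 \<ge> 2"
    "\<And>x T. x \<ge> x0 \<Longrightarrow> T \<ge> T0 \<Longrightarrow>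
       measure lebesgue {t \<in> {T..2*T}.
         norm (log_deriv_zeta (Complex (1/2 + \<alpha> / ln T) t)) \<ge> x * ln T}
       \<le> 3 * T * exp (- c * x * ln x)"
proof -
  obtain C C' and c :: "real \<Rightarrow> nat \<Rightarrow> complex" where C: "C > 0" and C': "C' > 0" and
    csum: "\<And>b. 0 < b \<Longrightarrow> b \<le> 1/8 \<Longrightarrow> (\<Sum>p\<in>prime_range b. (norm (c b p))\<^sup>2) \<le> C' / b\<^sup>2" and
    main: "\<And>T t a b. T \<ge> 8 \<Longrightarrow> T \<le> t \<Longrightarrow> t \<le> 2 * T \<Longrightarrow> 0 < a \<Longrightarrow> a \<le> b \<Longrightarrow> b \<le> 1/8 \<Longrightarrow> 6 \<le> b * ln T \<Longrightarrow>
      norm (log_deriv_zeta (Complex (1/2 + a) t)) \<le>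
      C * (b / a) * (norm (\<Sum>p\<in>prime_range b. c b p * osc p t) + ln T)"
    using log_deriv_le_prime_polynomial[OF RH] by blast
  obtain Cp where Cp: "Cp > 0"
    "\<And>s. Re s > 1/2 \<Longrightarrow> Re s \<le> 2 \<Longrightarrow> Im s \<ge> 4 \<Longrightarrow> norm (log_deriv_zeta s) \<le> Cp * ln (Im s) / (Re s - 1/2)"
    using zeta_log_deriv_pointwise[OF RH] by blast
  \<comment> \<open>The second bound makes \<open>C * b / a\<close> at most x / 2, which leaves half
    of the assumed size for the polynomial. The first makes the pointwise bound exclude large values
    when \<open>c0 * x\<close> exceeds L / 8.\<close>
  define c0 where "c0 = min (\<alpha> / (32 * Cp)) (\<alpha> / (2 * C))"
  have c0: "c0 > 0" "c0 \<le> \<alpha> / (32 * Cp)" "c0 \<le> \<alpha> / (2 * C)" using \<alpha> Cp(1) C by (auto simp: c0_def)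
  \<comment> \<open>Chosen so that k times the variance, (c0 x / 8) (C' L^2 / (c0 x)^2), equals L^2
    R / x.\<close>
  define R where "R = C' / (8 * c0)"
  have R: "R > 0" using C' c0 by (simp add: R_def)
  \<comment> \<open>The bound alpha / c0 gives \<open>a <= b\<close>, 8 / c0 gives
    \<open>k >= 1\<close> and \<open>6 <= b * L\<close>, and R^2 gives
    \<open>R / x <= 1 / sqrt x\<close>.\<close>
  define x0 where "x0 = max 2 (max (\<alpha> / c0) (max (8 / c0) (R\<^sup>2)))"
  define T0 where "T0 = max 8 (exp \<alpha>)"
  show ?thesis
  proof (rule that[of "c0 / 32" x0 T0])
    show "c0 / 32 > 0" "x0 \<ge> 2" "T0 \<ge> 2" using c0 by (auto simp: x0_def T0_def)
    fix x T :: real assume x: "x \<ge> x0" and T': "T \<ge> T0"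
    have x2: "x \<ge> 2" "x \<ge> \<alpha> / c0" "x \<ge> 8 / c0" "x \<ge> R\<^sup>2" using x by (auto simp: x0_def)
    have cx: "c0 * x \<ge> \<alpha>" "c0 * x \<ge> 8" using x2 c0(1) by (auto simp: field_simps)
    have T: "T \<ge> 8" "exp \<alpha> \<le> T" using T' by (auto simp: T0_def)
    define L where "L = ln T"
    have L\<alpha>: "L \<ge> \<alpha>" unfolding L_def using T by (subst ln_ge_iff) auto
    have L: "L > 0" using L\<alpha> \<alpha> by simp
    define a where "a = \<alpha> / L"
    have a: "a > 0" "a \<le> 1" using L L\<alpha> \<alpha> by (auto simp: a_def)
    define F where "F = (\<lambda>t. log_deriv_zeta (Complex (1/2 + a) t))"
    define A where "A = {t \<in> {T..2*T}. norm (F t) \<ge> x * L}"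
    have "measure lebesgue A \<le> 3 * T * exp (- (c0 / 32) * x * ln x)"
    proof (cases "c0 * x \<le> L / 8")
      case False
      have "norm (F t) < x * L" if t: "t \<in> {T..2*T}" for t
      proof -
        have "norm (F t) \<le> Cp * ln t / a" using Cp(2)[of "Complex (1/2 + a) t"] a t T by (simp add: F_def)
        also have "\<dots> \<le> Cp * (2 * L) / a"
        proof -
          have "2 * T \<le> T * T" using T by (intro mult_right_mono) auto
          hence "t \<le> T * T" using t by auto
          hence "ln t \<le> ln (T * T)" using t T by (intro ln_mono) auto
          hence "ln t \<le> 2 * L" using T by (simp add: ln_mult L_def)
          thus ?thesis using Cp(1) a by (intro divide_right_mono mult_left_mono) auto
        qed
        also have "\<dots> = 2 * Cp * L / \<alpha> * L" using L \<alpha> by (simp add: a_def)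
        also have "\<dots> < x * L"
        proof -
          have "2 * Cp * L < 16 * Cp * (c0 * x)" using False Cp(1) by simp
          also have "\<dots> = (16 * Cp * c0) * x" by simp
          also have "\<dots> \<le> \<alpha> * x" 
          proof -
            have "c0 * (32 * Cp) \<le> \<alpha>" using c0(2) Cp(1) by (simp add: pos_le_divide_eq)
            hence "16 * Cp * c0 \<le> \<alpha>" using Cp(1) c0(1) \<alpha> by (simp add: mult_ac)
            thus ?thesis using x2 by (intro mult_right_mono) auto
          qed
          finally have "2 * Cp * L / \<alpha> < x" using \<alpha> by (simp add: pos_divide_less_eq mult.commute)
          thus ?thesis using L by (rule mult_strict_right_mono)
        qed
        finally show ?thesis .
      qed
      hence "A = {}" by (fastforce simp: A_def)
      thus ?thesis using T by simp
    next
      case True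
      define b where "b = c0 * x / L"
      have bL: "b * L = c0 * x" using L by (simp add: b_def)
      have b: "b > 0" "b \<le> 1/8" "a \<le> b" "6 \<le> b * ln T" 
        using cx c0 x2 L True bL unfolding L_def[symmetric] by (auto simp: b_def a_def field_simps)
      define N where "N = nat \<lfloor>exp (4/b)\<rfloor>"
      define Q where "Q = (\<lambda>t. \<Sum>p | prime p \<and> p \<le> N. c b p * osc p t)"
      have Qc: "continuous_on S Q" for S unfolding Q_def by (intro continuous_intros)
      have sub: "A \<subseteq> {t \<in> {T..2*T}. norm (Q t) \<ge> L}"
      proof
        fix t assume t: "t \<in> A"
        hence tT: "T \<le> t" "t \<le> 2 * T" "x * L \<le> norm (F t)" by (auto simp: A_def)
        have "x * L \<le> C * (b / a) * (norm (Q t) + L)"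
          using tT(3) main[OF T(1) tT(1,2) a(1) b(3,2,4)] unfolding F_def Q_def N_def L_def by linarith
        also have "b / a = c0 * x / \<alpha>" using L \<alpha> by (simp add: b_def a_def)
        also have "C * (c0 * x / \<alpha>) * (norm (Q t) + L) \<le> (x / 2) * (norm (Q t) + L)"
        proof (rule mult_right_mono)
          have "c0 * (2 * C) \<le> \<alpha>" using c0(3) C by (simp add: pos_le_divide_eq)
          hence "(c0 * (2 * C)) * x \<le> \<alpha> * x" using x2 by (intro mult_right_mono) auto
          thus "C * (c0 * x / \<alpha>) \<le> x / 2" using \<alpha> by (simp add: field_simps)
        qed (use L in auto)
        finally have "x * L \<le> x * ((norm (Q t) + L) / 2)" by simp
        hence "L \<le> (norm (Q t) + L) / 2" using x2 by simp
        thus "t \<in> {t \<in> {T..2*T}. norm (Q t) \<ge> L}" using tT by simp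
      qed
      \<comment> \<open>The largest order with \<open>8 * k / b <= L\<close>, that is, with the k-th
        power of the polynomial no longer than the square root of T. As \<open>c0 * x / 8\<close> is
        at least 1, rounding down loses at most a factor 2.\<close>
      define k where "k = nat \<lfloor>c0 * x / 8\<rfloor>"
      have k: "real k \<le> c0 * x / 8" "real k \<ge> c0 * x / 16"
      proof -
        have "1 \<le> \<lfloor>c0 * x / 8\<rfloor>" using cx by (simp add: le_floor_iff)
        hence "real k = of_int \<lfloor>c0 * x / 8\<rfloor>" "real k \<ge> 1" by (auto simp: k_def)
        thus "real k \<le> c0 * x / 8" "real k \<ge> c0 * x / 16" by linarith+
      qed
      define S where "S = (\<Sum>p | prime p \<and> p \<le> N. (norm (c b p))\<^sup>2)"
      have S: "0 \<le> S" "S \<le> C' / b\<^sup>2" using csum[OF b(1,2)] by (auto simp: S_def N_def intro!: sum_nonneg)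
      have NT: "(real N ^ k)\<^sup>2 \<le> T"
      proof -
        have "real N \<le> exp (4 / b)" unfolding N_def by simp
        hence "real N ^ (k * 2) \<le> exp (4 / b) ^ (k * 2)" by (intro power_mono) auto
        also have "\<dots> = exp (8 * real k / b)" by (simp add: exp_of_nat_mult[symmetric])
        also have "8 * real k / b \<le> L"
        proof -
          have "8 * real k \<le> c0 * x" using k by simp
          thus ?thesis using b(1) bL by (simp add: field_simps)
        qed
        hence "exp (8 * real k / b) \<le> exp L" by simp
        also have "exp L = T" using T by (simp add: L_def)
        finally show ?thesis by (simp add: power_mult)
      qed
      have "L ^ (2 * k) * measure lebesgue A \<le> integral {T..2*T} (\<lambda>t. norm (Q t) ^ (2 * k))"
        by (rule measure_large_values_le[OF Qc _ sub]) (use L in auto)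
      also have "\<dots> \<le> (T + 2 * (real N ^ k)\<^sup>2) * (real k ^ k * S ^ k)"
        unfolding Q_def S_def by (rule prime_polynomial_moment) (use T in auto)
      also have "\<dots> \<le> (3 * T) * (real k ^ k * S ^ k)" using NT S by (intro mult_right_mono) auto
      also have "real k ^ k * S ^ k = (real k * S) ^ k" by (simp add: power_mult_distrib)
      also have "3 * T * (real k * S) ^ k \<le> 3 * T * (L\<^sup>2 * (R / x)) ^ k"
      proof (intro mult_left_mono power_mono)
        have "real k * S \<le> (c0 * x / 8) * (C' / b\<^sup>2)" using k S by (intro mult_mono) auto
        also have "\<dots> = L\<^sup>2 * (R / x)" using L c0 x2 by (simp add: b_def R_def power2_eq_square field_simps)
        finally show "real k * S \<le> L\<^sup>2 * (R / x)" .
      qed (use S T in auto)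
      also have "(L\<^sup>2 * (R / x)) ^ k = L ^ (2 * k) * (R / x) ^ k" by (simp only: power_mult_distrib power_mult)
      finally have "L ^ (2 * k) * measure lebesgue A \<le> L ^ (2 * k) * (3 * T * (R / x) ^ k)"
        by (simp only: mult_ac)
      hence mA: "measure lebesgue A \<le> 3 * T * (R / x) ^ k" using L by simp
      \<comment> \<open>From \<open>R <= sqrt x\<close> each factor saves sqrt x; with k at least c0
        x / 16 the exponent becomes c0 / 32.\<close>
      have "(R / x) ^ k \<le> exp (- (c0 / 32) * x * ln x)"
      proof -
        have "R \<le> sqrt x" using x2(4) R by (intro real_le_rsqrt) auto
        also have "sqrt x = exp (ln x / 2)" using x2 by (simp add: powr_half_sqrt[symmetric] powr_def)
        finally have "R / x \<le> exp (ln x / 2) / exp (ln x)" using x2 by (simp add: divide_right_mono)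
        also have "\<dots> = exp (- (ln x / 2))" by (simp add: exp_diff[symmetric])
        finally have "(R / x) ^ k \<le> exp (- (ln x / 2)) ^ k" using R x2 by (intro power_mono) auto
        also have "\<dots> = exp (- (real k * (ln x / 2)))" by (simp add: exp_of_nat_mult[symmetric])
        also have "\<dots> \<le> exp (- (c0 / 32) * x * ln x)"
        proof -
          have "(c0 * x / 16) * (ln x / 2) \<le> real k * (ln x / 2)" using k x2 by (intro mult_right_mono) auto
          thus ?thesis by simp
        qed
        finally show ?thesis .
      qed
      hence "3 * T * (R / x) ^ k \<le> 3 * T * exp (- (c0 / 32) * x * ln x)" using T by (intro mult_left_mono) auto
      thus ?thesis using mA by linarith
    qed
    thus "measure lebesgue {t \<in> {T..2*T}.
         norm (log_deriv_zeta (Complex (1/2 + \<alpha> / ln T) t)) \<ge> x * ln T}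
       \<le> 3 * T * exp (- (c0 / 32) * x * ln x)"
      unfolding A_def F_def a_def L_def .
  qed
qed

text \<open>As alpha / ln T is monotone in T, all points in question lie in one compact rectangle
  strictly to the right of the critical line and above the pole.\<close>

lemma log_deriv_bounded_small_T:
  assumes RH: "riemann_hypothesis" and \<alpha>: "\<alpha> > 0" and T0: "T0 \<ge> 2"
  obtains M where "\<And>T t. 2 \<le> T \<Longrightarrow> T \<le> T0 \<Longrightarrow> t \<in> {T..2*T} \<Longrightarrow>
    norm (log_deriv_zeta (Complex (1/2 + \<alpha> / ln T) t)) \<le> M"
proof -
  define Bx where "Bx = cbox (Complex (1/2 + \<alpha> / ln T0) 2) (Complex (1/2 + \<alpha> / ln 2) (2 * T0))"
  have pos: "\<alpha> / ln T0 > 0" using \<alpha> T0 by simp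
  have Bx: "Re s > 1/2" "Im s \<ge> 2" if "s \<in> Bx" for s
    using that pos by (auto simp: Bx_def in_cbox_complex_iff)
  define R where "R = {s::complex. Re s > 1/2} \<inter> {s. Im s > 0}"
  have op: "open R" unfolding R_def by (intro open_Int open_halfspace_Re_gt open_halfspace_Im_gt)
  have "continuous_on R log_deriv_zeta"
    by (intro holomorphic_on_imp_continuous_on holomorphic_zeta_log_deriv[OF RH] op) (auto simp: R_def)
  moreover have "Bx \<subseteq> R" using Bx by (force simp: R_def)
  ultimately have "compact ((\<lambda>s. log_deriv_zeta s) ` Bx)"
    unfolding Bx_def by (intro compact_continuous_image compact_cbox) (auto intro: continuous_on_subset)
  then obtain M where M: "\<And>s. s \<in> Bx \<Longrightarrow> norm (log_deriv_zeta s) \<le> M"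
    unfolding compact_eq_bounded_closed bounded_iff by blast
  show ?thesis
  proof (rule that[of M], rule M)
    fix T t :: real assume T: "2 \<le> T" "T \<le> T0" "t \<in> {T..2*T}"
    have "\<alpha> / ln T0 \<le> \<alpha> / ln T" "\<alpha> / ln T \<le> \<alpha> / ln 2" using T \<alpha> T0 by (auto intro!: divide_left_mono mult_pos_pos)
    thus "Complex (1/2 + \<alpha> / ln T) t \<in> Bx" using T by (simp add: Bx_def in_cbox_complex_iff)
  qed
qed

theorem theorem1p3:
  fixes \<alpha> :: real
  assumes "riemann_hypothesis" and "\<alpha> > 0"
  shows "\<exists>C>0. \<exists>K>0. \<forall>x\<ge>2. \<forall>T\<ge>2.
    1 / T * measure lebesgue {t \<in> {T..2*T}.
      1 / ln T * norm (deriv zeta (1/2 + of_real (\<alpha> / ln T) + \<i> * of_real t)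
                       / zeta (1/2 + of_real (\<alpha> / ln T) + \<i> * of_real t)) \<ge> x}
    \<le> K * exp (- C * x * ln x)"
proof -
  define A where "A = (\<lambda>x T. {t \<in> {T..2*T}.
         norm (log_deriv_zeta (Complex (1/2 + \<alpha> / ln T) t)) \<ge> x * ln T})"
  obtain c x0 T0 where c: "c > 0" "x0 \<ge> 2" "T0 \<ge> 2"
    "\<And>x T. x \<ge> x0 \<Longrightarrow> T \<ge> T0 \<Longrightarrow> measure lebesgue (A x T) \<le> 3 * T * exp (- c * x * ln x)"
    using large_values_large_T[OF assms] unfolding A_def by blast
  obtain M where M: "\<And>T t. 2 \<le> T \<Longrightarrow> T \<le> T0 \<Longrightarrow> t \<in> {T..2*T} \<Longrightarrow>
    norm (log_deriv_zeta (Complex (1/2 + \<alpha> / ln T) t)) \<le> M"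
    using log_deriv_bounded_small_T[OF assms c(3)] by blast
  \<comment> \<open>Since \<open>ln T >= ln 2\<close>, every \<open>x >= X\<close> has
    \<open>x * ln T > M\<close>, so for \<open>T <= T0\<close> the set of large values is
    empty.\<close>
  define X where "X = max x0 (M / ln 2 + 1)"
  \<comment> \<open>The 3 comes from the moment bound; for x < X the exponential makes the
    right-hand side at least 1, which bounds any proportion of [T, 2T].\<close>
  define K where "K = 3 + exp (c * X * ln X)"
  have "1 / T * measure lebesgue (A x T) \<le> K * exp (- c * x * ln x)" if x: "x \<ge> 2" and T: "T \<ge> 2" for x T
  proof (cases "x \<ge> X")
    case True
    show ?thesis
    proof (cases "T \<ge> T0")
      case T0: True
      have "x \<ge> x0" using True by (simp add: X_def)
      hence "1 / T * measure lebesgue (A x T) \<le> 1 / T * (3 * T * exp (- c * x * ln x))"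
        using c(4)[OF _ T0] T by (intro mult_left_mono) auto
      also have "\<dots> = 3 * exp (- c * x * ln x)" using T by simp
      also have "\<dots> \<le> K * exp (- c * x * ln x)" by (intro mult_right_mono) (auto simp: K_def)
      finally show ?thesis .
    next
      case False
      have "norm (log_deriv_zeta (Complex (1/2 + \<alpha> / ln T) t)) < x * ln T"
        if t: "t \<in> {T..2*T}" for t
      proof -
        have "M < (M / ln 2 + 1) * ln 2" by (simp add: field_simps)
        also have "\<dots> \<le> x * ln 2" using True by (intro mult_right_mono) (auto simp: X_def)
        also have "\<dots> \<le> x * ln T" using x T by (intro mult_left_mono) auto
        finally show ?thesis using M[OF T _ t] False by linarith
      qed
      hence "A x T = {}" by (fastforce simp: A_def)
      thus ?thesis by (simp add: K_def)
    qed
  next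
    case False
    have "measure lebesgue (A x T) \<le> measure lebesgue {T..2*T}"
      by (rule measure_subset_le) (auto simp: A_def)
    hence "1 / T * measure lebesgue (A x T) \<le> 1 / T * T" using T by (intro mult_left_mono) auto
    also have "\<dots> = 1" using T by simp
    also have "1 \<le> exp (c * X * ln X) * exp (- c * x * ln x)"
    proof -
      have "x * ln x \<le> X * ln X" using False x by (intro mult_mono) auto
      hence "c * (x * ln x) \<le> c * (X * ln X)" using c(1) by (intro mult_left_mono) auto
      thus ?thesis by (simp add: exp_add[symmetric] mult.assoc)
    qed
    also have "\<dots> \<le> K * exp (- c * x * ln x)" by (intro mult_right_mono) (auto simp: K_def)
    finally show ?thesis .
  qed
  moreover have "{t \<in> {T..2*T}. 1 / ln T * norm (deriv zeta (1/2 + of_real (\<alpha> / ln T) + \<i> * of_real t)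
                       / zeta (1/2 + of_real (\<alpha> / ln T) + \<i> * of_real t)) \<ge> x} = A x T" if "T \<ge> 2" for x T
  proof -
    have "1/2 + of_real (\<alpha> / ln T) + \<i> * of_real t = Complex (1/2 + \<alpha> / ln T) t" for t
      by (simp add: complex_eq_iff)
    moreover have "ln T > 0" using that by simp
    ultimately show ?thesis unfolding A_def by (simp add: pos_le_divide_eq)
  qed
  ultimately show ?thesis using c(1)
    by (intro exI[of _ c] conjI exI[of _ K] allI impI) (auto simp: K_def add_pos_pos)
qed

end
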